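(* In the missing-data setting described in the context, assume: (A0) $g(\mathbf{x},\beta)$ is twice continuously differentiable in $\beta$ and there is $\delta>0$ with $\mathrm{E}_{Q_0}\sup_{\|\beta-\beta_0\|\le\delta}\|\dot g(\mathbf{x}_1,\beta)\|^2<\infty$ and $\mathrm{E}_{Q_0}\sup_{\|\beta-\beta_0\|\le\delta}\|\ddot g(\mathbf{x}_1,\beta)\|<\infty$; (A1) $\widehat\beta_n\to\beta_0$ a.s.; (A2) $\sqrt n(\widehat\beta_n-\beta_0)=n^{-1/2}\sum_{i=1}^n a_iI_R(\mathbf{x}_i,y_i)+o_P(1)$ for some function $I_R$ with $\mathrm{E}\,a_iI_R(\mathbf{x}_i,y_i)=0$ and finite second moments; (A3) $T_L$ is weakly continuous at $F_0$; (A4) $\sqrt n\,(T_L(\widehat F_n)-T_L(F_0))=\sqrt n\,\mathrm{E}_{\widehat F_n}I_L(y)+o_P(1)$ for some differentiable function $I_L$ with $\mathrm{E}_{F_0}I_L(y)=0$, $\mathrm{E}_{F_0}I_L^2(y)<\infty$ and $|I_L'(y)|$ bounded. Define $\eta=\mathrm{E}a_i$, $$\mathbf{c}=\mathrm{E}\big[a_1I_L'(y_1-g(\mathbf{x}_1,\beta_0)+g(\mathbf{x}_2,\beta_0))\{\dot g(\mathbf{x}_2,\beta_0)-\dot g(\mathbf{x}_1,\beta_0)\}\big],$$ and, for $i\neq j$, $$e(\mathbf{x}_i,u_i,a_i)=a_i\,\mathrm{E}\big[I_L(u_i+g(\mathbf{x}_j,\beta_0))\,|\,u_i,a_i\big],\qquad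 f(\mathbf{x}_j)=\mathrm{E}\big[a_iI_L(u_i+g(\mathbf{x}_j,\beta_0))\,|\,\mathbf{x}_j\big],$$ $$\tau^2=\frac1{\eta^2}\mathrm{E}\Big[\big\{e(\mathbf{x}_i,u_i,a_i)+f(\mathbf{x}_i)+a_i\mathbf{c}'I_R(\mathbf{x}_i,y_i)\big\}^2\Big].$$ Then $$n^{1/2}(\widehat\mu_n-\mu_0)\rightarrow_d N(0,\tau^2).$$
   Context: Setting. $(\mathbf{x}_i,y_i,a_i)$, $i\ge 1$, are i.i.d., with $\mathbf{x}_i\in\mathbb{R}^p$, $y_i\in\mathbb{R}$, $a_i\in\{0,1\}$; $\mathbf{x}_i$ is always observed and $y_i$ is observed iff $a_i=1$. The model is $y_i=g(\mathbf{x}_i,\beta_0)+u_i$, where $g:\mathbb{R}^p\times B\to\mathbb{R}$ is known, $\beta_0\in B\subset\mathbb{R}^q$, and $u_i$ is independent of $(\mathbf{x}_i,a_i)$. $\mathrm{E}a_i>0$. $Q_0$, $K_0$, $F_0$ are the distributions of $\mathbf{x}_i$, $u_i$, $y_i$. Identification: $\mathrm{P}_{Q_0}(g(\mathbf{x},\beta_0)=g(\mathbf{x},\beta)+\alpha)<1$ for all $\beta\ne\beta_0$ and all $\alpha\in\mathbb{R}$. $\dot g$ and $\ddot g$ denote the gradient and Hessian of $g$ with respect to $\beta$. Estimates. $\widehat\beta_n$ is an estimator of $\beta_0$ based on the observations $(\mathbf{x}_i,y_i)$, $1\le i\le n$, with $a_i=1$. Let $A=\{i\le n:a_i=1\}$,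 $m=\#A$, $\widehat u_i=y_i-g(\mathbf{x}_i,\widehat\beta_n)$ for $i\in A$, $\widehat y_{ij}=g(\mathbf{x}_j,\widehat\beta_n)+\widehat u_i$ for $i\in A$, $1\le j\le n$, and $$\widehat F_n=\frac1{nm}\sum_{i\in A}\sum_{j=1}^n\delta_{\widehat y_{ij}},\qquad \widehat\mu_n=T_L(\widehat F_n),\qquad \mu_0=T_L(F_0),$$ where $\delta_s$ is the point mass at $s$. $\mathrm{E}_F h(y)$ is the expectation of $h(y)$ when $y\sim F$. A location functional $T_L$, defined on a class of univariate distribution functions, assigns to each $F$ in the class a real number with $T_L(F_{ay+b})=aT_L(F_y)+b$, where $F_y$ is the distribution of $y$. $T_L$ is weakly continuous at $F$ if $F_n\rightarrow_w F$ (weak convergence) implies $T_L(F_n)\to T_L(F)$. $\rightarrow_d$ is convergence in distribution. *)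

theory Defs
  imports "HOL-Probability.Probability"
begin

text \<open>Measurability is part of the definition: \<^const>\<open>measure\<close> is \<open>0\<close> on non-measurable sets, so the
  limit alone would hold vacuously for non-measurable \<open>Z n\<close>.\<close>

definition o_P_one :: "'w measure \<Rightarrow> (nat \<Rightarrow> 'w \<Rightarrow> 'b::real_normed_vector) \<Rightarrow> bool" where
  "o_P_one M Z \<longleftrightarrow> (\<forall>n. Z n \<in> borel_measurable M) \<and>
     (\<forall>\<epsilon>>0. (\<lambda>n. measure M {\<omega> \<in> space M. norm (Z n \<omega>) > \<epsilon>}) \<longlonglongrightarrow> 0)"

text \<open>The normal law with variance \<open>v \<ge> 0\<close>; \<open>v = 0\<close> gives the point mass at \<open>m\<close>
  (\<^const>\<open>normal_density\<close> would give the zero measure there).\<close>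

definition normal_law :: "real \<Rightarrow> real \<Rightarrow> real measure" where
  "normal_law m v = distr std_normal_distribution borel (\<lambda>z. m + sqrt v * z)"

text \<open>\<open>f1\<close> is the gradient and \<open>f2\<close> the Hessian of the \<open>C\<^sup>2\<close> function \<open>f\<close> on \<open>B\<close>. Derivatives are
  taken within \<open>B\<close>, which need not be open; they are the ordinary (unique) ones in its interior.\<close>

definition C2_on_with ::
  "(real ^ 'q) set \<Rightarrow> (real ^ 'q \<Rightarrow> real) \<Rightarrow> (real ^ 'q \<Rightarrow> real ^ 'q) \<Rightarrow> (real ^ 'q \<Rightarrow> real ^ 'q ^ 'q) \<Rightarrow> bool"
where
  "C2_on_with B f f1 f2 \<longleftrightarrow>
     (\<forall>b\<in>B. (f has_derivative (\<lambda>h. f1 b \<bullet> h)) (at b within B)) \<and>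
     (\<forall>b\<in>B. (f1 has_derivative (\<lambda>h. f2 b *v h)) (at b within B)) \<and>
     continuous_on B f2"

text \<open>A univariate distribution function is represented by its Borel probability measure; \<open>T\<close> matters
  only on the class \<open>D\<close>.\<close>

definition location_functional :: "real measure set \<Rightarrow> (real measure \<Rightarrow> real) \<Rightarrow> bool" where
  "location_functional D T \<longleftrightarrow>
     (\<forall>F\<in>D. real_distribution F) \<and>
     (\<forall>F\<in>D. \<forall>a b. distr F borel (\<lambda>y. a * y + b) \<in> D \<longrightarrow>
        T (distr F borel (\<lambda>y. a * y + b)) = a * T F + b)"

definition weakly_continuous_at ::
  "real measure set \<Rightarrow> (real measure \<Rightarrow> real) \<Rightarrow> real measure \<Rightarrow> bool" where
  "weakly_continuous_at D T F \<longleftrightarrow> F \<in> D \<and>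
     (\<forall>Fs. (\<forall>n. Fs n \<in> D) \<longrightarrow> weak_conv_m Fs F \<longrightarrow> (\<lambda>n. T (Fs n)) \<longlonglongrightarrow> T F)"

text \<open>Samples are indexed from \<open>1\<close>.\<close>

definition observed :: "(nat \<Rightarrow> 'w \<Rightarrow> real) \<Rightarrow> nat \<Rightarrow> 'w \<Rightarrow> nat set" where
  "observed a n \<omega> = {i \<in> {1..n}. a i \<omega> = 1}"

definition complete_cases ::
  "(nat \<Rightarrow> 'w \<Rightarrow> 'p) \<Rightarrow> (nat \<Rightarrow> 'w \<Rightarrow> real) \<Rightarrow> (nat \<Rightarrow> 'w \<Rightarrow> real) \<Rightarrow> nat \<Rightarrow> 'w \<Rightarrow> ('p \<times> real) list" where
  "complete_cases x y a n \<omega> =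
     map (\<lambda>i. (x i \<omega>, y i \<omega>)) (filter (\<lambda>i. a i \<omega> = 1) [1..<Suc n])"

definition imputed ::
  "('p \<Rightarrow> 'q \<Rightarrow> real) \<Rightarrow> (nat \<Rightarrow> 'w \<Rightarrow> 'q) \<Rightarrow> (nat \<Rightarrow> 'w \<Rightarrow> 'p) \<Rightarrow> (nat \<Rightarrow> 'w \<Rightarrow> real) \<Rightarrow>
     nat \<Rightarrow> 'w \<Rightarrow> nat \<Rightarrow> nat \<Rightarrow> real" where
  "imputed g bhat x y n \<omega> i j =
     g (x j \<omega>) (bhat n \<omega>) + (y i \<omega> - g (x i \<omega>) (bhat n \<omega>))"

text \<open>The equally weighted mixture of the point masses at the \<open>imputed \<dots> i j\<close>, over \<open>i\<close> observed and
  \<open>1 \<le> j \<le> n\<close>; see \<open>measure_imputed_distr\<close>. It is the zero measure if nothing is observed.\<close>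

definition imputed_distr ::
  "('p \<Rightarrow> 'q \<Rightarrow> real) \<Rightarrow> (nat \<Rightarrow> 'w \<Rightarrow> 'q) \<Rightarrow> (nat \<Rightarrow> 'w \<Rightarrow> 'p) \<Rightarrow> (nat \<Rightarrow> 'w \<Rightarrow> real) \<Rightarrow>
     (nat \<Rightarrow> 'w \<Rightarrow> real) \<Rightarrow> nat \<Rightarrow> 'w \<Rightarrow> real measure" where
  "imputed_distr g bhat x y a n \<omega> =
     distr (uniform_count_measure (observed a n \<omega> \<times> {1..n})) borel
       (\<lambda>(i, j). imputed g bhat x y n \<omega> i j)"

lemma measure_imputed_distr:
  assumes "S \<in> sets borel"
  shows "measure (imputed_distr g bhat x y a n \<omega>) S =
    1 / (real n * real (card (observed a n \<omega>))) *
      (\<Sum>i\<in>observed a n \<omega>. \<Sum>j=1..n. indicator S (imputed g bhat x y n \<omega> i j))"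
proof -
  let ?A = "observed a n \<omega>" and ?h = "\<lambda>(i, j). imputed g bhat x y n \<omega> i j"
  let ?U = "uniform_count_measure (?A \<times> {1..n})"
  have fin: "finite ?A" by (simp add: observed_def)
  have h: "?h \<in> measurable ?U borel"
    by (simp add: measurable_def space_uniform_count_measure sets_uniform_count_measure)
  have "measure (imputed_distr g bhat x y a n \<omega>) S = measure ?U (?h -` S \<inter> (?A \<times> {1..n}))"
    unfolding imputed_distr_def
    by (subst measure_distr[OF h assms]) (simp add: space_uniform_count_measure)
  also have "\<dots> = real (card (?h -` S \<inter> (?A \<times> {1..n}))) / real (card (?A \<times> {1..n}))"
    using fin by (subst measure_uniform_count_measure) auto
  also have "real (card (?h -` S \<inter> (?A \<times> {1..n}))) =
      (\<Sum>p\<in>?A \<times> {1..n}. indicator S (?h p))"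
    using fin by (simp add: indicator_def sum.If_cases Int_commute vimage_def)
  also have "\<dots> = (\<Sum>i\<in>?A. \<Sum>j=1..n. indicator S (imputed g bhat x y n \<omega> i j))"
    by (simp add: sum.cartesian_product split_def)
  finally show ?thesis by (simp add: card_cartesian_product mult.commute)
qed

end

theory Submission
  imports Defs
begin

text \<open>Write \<open>w = (x, y, a)\<close> for a data point, \<open>r w = y - g x \<beta>\<^sub>0\<close> for its residual, and
\<open>h w w' \<beta> = a I\<^sub>L(g x' \<beta> + y - g x \<beta>)\<close>. By the linear expansion of \<open>T\<^sub>L\<close> the claim
concerns \<open>sqrt n\<close> times the mean of \<open>I\<^sub>L\<close> under \<open>Fhat n\<close>, and this mean is \<open>n/m\<close> times the V-statistic \<open>V n \<beta> = n\<^sup>-\<^sup>2 \<Sum>\<^sub>i \<Sum>\<^sub>j h (W i) (W j) \<beta>\<close> taken at the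
estimate (\<open>integral_imputed_distr\<close>). Three expansions in probability turn it into a normalised
i.i.d. sum.

First, at the true parameter, Hoeffding's projection replaces \<open>sqrt n V n \<beta>\<^sub>0\<close> by
\<open>n\<^sup>-\<^sup>1\<^sup>/\<^sup>2 \<Sum>\<^sub>i \<psi>\<^sub>1(W i)\<close>, where \<open>\<psi>\<^sub>1\<close> is the sum of the two conditional expectations of the kernel
(\<open>V_statistic_projection\<close>). The kernel has mean \<open>0\<close> because the residual is independent of \<open>(x, a)\<close>:
the imputed value \<open>g x' \<beta>\<^sub>0 + r w\<close> has the same law \<open>F\<^sub>0\<close> as a true response
(\<open>decouple_independent_pair\<close>, \<open>imputation_kernel_moments\<close>).

Second, replacing \<open>\<beta>\<^sub>0\<close> by the estimate adds \<open>c \<bullet> sqrt n (bhat n - \<beta>\<^sub>0)\<close> up to \<open>o\<^sub>P(1)\<close>. The summands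
at the estimate depend on the whole sample, so the linearization error is bounded by its supremum
over a small ball of parameters. This supremum, divided by the distance to \<open>\<beta>\<^sub>0\<close>, tends to \<open>0\<close> pointwise
as the ball shrinks, because the kernel is differentiable at \<open>\<beta>\<^sub>0\<close>, and it is dominated by a
Lipschitz constant built from \<open>sup \<parallel>gd\<parallel>\<close>; hence its expectation tends to \<open>0\<close>
(\<open>uniform_linearization\<close>, \<open>V_statistic_linearization\<close>). Together with the linear expansion of the
estimator and a weak law for the gradient kernel this is \<open>V_statistic_delta_method\<close>.

Third, \<open>m/n\<close> tends to \<open>\<eta>\<close> in probability, which contributes the factor \<open>1/\<eta>\<close>
(\<open>normalized_ratio_asymptotics\<close>).

The central limit theorem and Slutsky's theorem finish the proof. The variance is \<open>\<tau>2\<close> because \<open>e\<close> and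
\<open>f\<close>, being conditional expectations given one of two independent data points, are integrals over the
other one (\<open>real_cond_exp_W\<close>).\<close>

section \<open>Convergence and boundedness in probability\<close>

definition O_P_one :: "'w measure \<Rightarrow> (nat \<Rightarrow> 'w \<Rightarrow> 'b::real_normed_vector) \<Rightarrow> bool" where
  "O_P_one M Z \<longleftrightarrow> (\<forall>n. Z n \<in> borel_measurable M) \<and>
     (\<forall>\<epsilon>>0. \<exists>K>0. \<forall>\<^sub>F n in sequentially. measure M {\<omega> \<in> space M. norm (Z n \<omega>) > K} \<le> \<epsilon>)"

lemma o_P_one_measurable: "o_P_one M Z \<Longrightarrow> Z n \<in> borel_measurable M"
  by (simp add: o_P_one_def)

lemma O_P_one_measurable: "O_P_one M Z \<Longrightarrow> Z n \<in> borel_measurable M"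
  by (simp add: O_P_one_def)

context prob_space
begin


lemma o_P_oneI:
  assumes "\<And>n. Z n \<in> borel_measurable M"
    and "\<And>\<epsilon> \<delta>. \<epsilon> > 0 \<Longrightarrow> \<delta> > 0 \<Longrightarrow>
      \<forall>\<^sub>F n in sequentially. measure M {\<omega> \<in> space M. norm (Z n \<omega>) > \<epsilon>} \<le> \<delta>"
  shows "o_P_one M Z"
  unfolding o_P_one_def
proof (intro conjI allI impI)
  fix \<epsilon> :: real assume e: "\<epsilon> > 0"
  show "(\<lambda>n. measure M {\<omega> \<in> space M. norm (Z n \<omega>) > \<epsilon>}) \<longlonglongrightarrow> 0"
  proof (rule tendstoI)
    fix r :: real assume "r > 0"
    then have "r / 2 > 0" by simp
    from assms(2)[OF e this] show "\<forall>\<^sub>F n in sequentially. dist (measure M {\<omega> \<in> space M. norm (Z n \<omega>) > \<epsilon>}) 0 < r"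
      by eventually_elim (use \<open>r > 0\<close> in simp)
  qed
qed (rule assms(1))

lemma o_P_oneD:
  assumes "o_P_one M Z" "\<epsilon> > 0" "\<delta> > 0"
  shows "\<forall>\<^sub>F n in sequentially. measure M {\<omega> \<in> space M. norm (Z n \<omega>) > \<epsilon>} \<le> \<delta>"
proof -
  have "(\<lambda>n. measure M {\<omega> \<in> space M. norm (Z n \<omega>) > \<epsilon>}) \<longlonglongrightarrow> 0"
    using assms by (simp add: o_P_one_def)
  from order_tendstoD(2)[OF this assms(3)] show ?thesis by eventually_elim simp
qed

text \<open>Sums, products and reciprocals of \<open>o\<^sub>P(1)\<close> and \<open>O\<^sub>P(1)\<close> sequences all reduce to this union bound: \<open>X\<close>
  can be large only where \<open>Y\<close> or \<open>Z\<close> is.\<close>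

lemma tail_union_bound:
  fixes X :: "'a \<Rightarrow> 'b::real_normed_vector" and Y :: "'a \<Rightarrow> 'c::real_normed_vector" and Z :: "'a \<Rightarrow> 'd::real_normed_vector"
  assumes [measurable]: "Y \<in> borel_measurable M" "Z \<in> borel_measurable M"
    and "\<And>\<omega>. \<omega> \<in> space M \<Longrightarrow> norm (Y \<omega>) \<le> s \<Longrightarrow> norm (Z \<omega>) \<le> t \<Longrightarrow> norm (X \<omega>) \<le> r"
    and "measure M {\<omega> \<in> space M. norm (Y \<omega>) > s} \<le> p"
    and "measure M {\<omega> \<in> space M. norm (Z \<omega>) > t} \<le> q"
  shows "measure M {\<omega> \<in> space M. norm (X \<omega>) > r} \<le> p + q"
proof -
  have "measure M {\<omega> \<in> space M. norm (X \<omega>) > r}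
      \<le> measure M ({\<omega> \<in> space M. norm (Y \<omega>) > s} \<union> {\<omega> \<in> space M. norm (Z \<omega>) > t})"
    using assms(3) by (intro finite_measure_mono) (auto simp: not_less[symmetric])
  also have "\<dots> \<le> measure M {\<omega> \<in> space M. norm (Y \<omega>) > s} + measure M {\<omega> \<in> space M. norm (Z \<omega>) > t}"
    by (intro measure_Un_le) measurable
  finally show ?thesis using assms(4,5) by linarith
qed

text \<open>Stated with an inequality of norms, so that products, inner products and norms of vectors are
  covered at once.\<close>

lemma o_P_one_mult:
  fixes X :: "nat \<Rightarrow> 'a \<Rightarrow> 'b::real_normed_vector" and Y :: "nat \<Rightarrow> 'a \<Rightarrow> 'c::real_normed_vector" and Z :: "nat \<Rightarrow> 'a \<Rightarrow> 'd::real_normed_vector"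
  assumes "o_P_one M Y" "O_P_one M Z" and "\<And>n. X n \<in> borel_measurable M"
    and le: "\<And>n \<omega>. \<omega> \<in> space M \<Longrightarrow> norm (X n \<omega>) \<le> norm (Y n \<omega>) * norm (Z n \<omega>)"
  shows "o_P_one M X"
proof (rule o_P_oneI)
  fix \<epsilon> \<delta> :: real assume e: "\<epsilon> > 0" and d: "\<delta> > 0"
  obtain K where K: "K > 0" and Z: "\<forall>\<^sub>F n in sequentially. measure M {\<omega> \<in> space M. norm (Z n \<omega>) > K} \<le> \<delta>/2"
    using assms(2) d unfolding O_P_one_def by (meson half_gt_zero)
  have Y: "\<forall>\<^sub>F n in sequentially. measure M {\<omega> \<in> space M. norm (Y n \<omega>) > \<epsilon> / K} \<le> \<delta>/2"
    using assms(1) e d K by (intro o_P_oneD) auto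
  from Y Z show "\<forall>\<^sub>F n in sequentially. measure M {\<omega> \<in> space M. norm (X n \<omega>) > \<epsilon>} \<le> \<delta>"
  proof eventually_elim
    case (elim n)
    have "norm (X n \<omega>) \<le> \<epsilon>" if "\<omega> \<in> space M" "norm (Y n \<omega>) \<le> \<epsilon> / K" "norm (Z n \<omega>) \<le> K" for \<omega>
    proof -
      have "norm (Y n \<omega>) * norm (Z n \<omega>) \<le> (\<epsilon> / K) * K"
        using that K e by (intro mult_mono) auto
      then show ?thesis using le[OF that(1), of n] K by simp
    qed
    from tail_union_bound[OF _ _ this elim(1) elim(2)] show ?case
      using assms(1,2) by (simp add: o_P_one_measurable O_P_one_measurable)
  qed
qed (rule assms(3))

lemma O_P_one_const: "O_P_one M (\<lambda>_ _. c)"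
  unfolding O_P_one_def
proof (intro conjI allI impI)
  fix \<epsilon> :: real assume "\<epsilon> > 0"
  show "\<exists>K>0. \<forall>\<^sub>F n in sequentially. measure M {\<omega> \<in> space M. norm c > K} \<le> \<epsilon>"
    using \<open>\<epsilon> > 0\<close> by (intro exI[of _ "norm c + 1"]) (auto intro: add_nonneg_pos)
qed simp

lemma o_P_one_le:
  fixes X :: "nat \<Rightarrow> 'a \<Rightarrow> 'b::real_normed_vector" and Y :: "nat \<Rightarrow> 'a \<Rightarrow> 'c::real_normed_vector"
  assumes "o_P_one M Y" and "\<And>n. X n \<in> borel_measurable M"
    and "\<And>n \<omega>. \<omega> \<in> space M \<Longrightarrow> norm (X n \<omega>) \<le> norm (Y n \<omega>)"
  shows "o_P_one M X"
  using o_P_one_mult[OF assms(1) O_P_one_const[of "1::real"] assms(2)] assms(3) by simp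

lemma o_P_one_cong:
  assumes "o_P_one M Y" and "\<And>n \<omega>. \<omega> \<in> space M \<Longrightarrow> X n \<omega> = Y n \<omega>"
  shows "o_P_one M X"
  by (rule o_P_one_le[OF assms(1)])
     (use assms in \<open>auto simp: o_P_one_measurable cong: measurable_cong\<close>)

lemma o_P_one_add:
  fixes X Y :: "nat \<Rightarrow> 'a \<Rightarrow> 'b::{real_normed_vector, second_countable_topology}"
  assumes "o_P_one M X" "o_P_one M Y"
  shows "o_P_one M (\<lambda>n \<omega>. X n \<omega> + Y n \<omega>)"
proof (rule o_P_oneI)
  have [measurable]: "X n \<in> borel_measurable M" "Y n \<in> borel_measurable M" for n
    using assms by (simp_all add: o_P_one_measurable)
  show "(\<lambda>\<omega>. X n \<omega> + Y n \<omega>) \<in> borel_measurable M" for n by measurable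
  fix \<epsilon> \<delta> :: real assume "\<epsilon> > 0" "\<delta> > 0"
  then have "\<epsilon>/2 > 0" "\<delta>/2 > 0" by auto
  from o_P_oneD[OF assms(1) this] o_P_oneD[OF assms(2) this]
  show "\<forall>\<^sub>F n in sequentially. measure M {\<omega> \<in> space M. norm (X n \<omega> + Y n \<omega>) > \<epsilon>} \<le> \<delta>"
  proof eventually_elim
    case (elim n)
    have "norm (X n \<omega> + Y n \<omega>) \<le> \<epsilon>" if "norm (X n \<omega>) \<le> \<epsilon>/2" "norm (Y n \<omega>) \<le> \<epsilon>/2" for \<omega>
      using norm_triangle_ineq[of "X n \<omega>" "Y n \<omega>"] that by linarith
    from tail_union_bound[OF _ _ this elim] show ?case by simp
  qed
qed

lemma O_P_one_add_o_P_one: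
  fixes X Y :: "nat \<Rightarrow> 'a \<Rightarrow> 'b::{real_normed_vector, second_countable_topology}"
  assumes "O_P_one M X" "o_P_one M Y"
  shows "O_P_one M (\<lambda>n \<omega>. X n \<omega> + Y n \<omega>)"
  unfolding O_P_one_def
proof (intro conjI allI impI)
  have [measurable]: "X n \<in> borel_measurable M" "Y n \<in> borel_measurable M" for n
    using assms by (simp_all add: o_P_one_measurable O_P_one_measurable)
  show "(\<lambda>\<omega>. X n \<omega> + Y n \<omega>) \<in> borel_measurable M" for n by measurable
  fix \<epsilon> :: real assume e: "\<epsilon> > 0"
  obtain K where K: "K > 0" and X: "\<forall>\<^sub>F n in sequentially. measure M {\<omega> \<in> space M. norm (X n \<omega>) > K} \<le> \<epsilon>/2"
    using assms(1) e unfolding O_P_one_def by (meson half_gt_zero)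
  have Y: "\<forall>\<^sub>F n in sequentially. measure M {\<omega> \<in> space M. norm (Y n \<omega>) > 1} \<le> \<epsilon>/2"
    using e by (intro o_P_oneD[OF assms(2)]) auto
  have "\<forall>\<^sub>F n in sequentially. measure M {\<omega> \<in> space M. norm (X n \<omega> + Y n \<omega>) > K + 1} \<le> \<epsilon>"
    using X Y
  proof eventually_elim
    case (elim n)
    have "norm (X n \<omega> + Y n \<omega>) \<le> K + 1" if "norm (X n \<omega>) \<le> K" "norm (Y n \<omega>) \<le> 1" for \<omega>
      using norm_triangle_ineq[of "X n \<omega>" "Y n \<omega>"] that by linarith
    from tail_union_bound[OF _ _ this elim] show ?case by simp
  qed
  then show "\<exists>K>0. \<forall>\<^sub>F n in sequentially. measure M {\<omega> \<in> space M. norm (X n \<omega> + Y n \<omega>) > K} \<le> \<epsilon>"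
    using K by (intro exI[of _ "K+1"]) auto
qed

lemma tail_Markov:
  fixes X :: "'a \<Rightarrow> 'b::real_normed_vector"
  assumes "X \<in> borel_measurable M" "integrable M Y" "\<And>\<omega>. \<omega> \<in> space M \<Longrightarrow> norm (X \<omega>) \<le> Y \<omega>" "r > 0"
  shows "measure M {\<omega> \<in> space M. norm (X \<omega>) > r} \<le> expectation Y / r"
proof -
  have [measurable]: "X \<in> borel_measurable M" "Y \<in> borel_measurable M" using assms(1,2) by auto
  have "measure M {\<omega> \<in> space M. norm (X \<omega>) > r} \<le> measure M {\<omega> \<in> space M. Y \<omega> \<ge> r}"
    using assms(3) by (intro finite_measure_mono) (force, measurable)
  also have "\<dots> \<le> expectation Y / r"
    using assms(2,4) order_trans[OF norm_ge_zero assms(3)]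
    by (intro integral_Markov_inequality_measure[where A = "{}"]) (auto intro!: AE_I2)
  finally show ?thesis .
qed

lemma o_P_one_of_L1:
  fixes X :: "nat \<Rightarrow> 'a \<Rightarrow> 'b::real_normed_vector"
  assumes "\<And>n. X n \<in> borel_measurable M" "\<And>n. integrable M (Y n)"
    and "\<And>n \<omega>. \<omega> \<in> space M \<Longrightarrow> norm (X n \<omega>) \<le> Y n \<omega>" and "(\<lambda>n. expectation (Y n)) \<longlonglongrightarrow> 0"
  shows "o_P_one M X"
proof (rule o_P_oneI)
  fix \<epsilon> \<delta> :: real assume e: "\<epsilon> > 0" "\<delta> > 0"
  then have "\<forall>\<^sub>F n in sequentially. expectation (Y n) < \<epsilon> * \<delta>"
    using assms(4) by (intro order_tendstoD(2)[where y = 0]) auto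
  then show "\<forall>\<^sub>F n in sequentially. measure M {\<omega> \<in> space M. norm (X n \<omega>) > \<epsilon>} \<le> \<delta>"
  proof eventually_elim
    case (elim n)
    have "measure M {\<omega> \<in> space M. norm (X n \<omega>) > \<epsilon>} \<le> expectation (Y n) / \<epsilon>"
      by (rule tail_Markov) (use assms e in auto)
    also have "\<dots> \<le> \<delta>" using elim e by (simp add: field_simps)
    finally show ?case .
  qed
qed (rule assms(1))

lemma tail_Chebyshev:
  fixes X :: "'a \<Rightarrow> 'b::real_normed_vector"
  assumes "X \<in> borel_measurable M" "integrable M (\<lambda>\<omega>. (norm (X \<omega>))\<^sup>2)" "r > 0"
  shows "measure M {\<omega> \<in> space M. norm (X \<omega>) > r} \<le> expectation (\<lambda>\<omega>. (norm (X \<omega>))\<^sup>2) / r\<^sup>2"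
proof -
  have "measure M {\<omega> \<in> space M. norm (X \<omega>) > r} = measure M {\<omega> \<in> space M. norm ((norm (X \<omega>))\<^sup>2) > r\<^sup>2}"
    by (rule arg_cong[where f = "measure M"])
       (use assms(3) in \<open>auto simp: power_strict_mono dest: power_less_imp_less_base\<close>)
  also have "\<dots> \<le> expectation (\<lambda>\<omega>. (norm (X \<omega>))\<^sup>2) / r\<^sup>2"
    by (rule tail_Markov) (use assms in auto)
  finally show ?thesis .
qed

lemma o_P_one_of_L2:
  fixes X :: "nat \<Rightarrow> 'a \<Rightarrow> 'b::real_normed_vector"
  assumes "\<And>n. X n \<in> borel_measurable M" "\<And>n. integrable M (\<lambda>\<omega>. (norm (X n \<omega>))\<^sup>2)"
    and "(\<lambda>n. expectation (\<lambda>\<omega>. (norm (X n \<omega>))\<^sup>2)) \<longlonglongrightarrow> 0"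
  shows "o_P_one M X"
proof (rule o_P_oneI)
  fix \<epsilon> \<delta> :: real assume e: "\<epsilon> > 0" "\<delta> > 0"
  then have "\<forall>\<^sub>F n in sequentially. expectation (\<lambda>\<omega>. (norm (X n \<omega>))\<^sup>2) < \<epsilon>\<^sup>2 * \<delta>"
    using assms(3) by (intro order_tendstoD(2)[where y = 0]) auto
  then show "\<forall>\<^sub>F n in sequentially. measure M {\<omega> \<in> space M. norm (X n \<omega>) > \<epsilon>} \<le> \<delta>"
  proof eventually_elim
    case (elim n)
    have "measure M {\<omega> \<in> space M. norm (X n \<omega>) > \<epsilon>} \<le> expectation (\<lambda>\<omega>. (norm (X n \<omega>))\<^sup>2) / \<epsilon>\<^sup>2"
      by (rule tail_Chebyshev) (use assms e in auto)
    also have "\<dots> \<le> \<delta>" using elim e by (simp add: field_simps)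
    finally show ?case .
  qed
qed (rule assms(1))

lemma O_P_one_of_L2:
  fixes X :: "nat \<Rightarrow> 'a \<Rightarrow> 'b::real_normed_vector"
  assumes "\<And>n. X n \<in> borel_measurable M" "\<And>n. integrable M (\<lambda>\<omega>. (norm (X n \<omega>))\<^sup>2)"
    and "\<And>n. expectation (\<lambda>\<omega>. (norm (X n \<omega>))\<^sup>2) \<le> C"
  shows "O_P_one M X"
  unfolding O_P_one_def
proof (intro conjI allI impI)
  fix \<epsilon> :: real assume e: "\<epsilon> > 0"
  define K where "K = sqrt ((\<bar>C\<bar> + 1) / \<epsilon>)"
  have K: "K > 0" "K\<^sup>2 = (\<bar>C\<bar> + 1) / \<epsilon>" using e by (auto simp: K_def field_simps intro!: add_pos_nonneg)
  have "measure M {\<omega> \<in> space M. norm (X n \<omega>) > K} \<le> \<epsilon>" for n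
  proof -
    have "measure M {\<omega> \<in> space M. norm (X n \<omega>) > K} \<le> expectation (\<lambda>\<omega>. (norm (X n \<omega>))\<^sup>2) / K\<^sup>2"
      by (rule tail_Chebyshev) (use assms K in auto)
    also have "\<dots> \<le> (\<bar>C\<bar> + 1) / K\<^sup>2" using assms(3)[of n] by (intro divide_right_mono) auto
    also have "\<dots> = \<epsilon>" using K e by (simp add: field_simps)
    finally show ?thesis .
  qed
  then show "\<exists>K>0. \<forall>\<^sub>F n in sequentially. measure M {\<omega> \<in> space M. norm (X n \<omega>) > K} \<le> \<epsilon>"
    using K(1) by auto
qed (rule assms(1))

lemma o_P_one_of_AE_tendsto:
  fixes X :: "nat \<Rightarrow> 'a \<Rightarrow> 'b::real_normed_vector"
  assumes [measurable]: "\<And>n. X n \<in> borel_measurable M" and "AE \<omega> in M. (\<lambda>n. X n \<omega>) \<longlonglongrightarrow> 0"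
  shows "o_P_one M X"
  unfolding o_P_one_def
proof (intro conjI allI impI)
  fix \<epsilon> :: real assume e: "\<epsilon> > 0"
  have "(\<lambda>n. expectation (indicat_real {\<omega> \<in> space M. norm (X n \<omega>) > \<epsilon>})) \<longlonglongrightarrow> expectation (\<lambda>_. 0)"
  proof (rule integral_dominated_convergence[where w = "\<lambda>_. 1"])
    show "AE \<omega> in M. (\<lambda>n. indicat_real {\<omega> \<in> space M. norm (X n \<omega>) > \<epsilon>} \<omega>) \<longlonglongrightarrow> 0"
      using assms(2)
    proof eventually_elim
      case (elim \<omega>)
      then have "(\<lambda>n. norm (X n \<omega>)) \<longlonglongrightarrow> 0" by (simp add: tendsto_norm_zero)
      from order_tendstoD(2)[OF this e] show ?case
        by (intro tendsto_eventually) (auto elim!: eventually_mono simp: indicator_def)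
    qed
  qed (auto simp: indicator_def)
  then show "(\<lambda>n. measure M {\<omega> \<in> space M. norm (X n \<omega>) > \<epsilon>}) \<longlonglongrightarrow> 0"
    by simp
qed measurable

lemma o_P_one_sum:
  fixes X :: "'i \<Rightarrow> nat \<Rightarrow> 'a \<Rightarrow> 'b::{real_normed_vector, second_countable_topology}"
  assumes "finite I" "\<And>i. i \<in> I \<Longrightarrow> o_P_one M (X i)"
  shows "o_P_one M (\<lambda>n \<omega>. \<Sum>i\<in>I. X i n \<omega>)"
  using assms
proof (induction I)
  case empty
  show ?case by (rule o_P_one_of_AE_tendsto) auto
qed (auto intro: o_P_one_add)

lemma o_P_one_componentwise:
  fixes X :: "nat \<Rightarrow> 'a \<Rightarrow> 'b::euclidean_space"
  assumes X: "\<And>b. b \<in> Basis \<Longrightarrow> o_P_one M (\<lambda>n \<omega>. X n \<omega> \<bullet> b)"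
  shows "o_P_one M X"
proof (rule o_P_one_le)
  have m: "(\<lambda>\<omega>. X n \<omega> \<bullet> b) \<in> borel_measurable M" if "b \<in> Basis" for n b
    using X[OF that] by (rule o_P_one_measurable)
  show "X n \<in> borel_measurable M" for n
    using m by (subst borel_measurable_euclidean_space) auto
  have "o_P_one M (\<lambda>n \<omega>. \<bar>X n \<omega> \<bullet> b\<bar>)" if "b \<in> Basis" for b
    by (rule o_P_one_le[OF X[OF that]]) (use m[OF that] in auto)
  then show "o_P_one M (\<lambda>n \<omega>. \<Sum>b\<in>Basis. \<bar>X n \<omega> \<bullet> b\<bar>)"
    by (intro o_P_one_sum) auto
  show "norm (X n \<omega>) \<le> norm (\<Sum>b\<in>Basis. \<bar>X n \<omega> \<bullet> b\<bar>)" for n \<omega>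
    using norm_le_l1[of "X n \<omega>"] by (simp add: sum_nonneg)
qed

lemma o_P_one_inverse:
  fixes X :: "nat \<Rightarrow> 'a \<Rightarrow> real"
  assumes X: "o_P_one M (\<lambda>n \<omega>. X n \<omega> - c)" and c: "c \<noteq> 0"
  shows "o_P_one M (\<lambda>n \<omega>. 1 / X n \<omega> - 1 / c)"
proof (rule o_P_oneI)
  have [measurable]: "X n \<in> borel_measurable M" for n
    using borel_measurable_add[OF o_P_one_measurable[OF X, of n] borel_measurable_const[of c]] by simp
  show "(\<lambda>\<omega>. 1 / X n \<omega> - 1 / c) \<in> borel_measurable M" for n by measurable
  fix \<epsilon> \<delta> :: real assume e: "\<epsilon> > 0" "\<delta> > 0"
  \<comment> \<open>for \<open>\<bar>z - c\<bar> \<le> \<bar>c\<bar> / 2\<close> the reciprocals differ by at most \<open>2 \<bar>z - c\<bar> / c\<^sup>2\<close>\<close>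
  define r where "r = min (\<bar>c\<bar>/2) (\<epsilon> * c\<^sup>2 / 2)"
  have r: "r > 0" using e c by (simp add: r_def)
  from o_P_oneD[OF X r e(2)]
  show "\<forall>\<^sub>F n in sequentially. measure M {\<omega> \<in> space M. norm (1 / X n \<omega> - 1 / c) > \<epsilon>} \<le> \<delta>"
  proof eventually_elim
    case (elim n)
    have *: "\<bar>1 / z - 1 / c\<bar> \<le> \<epsilon>" if "\<bar>z - c\<bar> \<le> r" for z
    proof -
      have z: "\<bar>z\<bar> \<ge> \<bar>c\<bar> / 2" using that unfolding r_def by arith
      then have "z \<noteq> 0" using c by auto
      then have "\<bar>1 / z - 1 / c\<bar> = \<bar>z - c\<bar> / (\<bar>z\<bar> * \<bar>c\<bar>)"
        using c by (simp add: field_simps abs_mult[symmetric] abs_minus_commute flip: abs_divide)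
      also have "\<dots> \<le> (\<epsilon> * c\<^sup>2 / 2) / ((\<bar>c\<bar> / 2) * \<bar>c\<bar>)"
        using that z c e by (intro frac_le mult_right_mono mult_pos_pos) (auto simp: r_def)
      also have "\<dots> = \<epsilon>" using c by (simp add: field_simps power2_eq_square)
      finally show ?thesis .
    qed
    have "measure M {\<omega> \<in> space M. norm (1 / X n \<omega> - 1 / c) > \<epsilon>} \<le> \<delta> + 0"
      by (rule tail_union_bound[where Y = "\<lambda>\<omega>. X n \<omega> - c" and Z = "\<lambda>_. 0::real" and s = r and t = 0])
         (use elim * in auto)
    then show ?case by simp
  qed
qed

section \<open>Weak convergence\<close>

lemma distr_real_distribution: "X \<in> borel_measurable M \<Longrightarrow> real_distribution (distr M borel X)"
  by (simp add: prob_space_distr real_distribution_def real_distribution_axioms_def)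

text \<open>Slutsky's theorem. The characteristic functions of \<open>X n\<close> and \<open>Y n\<close> at \<open>t\<close> differ by at most
  \<open>\<bar>t\<bar> \<epsilon> + 2 P(\<bar>Y n - X n\<bar> > \<epsilon>)\<close>, because \<open>x \<mapsto> exp (i t x)\<close> is bounded by \<open>1\<close> and has Lipschitz constant \<open>\<bar>t\<bar>\<close>.\<close>

lemma weak_conv_add_o_P_one:
  fixes X Y :: "nat \<Rightarrow> 'a \<Rightarrow> real"
  assumes X: "\<And>n. X n \<in> borel_measurable M" and mu: "real_distribution \<mu>"
    and conv: "weak_conv_m (\<lambda>n. distr M borel (X n)) \<mu>"
    and R: "o_P_one M (\<lambda>n \<omega>. Y n \<omega> - X n \<omega>)"
  shows "weak_conv_m (\<lambda>n. distr M borel (Y n)) \<mu>"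
proof -
  note [measurable] = X
  have [measurable]: "Y n \<in> borel_measurable M" for n
    using borel_measurable_add[OF o_P_one_measurable[OF R, of n] X[of n]] by simp
  have char_diff: "(\<lambda>n. char (distr M borel (Y n)) t - char (distr M borel (X n)) t) \<longlonglongrightarrow> 0" for t
  proof (rule tendstoI)
    fix r :: real assume r: "r > 0"
    define e where "e = r / (4 * (\<bar>t\<bar> + 1))"
    have e: "e > 0" "\<bar>t\<bar> * e \<le> r / 4"
      using r by (auto simp: e_def field_simps intro!: divide_pos_pos add_nonneg_pos mult_left_mono)
    have "\<forall>\<^sub>F n in sequentially. measure M {\<omega> \<in> space M. norm (Y n \<omega> - X n \<omega>) > e} \<le> r/8"
      using r e by (intro o_P_oneD[OF R]) auto
    then show "\<forall>\<^sub>F n in sequentially. dist (char (distr M borel (Y n)) t - char (distr M borel (X n)) t) 0 < r"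
    proof eventually_elim
      case (elim n)
      define A where "A = {\<omega> \<in> space M. norm (Y n \<omega> - X n \<omega>) > e}"
      have [measurable]: "A \<in> sets M" unfolding A_def by measurable
      have iA: "integrable M (indicat_real A)"
        by (rule integrable_const_bound[where B = 1]) (auto simp: indicator_def)
      have i: "integrable M (\<lambda>\<omega>. iexp (t * Y n \<omega>))" "integrable M (\<lambda>\<omega>. iexp (t * X n \<omega>))"
        by (auto intro!: integrable_const_bound[where B = 1])
      have "char (distr M borel (Y n)) t - char (distr M borel (X n)) t
          = expectation (\<lambda>\<omega>. iexp (t * Y n \<omega>) - iexp (t * X n \<omega>))"
        using i by (simp add: char_def integral_distr)
      also have "norm \<dots> \<le> expectation (\<lambda>\<omega>. norm (iexp (t * Y n \<omega>) - iexp (t * X n \<omega>)))"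
        by (rule integral_norm_bound)
      also have "\<dots> \<le> expectation (\<lambda>\<omega>. \<bar>t\<bar> * e + 2 * indicat_real A \<omega>)"
      proof (rule integral_mono)
        fix \<omega> assume w: "\<omega> \<in> space M"
        let ?d = "norm (iexp (t * Y n \<omega>) - iexp (t * X n \<omega>))"
        have d2: "?d \<le> 1 + 1"
          by (intro order_trans[OF norm_triangle_ineq4] add_mono) auto
        have "iexp (t * Y n \<omega>) - iexp (t * X n \<omega>) = iexp (t * X n \<omega>) * (iexp (t * (Y n \<omega> - X n \<omega>)) - 1)"
          by (simp add: exp_add[symmetric] algebra_simps)
        then have "?d = norm (iexp (t * (Y n \<omega> - X n \<omega>)) - 1)" by (simp add: norm_mult)
        also have "\<dots> \<le> \<bar>t * (Y n \<omega> - X n \<omega>)\<bar>"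
          using iexp_approx1[of "t * (Y n \<omega> - X n \<omega>)" 0] by simp
        finally have dL: "?d \<le> \<bar>t\<bar> * \<bar>Y n \<omega> - X n \<omega>\<bar>" by (simp add: abs_mult)
        show "?d \<le> \<bar>t\<bar> * e + 2 * indicat_real A \<omega>"
        proof (cases "\<omega> \<in> A")
          case True
          have "?d \<le> \<bar>t\<bar> * e + 2" using d2 mult_nonneg_nonneg[of "\<bar>t\<bar>" e] e(1) by linarith
          moreover have "indicat_real A \<omega> = 1" by (rule indicator_simps(1)[OF True])
          ultimately show ?thesis by (simp only: mult_1_right)
        next
          case False
          then have "\<bar>Y n \<omega> - X n \<omega>\<bar> \<le> e" using w by (auto simp: A_def)
          then have "\<bar>t\<bar> * \<bar>Y n \<omega> - X n \<omega>\<bar> \<le> \<bar>t\<bar> * e" by (rule mult_left_mono) simp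
          then have "?d \<le> \<bar>t\<bar> * e" using dL by linarith
          moreover have "indicat_real A \<omega> = 0" by (rule indicator_simps(2)[OF False])
          ultimately show ?thesis by (simp only: mult_zero_right add_0_right)
        qed
      qed (use i iA in auto)
      also have "\<dots> = \<bar>t\<bar> * e + 2 * measure M A"
        using iA by (simp add: prob_space)
      also have "\<dots> \<le> r / 4 + 2 * (r / 8)" using elim e unfolding A_def by (intro add_mono mult_left_mono) auto
      also have "\<dots> < r" using r by simp
      finally show ?case by simp
    qed
  qed
  show ?thesis
  proof (rule levy_continuity)
    fix t
    have "(\<lambda>n. char (distr M borel (X n)) t) \<longlonglongrightarrow> char \<mu> t"
      using conv mu by (intro levy_continuity1 distr_real_distribution) auto
    from tendsto_add[OF char_diff[of t] this]
    show "(\<lambda>n. char (distr M borel (Y n)) t) \<longlonglongrightarrow> char \<mu> t" by simp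
  qed (use mu in \<open>auto intro: distr_real_distribution\<close>)
qed

end


lemma real_distribution_normal_law: "real_distribution (normal_law m v)"
proof -
  interpret std: real_distribution std_normal_distribution by (rule real_dist_normal_dist)
  show ?thesis unfolding normal_law_def by (rule std.distr_real_distribution) simp
qed

lemma weak_conv_m_scale:
  fixes s :: real
  assumes F: "\<And>n. real_distribution (F n)" and mu: "real_distribution \<mu>" and "weak_conv_m F \<mu>"
  shows "weak_conv_m (\<lambda>n. distr (F n) borel ((*) s)) (distr \<mu> borel ((*) s))"
proof (rule levy_continuity)
  have distr: "real_distribution (distr G borel ((*) s))"
    and char: "char (distr G borel ((*) s)) t = char G (t * s)" if "real_distribution G" for G t
  proof -
    interpret G: real_distribution G by fact
    show "real_distribution (distr G borel ((*) s))" by (rule G.distr_real_distribution) simp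
    show "char (distr G borel ((*) s)) t = char G (t * s)"
      unfolding char_def by (subst integral_distr) (auto simp: mult_ac)
  qed
  show "real_distribution (distr (F n) borel ((*) s))" "real_distribution (distr \<mu> borel ((*) s))" for n
    using F mu by (auto intro: distr)
  show "(\<lambda>n. char (distr (F n) borel ((*) s)) t) \<longlonglongrightarrow> char (distr \<mu> borel ((*) s)) t" for t
    using levy_continuity1[OF F mu assms(3)] by (simp add: char F mu)
qed

section \<open>Samples of independent identically distributed points\<close>

text \<open>The common law \<open>P\<close> is a parameter, so that moment conditions are stated once, for \<open>P\<close> and
  \<open>P \<Otimes>\<^sub>M P\<close>, and not for every index or pair of indices.\<close>

locale iid_sample = prob_space M for M :: "'w measure" +
  fixes W :: "nat \<Rightarrow> 'w \<Rightarrow> 'd::second_countable_topology" and P :: "'d measure"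
  assumes indep_W: "indep_vars (\<lambda>_. borel) W {1..}"
    and distr_W: "\<And>i. i \<ge> 1 \<Longrightarrow> distr M borel (W i) = P"
begin

lemma measurable_W: "i \<ge> 1 \<Longrightarrow> W i \<in> borel_measurable M"
  using indep_W by (simp add: indep_vars_def)

lemma sets_P[measurable_cong, simp]: "sets P = sets borel"
  by (subst distr_W[of 1, symmetric]) auto

lemma space_P[simp]: "space P = UNIV"
  using sets_eq_imp_space_eq[OF sets_P] by simp

lemma prob_space_P: "prob_space P"
  by (subst distr_W[of 1, symmetric]) (auto intro!: prob_space_distr measurable_W)

sublocale P: prob_space P by (rule prob_space_P)

sublocale PP: pair_prob_space P P ..

lemma measurable_PP: "f \<in> measurable (P \<Otimes>\<^sub>M P) N \<longleftrightarrow> f \<in> measurable (borel \<Otimes>\<^sub>M borel) N"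
  by (simp only: measurable_cong_sets[OF sets_pair_measure_cong[OF sets_P sets_P] refl])

lemma integral_W:
  fixes \<phi> :: "'d \<Rightarrow> 'b::{banach, second_countable_topology}"
  assumes "i \<ge> 1" "\<phi> \<in> borel_measurable borel"
  shows "(\<integral>\<omega>. \<phi> (W i \<omega>) \<partial>M) = (\<integral>w. \<phi> w \<partial>P)" "integrable M (\<lambda>\<omega>. \<phi> (W i \<omega>)) \<longleftrightarrow> integrable P \<phi>"
  using integral_distr[OF measurable_W[OF assms(1)] assms(2)]
    integrable_distr_eq[OF measurable_W[OF assms(1)] assms(2)] distr_W[OF assms(1)] by auto

lemma AE_W:
  assumes "i \<ge> 1" "AE w in P. Q w"
  shows "AE \<omega> in M. Q (W i \<omega>)"
proof -
  have "AE w in distr M borel (W i). Q w" using assms(2) by (simp only: distr_W[OF assms(1)])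
  then show ?thesis by (rule AE_distrD[OF measurable_W[OF assms(1)]])
qed

lemma indep_restrict_W:
  assumes "I \<subseteq> {1..}" "j \<ge> 1" "j \<notin> I"
  shows "indep_var (PiM I (\<lambda>_. borel)) (\<lambda>\<omega>. restrict (\<lambda>i. W i \<omega>) I)
    (PiM {j} (\<lambda>_. borel)) (\<lambda>\<omega>. restrict (\<lambda>i. W i \<omega>) {j})"
  using assms by (intro indep_var_restrict[OF indep_W]) auto

lemma indep_W_W:
  assumes "i \<ge> 1" "j \<ge> 1" "i \<noteq> j"
  shows "indep_var borel (W i) borel (W j)"
  using indep_var_compose[OF indep_restrict_W[of "{i}" j], of "\<lambda>r. r i" borel "\<lambda>r. r j" borel] assms
  by (simp add: comp_def)

lemma distr_W_W:
  assumes "i \<ge> 1" "j \<ge> 1" "i \<noteq> j"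
  shows "distr M (borel \<Otimes>\<^sub>M borel) (\<lambda>\<omega>. (W i \<omega>, W j \<omega>)) = P \<Otimes>\<^sub>M P"
  using indep_W_W[OF assms] assms by (simp add: indep_var_distribution_eq distr_W)

lemma integral_W_W:
  fixes K :: "'d \<times> 'd \<Rightarrow> 'b::{banach, second_countable_topology}"
  assumes ij: "i \<ge> 1" "j \<ge> 1" "i \<noteq> j" and K: "K \<in> borel_measurable (borel \<Otimes>\<^sub>M borel)"
  shows "(\<integral>\<omega>. K (W i \<omega>, W j \<omega>) \<partial>M) = integral\<^sup>L (P \<Otimes>\<^sub>M P) K"
    "integrable M (\<lambda>\<omega>. K (W i \<omega>, W j \<omega>)) \<longleftrightarrow> integrable (P \<Otimes>\<^sub>M P) K"
proof -
  note [measurable] = measurable_W[OF ij(1)] measurable_W[OF ij(2)]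
  show "(\<integral>\<omega>. K (W i \<omega>, W j \<omega>) \<partial>M) = integral\<^sup>L (P \<Otimes>\<^sub>M P) K"
    "integrable M (\<lambda>\<omega>. K (W i \<omega>, W j \<omega>)) \<longleftrightarrow> integrable (P \<Otimes>\<^sub>M P) K"
    unfolding distr_W_W[OF ij, symmetric] using K
    by (simp_all add: integral_distr integrable_distr_eq)
qed

lemma integrable_coordinate:
  fixes \<phi> :: "'d \<Rightarrow> real"
  assumes \<phi>: "integrable P \<phi>"
  shows "integrable (P \<Otimes>\<^sub>M P) (\<lambda>(w, w'). \<phi> w)" "integrable (P \<Otimes>\<^sub>M P) (\<lambda>(w, w'). \<phi> w')"
proof -
  have [measurable]: "\<phi> \<in> borel_measurable borel" using borel_measurable_integrable[OF \<phi>] by simp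
  have "integrable M (\<lambda>\<omega>. \<phi> (W 1 \<omega>))" "integrable M (\<lambda>\<omega>. \<phi> (W 2 \<omega>))"
    using integral_W(2)[of 1 \<phi>] integral_W(2)[of 2 \<phi>] \<phi> by auto
  then show "integrable (P \<Otimes>\<^sub>M P) (\<lambda>(w, w'). \<phi> w)" "integrable (P \<Otimes>\<^sub>M P) (\<lambda>(w, w'). \<phi> w')"
    using integral_W_W(2)[of 1 2 "\<lambda>(w, w'). \<phi> w"] integral_W_W(2)[of 1 2 "\<lambda>(w, w'). \<phi> w'"] by auto
qed

text \<open>If the sample point \<open>W j\<close> enters a product only through \<open>K\<close>, and \<open>K\<close> is centred in that argument,
  integrating out \<open>W j\<close> first annihilates the product.\<close>

lemma expectation_centred_kernel_eq_0:
  fixes F :: "(nat \<Rightarrow> 'd) \<Rightarrow> real" and K :: "'d \<Rightarrow> 'd \<Rightarrow> real"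
  assumes I: "I \<subseteq> {1..}" "j \<ge> 1" "j \<notin> I" "i \<in> I"
    and F[measurable]: "F \<in> borel_measurable (PiM I (\<lambda>_. borel))"
    and K[measurable]: "case_prod K \<in> borel_measurable (borel \<Otimes>\<^sub>M borel)"
    and centred: "AE w in P. (\<integral>w'. K w w' \<partial>P) = 0"
    and int: "integrable M (\<lambda>\<omega>. F (restrict (\<lambda>i. W i \<omega>) I) * K (W i \<omega>) (W j \<omega>))"
  shows "(\<integral>\<omega>. F (restrict (\<lambda>i. W i \<omega>) I) * K (W i \<omega>) (W j \<omega>) \<partial>M) = 0"
proof -
  let ?R = "\<lambda>\<omega>. restrict (\<lambda>i. W i \<omega>) I" and ?S = "\<lambda>\<omega>. restrict (\<lambda>i. W i \<omega>) {j}"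
  let ?L = "PiM I (\<lambda>_. borel) :: (nat \<Rightarrow> 'd) measure" and ?N = "PiM {j} (\<lambda>_. borel) :: (nat \<Rightarrow> 'd) measure"
  define \<mu> \<nu> where "\<mu> = distr M ?L ?R" and "\<nu> = distr M ?N ?S"
  have R[measurable]: "?R \<in> measurable M ?L"
    by (intro measurable_restrict measurable_W) (use I in auto)
  have S[measurable]: "?S \<in> measurable M ?N"
    by (intro measurable_restrict measurable_W) (use I in auto)
  interpret \<mu>: prob_space \<mu> unfolding \<mu>_def by (rule prob_space_distr) simp
  interpret \<nu>: prob_space \<nu> unfolding \<nu>_def by (rule prob_space_distr) simp
  interpret joint: pair_prob_space \<mu> \<nu> ..
  have [measurable_cong]: "sets \<mu> = sets ?L" "sets \<nu> = sets ?N" by (simp_all add: \<mu>_def \<nu>_def)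
  have [measurable]: "(\<lambda>r. r i) \<in> measurable ?L borel" "(\<lambda>r. r j) \<in> measurable ?N borel"
    using I(4) by measurable
  have law: "\<mu> \<Otimes>\<^sub>M \<nu> = distr M (?L \<Otimes>\<^sub>M ?N) (\<lambda>\<omega>. (?R \<omega>, ?S \<omega>))"
    using indep_restrict_W[OF I(1-3)] by (simp add: indep_var_distribution_eq \<mu>_def \<nu>_def)
  have inner: "(\<integral>s. h (s j) \<partial>\<nu>) = (\<integral>w. h w \<partial>P)" if [measurable]: "h \<in> borel_measurable borel" for h :: "'d \<Rightarrow> real"
    unfolding \<nu>_def using integral_W(1)[OF I(2) that] by (subst integral_distr[OF S]) auto
  let ?G = "\<lambda>(r, s). F r * K (r i) (s j)"
  have G: "?G \<in> borel_measurable (?L \<Otimes>\<^sub>M ?N)" by measurable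
  have intG: "integrable (\<mu> \<Otimes>\<^sub>M \<nu>) ?G"
    unfolding law using int I(4) by (subst integrable_distr_eq[OF _ G]) auto
  have "(\<integral>\<omega>. F (?R \<omega>) * K (W i \<omega>) (W j \<omega>) \<partial>M) = integral\<^sup>L (\<mu> \<Otimes>\<^sub>M \<nu>) ?G"
    unfolding law using I(4) by (subst integral_distr[OF _ G]) auto
  also have "\<dots> = (\<integral>r. (\<integral>s. F r * K (r i) (s j) \<partial>\<nu>) \<partial>\<mu>)"
    using joint.integral_fst'[OF intG] by simp
  also have "\<dots> = (\<integral>r. F r * (\<integral>w. K (r i) w \<partial>P) \<partial>\<mu>)"
    by (simp add: inner)
  also have "\<dots> = (\<integral>r. 0 \<partial>\<mu>)"
  proof (rule integral_cong_AE)
    have "AE \<omega> in M. (\<integral>w'. K (?R \<omega> i) w' \<partial>P) = 0"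
      using AE_W[OF _ centred, of i] I by auto
    then have "AE r in \<mu>. (\<integral>w'. K (r i) w' \<partial>P) = 0"
      unfolding \<mu>_def by (subst AE_distr_iff[OF R]) measurable
    then show "AE r in \<mu>. F r * (\<integral>w. K (r i) w \<partial>P) = 0"
      by eventually_elim simp
  qed measurable
  finally show ?thesis by simp
qed

lemma iid_sum_L2:
  fixes \<phi> :: "'d \<Rightarrow> 'b::euclidean_space"
  assumes \<phi>[measurable]: "\<phi> \<in> borel_measurable borel" and sq: "integrable P (\<lambda>w. (norm (\<phi> w))\<^sup>2)"
    and mean: "(\<integral>w. \<phi> w \<partial>P) = 0"
  shows "integrable M (\<lambda>\<omega>. (norm (\<Sum>i=1..n. \<phi> (W i \<omega>)))\<^sup>2)"
    and "(\<integral>\<omega>. (norm (\<Sum>i=1..n. \<phi> (W i \<omega>)))\<^sup>2 \<partial>M) = real n * (\<integral>w. (norm (\<phi> w))\<^sup>2 \<partial>P)"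
proof -
  have W: "W i \<in> borel_measurable M" if "i \<in> {1..n}" for i using that by (intro measurable_W) auto
  have sqM: "integrable M (\<lambda>\<omega>. (norm (\<phi> (W i \<omega>)))\<^sup>2)" if "i \<in> {1..n}" for i
    using integral_W(2)[of i "\<lambda>w. (norm (\<phi> w))\<^sup>2"] sq that by auto
  have inner: "integrable M (\<lambda>\<omega>. \<phi> (W i \<omega>) \<bullet> \<phi> (W j \<omega>))" if ij: "i \<in> {1..n}" "j \<in> {1..n}" for i j
  proof (rule Bochner_Integration.integrable_bound)
    note [measurable] = W[OF ij(1)] W[OF ij(2)]
    show "integrable M (\<lambda>\<omega>. (norm (\<phi> (W i \<omega>)))\<^sup>2 + (norm (\<phi> (W j \<omega>)))\<^sup>2)"
      using ij by (intro Bochner_Integration.integrable_add sqM)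
    show "(\<lambda>\<omega>. \<phi> (W i \<omega>) \<bullet> \<phi> (W j \<omega>)) \<in> borel_measurable M" by measurable
    show "AE \<omega> in M. norm (\<phi> (W i \<omega>) \<bullet> \<phi> (W j \<omega>)) \<le> norm ((norm (\<phi> (W i \<omega>)))\<^sup>2 + (norm (\<phi> (W j \<omega>)))\<^sup>2)"
    proof (rule AE_I2)
      fix \<omega>
      let ?a = "norm (\<phi> (W i \<omega>))" and ?b = "norm (\<phi> (W j \<omega>))"
      have "\<bar>\<phi> (W i \<omega>) \<bullet> \<phi> (W j \<omega>)\<bar> \<le> ?a * ?b" by (rule Cauchy_Schwarz_ineq2)
      also have "\<dots> \<le> ?a\<^sup>2 + ?b\<^sup>2"
        using sum_squares_bound[of ?a ?b] mult_nonneg_nonneg[OF norm_ge_zero norm_ge_zero, of "\<phi> (W i \<omega>)" "\<phi> (W j \<omega>)"]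
        unfolding mult.assoc by linarith
      finally show "norm (\<phi> (W i \<omega>) \<bullet> \<phi> (W j \<omega>)) \<le> norm (?a\<^sup>2 + ?b\<^sup>2)" by simp
    qed
  qed
  have ortho: "(\<integral>\<omega>. \<phi> (W i \<omega>) \<bullet> \<phi> (W j \<omega>) \<partial>M) = 0" if ij: "i \<in> {1..n}" "j \<in> {1..n}" "i \<noteq> j" for i j
  proof -
    let ?K = "\<lambda>(w, w'). \<phi> w \<bullet> \<phi> w'"
    have K: "?K \<in> borel_measurable (borel \<Otimes>\<^sub>M borel)" by measurable
    have intK: "integrable (P \<Otimes>\<^sub>M P) ?K"
      using integral_W_W(2)[OF _ _ _ K, of i j] inner[OF ij(1,2)] ij by auto
    have \<phi>int: "integrable P \<phi>"
    proof (rule Bochner_Integration.integrable_bound)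
      show "integrable P (\<lambda>w. 1 + (norm (\<phi> w))\<^sup>2)" using sq by simp
      have "t \<le> 1 + t\<^sup>2" for t :: real
        using sum_squares_bound[of 1 t] zero_le_power2[of t] unfolding one_power2 mult_1_right by linarith
      then show "AE w in P. norm (\<phi> w) \<le> norm (1 + (norm (\<phi> w))\<^sup>2)" by (auto simp: abs_of_nonneg)
    qed measurable
    have "(\<integral>\<omega>. \<phi> (W i \<omega>) \<bullet> \<phi> (W j \<omega>) \<partial>M) = integral\<^sup>L (P \<Otimes>\<^sub>M P) ?K"
      using integral_W_W(1)[OF _ _ _ K, of i j] ij by auto
    also have "\<dots> = (\<integral>w. (\<integral>w'. \<phi> w \<bullet> \<phi> w' \<partial>P) \<partial>P)"
      using PP.integral_fst'[OF intK] by simp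
    also have "\<dots> = 0" using \<phi>int mean by simp
    finally show ?thesis .
  qed
  have expand: "(norm (\<Sum>i=1..n. \<phi> (W i \<omega>)))\<^sup>2 = (\<Sum>i=1..n. \<Sum>j=1..n. \<phi> (W i \<omega>) \<bullet> \<phi> (W j \<omega>))" for \<omega>
    by (simp add: power2_norm_eq_inner inner_sum_left inner_sum_right) (rule sum.swap)
  show "integrable M (\<lambda>\<omega>. (norm (\<Sum>i=1..n. \<phi> (W i \<omega>)))\<^sup>2)"
    unfolding expand by (intro Bochner_Integration.integrable_sum inner)
  have "(\<integral>\<omega>. (norm (\<Sum>i=1..n. \<phi> (W i \<omega>)))\<^sup>2 \<partial>M) = (\<Sum>i=1..n. \<Sum>j=1..n. \<integral>\<omega>. \<phi> (W i \<omega>) \<bullet> \<phi> (W j \<omega>) \<partial>M)"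
    unfolding expand
    by (subst Bochner_Integration.integral_sum)
       (intro Bochner_Integration.integrable_sum inner sum.cong refl Bochner_Integration.integral_sum; assumption)+
  also have "\<dots> = (\<Sum>i=1..n. \<Sum>j=1..n. if j = i then \<integral>w. (norm (\<phi> w))\<^sup>2 \<partial>P else 0)"
  proof (intro sum.cong refl)
    fix i j assume ij: "i \<in> {1..n}" "j \<in> {1..n}"
    show "(\<integral>\<omega>. \<phi> (W i \<omega>) \<bullet> \<phi> (W j \<omega>) \<partial>M) = (if j = i then \<integral>w. (norm (\<phi> w))\<^sup>2 \<partial>P else 0)"
      using ortho[OF ij] integral_W(1)[of i "\<lambda>w. (norm (\<phi> w))\<^sup>2"] ij
      by (auto simp: power2_norm_eq_inner)
  qed
  also have "\<dots> = real n * (\<integral>w. (norm (\<phi> w))\<^sup>2 \<partial>P)" by simp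
  finally show "(\<integral>\<omega>. (norm (\<Sum>i=1..n. \<phi> (W i \<omega>)))\<^sup>2 \<partial>M) = real n * (\<integral>w. (norm (\<phi> w))\<^sup>2 \<partial>P)" .
qed

lemma normalized_sum_L2:
  fixes \<phi> :: "'d \<Rightarrow> 'b::euclidean_space"
  assumes \<phi>[measurable]: "\<phi> \<in> borel_measurable borel" and sq: "integrable P (\<lambda>w. (norm (\<phi> w))\<^sup>2)"
    and mean: "(\<integral>w. \<phi> w \<partial>P) = 0"
  defines "Z \<equiv> \<lambda>n \<omega>. (1 / sqrt (real n)) *\<^sub>R (\<Sum>i=1..n. \<phi> (W i \<omega>))"
  shows "Z n \<in> borel_measurable M" and "integrable M (\<lambda>\<omega>. (norm (Z n \<omega>))\<^sup>2)"
    and "(\<integral>\<omega>. (norm (Z n \<omega>))\<^sup>2 \<partial>M) \<le> (\<integral>w. (norm (\<phi> w))\<^sup>2 \<partial>P)" and "O_P_one M Z"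
proof -
  show meas: "Z n \<in> borel_measurable M" for n
    unfolding Z_def by (intro borel_measurable_scaleR borel_measurable_const borel_measurable_sum
        measurable_compose[OF measurable_W \<phi>]) auto
  have norm_Z: "(norm (Z n \<omega>))\<^sup>2 = (1 / real n) * (norm (\<Sum>i=1..n. \<phi> (W i \<omega>)))\<^sup>2" for n \<omega>
    by (simp add: Z_def power_divide)
  show int: "integrable M (\<lambda>\<omega>. (norm (Z n \<omega>))\<^sup>2)" for n
    unfolding norm_Z using iid_sum_L2(1)[OF assms(1-3)] by simp
  show le: "(\<integral>\<omega>. (norm (Z n \<omega>))\<^sup>2 \<partial>M) \<le> (\<integral>w. (norm (\<phi> w))\<^sup>2 \<partial>P)" for n
    unfolding norm_Z using iid_sum_L2(2)[OF assms(1-3), of n] by (cases "n = 0") simp_all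
  show "O_P_one M Z" by (rule O_P_one_of_L2[OF meas int le])
qed

lemma iid_central_limit:
  fixes \<phi> :: "'d \<Rightarrow> real"
  assumes \<phi>[measurable]: "\<phi> \<in> borel_measurable borel" and sq: "integrable P (\<lambda>w. (\<phi> w)\<^sup>2)"
    and mean: "(\<integral>w. \<phi> w \<partial>P) = 0"
  shows "weak_conv_m (\<lambda>n. distr M borel (\<lambda>\<omega>. (1 / sqrt (real n)) * (\<Sum>i=1..n. \<phi> (W i \<omega>))))
    (normal_law 0 (\<integral>w. (\<phi> w)\<^sup>2 \<partial>P))"
proof -
  define v where "v = (\<integral>w. (\<phi> w)\<^sup>2 \<partial>P)"
  let ?Z = "\<lambda>n \<omega>. (1 / sqrt (real n)) * (\<Sum>i=1..n. \<phi> (W i \<omega>))"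
  have sq': "integrable P (\<lambda>w. (norm (\<phi> w))\<^sup>2)" using sq by simp
  note L2 = normalized_sum_L2[OF \<phi> sq' mean, unfolded real_scaleR_def]
  have "v \<ge> 0" by (simp add: v_def)
  then consider "v = 0" | "v > 0" by linarith
  then have "weak_conv_m (\<lambda>n. distr M borel (?Z n)) (normal_law 0 v)"
  proof cases
    case 1
    \<comment> \<open>the normalised sums vanish almost surely, and the limit law is the point mass at \<open>0\<close>\<close>
    interpret std: real_distribution std_normal_distribution by (rule real_dist_normal_dist)
    have "normal_law 0 v = return borel 0" using 1 by (simp add: normal_law_def std.distr_const)
    moreover have "distr M borel (\<lambda>_. 0::real) = return borel 0" by (simp add: distr_const)
    ultimately have *: "weak_conv_m (\<lambda>n. distr M borel ((\<lambda>n _. 0::real) n)) (normal_law 0 v)"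
      by (simp add: weak_conv_m_def weak_conv_def)
    have 0: "(\<integral>\<omega>. (norm (?Z n \<omega>))\<^sup>2 \<partial>M) = 0" for n
      using L2(3)[of n] 1 by (intro antisym) (auto simp: v_def)
    have "o_P_one M ?Z"
      by (rule o_P_one_of_L2[OF L2(1,2)]) (simp only: 0 tendsto_const)
    then show ?thesis
      by (intro weak_conv_add_o_P_one[OF _ real_distribution_normal_law *]) simp_all
  next
    case 2
    \<comment> \<open>the sample starts at index \<open>1\<close>, the sequence in the central limit theorem at \<open>0\<close>\<close>
    let ?X = "\<lambda>i \<omega>. \<phi> (W (Suc i) \<omega>)"
    have "indep_vars (\<lambda>_. borel) (\<lambda>i. W (Suc i)) UNIV"
    proof -
      have "indep_vars (\<lambda>j. PiM {Suc j} (\<lambda>_. borel)) (\<lambda>j \<omega>. restrict (\<lambda>i. W i \<omega>) {Suc j}) UNIV"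
        by (rule indep_vars_restrict[OF indep_W]) (auto simp: disjoint_family_on_def)
      from indep_vars_compose2[OF this, of "\<lambda>j r. r (Suc j)" "\<lambda>_. borel"] show ?thesis by simp
    qed
    from indep_vars_compose2[OF this, of "\<lambda>_. \<phi>" "\<lambda>_. borel"]
    have ind: "indep_vars (\<lambda>_. borel) ?X UNIV" by simp
    have EX: "expectation (?X n) = 0" for n using integral_W(1)[of "Suc n" \<phi>] mean by simp
    have sqX: "integrable M (\<lambda>\<omega>. (?X n \<omega>)\<^sup>2)" for n
      using integral_W(2)[of "Suc n" "\<lambda>w. (\<phi> w)\<^sup>2"] sq by simp
    have varX: "variance (?X n) = (sqrt v)\<^sup>2" for n
      using integral_W(1)[of "Suc n" "\<lambda>w. (\<phi> w)\<^sup>2"] 2 EX[of n] by (simp add: v_def)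
    have distrX: "distr M borel (?X n) = distr P borel \<phi>" for n
      using distr_distr[OF \<phi> measurable_W[of "Suc n"]] distr_W[of "Suc n"] by (simp add: comp_def)
    have "weak_conv_m (\<lambda>n. distr M borel (\<lambda>\<omega>. (\<Sum>i<n. ?X i \<omega>) / sqrt (n * (sqrt v)\<^sup>2))) std_normal_distribution"
      by (rule central_limit_theorem_zero_mean[OF ind EX _ sqX varX distrX]) (use 2 in simp)
    moreover have m: "(\<lambda>\<omega>. (\<Sum>i<n. ?X i \<omega>) / sqrt (n * (sqrt v)\<^sup>2)) \<in> borel_measurable M" for n
      by (intro borel_measurable_divide borel_measurable_const borel_measurable_sum
        measurable_compose[OF measurable_W \<phi>]) auto
    ultimately have "weak_conv_m (\<lambda>n. distr (distr M borel (\<lambda>\<omega>. (\<Sum>i<n. ?X i \<omega>) / sqrt (n * (sqrt v)\<^sup>2))) borel ((*) (sqrt v)))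
       (distr std_normal_distribution borel ((*) (sqrt v)))"
      by (intro weak_conv_m_scale real_dist_normal_dist distr_real_distribution)
    also have "(\<lambda>n. distr (distr M borel (\<lambda>\<omega>. (\<Sum>i<n. ?X i \<omega>) / sqrt (n * (sqrt v)\<^sup>2))) borel ((*) (sqrt v)))
        = (\<lambda>n. distr M borel (?Z n))"
    proof
      fix n
      have "(\<Sum>i<n. ?X i \<omega>) = (\<Sum>i=1..n. \<phi> (W i \<omega>))" for \<omega>
        by (simp add: sum.atLeast1_atMost_eq)
      then have "((*) (sqrt v)) \<circ> (\<lambda>\<omega>. (\<Sum>i<n. ?X i \<omega>) / sqrt (n * (sqrt v)\<^sup>2)) = ?Z n"
        using 2 by (auto simp: fun_eq_iff real_sqrt_mult)
      then show "distr (distr M borel (\<lambda>\<omega>. (\<Sum>i<n. ?X i \<omega>) / sqrt (n * (sqrt v)\<^sup>2))) borel ((*) (sqrt v))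
          = distr M borel (?Z n)"
        by (subst distr_distr[OF _ m]) auto
    qed
    also have "distr std_normal_distribution borel ((*) (sqrt v)) = normal_law 0 v"
      by (simp add: normal_law_def)
    finally show ?thesis .
  qed
  then show ?thesis by (simp add: v_def)
qed

section \<open>V-statistics\<close>

text \<open>Two different unordered pairs of indices contain an index that occurs in only one of the two factors;
  integrating out that sample point first gives \<open>0\<close>.\<close>

lemma degenerate_kernel_orthogonal:
  fixes D :: "'d \<Rightarrow> 'd \<Rightarrow> real"
  assumes D[measurable]: "case_prod D \<in> borel_measurable (borel \<Otimes>\<^sub>M borel)"
    and deg1: "AE w in P. (\<integral>w'. D w w' \<partial>P) = 0" and deg2: "AE w' in P. (\<integral>w. D w w' \<partial>P) = 0"
    and ij: "i \<ge> 1" "j \<ge> 1" "i \<noteq> j" and kl: "k \<ge> 1" "l \<ge> 1" "k \<noteq> l" and ne: "{i, j} \<noteq> {k, l}"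
    and int: "integrable M (\<lambda>\<omega>. D (W i \<omega>) (W j \<omega>) * D (W k \<omega>) (W l \<omega>))"
  shows "(\<integral>\<omega>. D (W i \<omega>) (W j \<omega>) * D (W k \<omega>) (W l \<omega>) \<partial>M) = 0"
proof -
  have mk: "(\<lambda>r. D (r k) (r l)) \<in> borel_measurable (PiM I (\<lambda>_. borel))" if "k \<in> I" "l \<in> I" for I :: "nat set"
  proof -
    have [measurable]: "(\<lambda>r. r k) \<in> measurable (PiM I (\<lambda>_. borel)) borel" "(\<lambda>r. r l) \<in> measurable (PiM I (\<lambda>_. borel)) borel"
      using that by measurable
    show ?thesis by measurable
  qed
  consider "j \<notin> {i, k, l}" | "i \<notin> {j, k, l}" using ij kl ne by auto
  then show ?thesis
  proof cases
    case 1
    let ?I = "{i, k, l}"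
    have "(\<integral>\<omega>. D (restrict (\<lambda>i. W i \<omega>) ?I k) (restrict (\<lambda>i. W i \<omega>) ?I l) * D (W i \<omega>) (W j \<omega>) \<partial>M) = 0"
      by (rule expectation_centred_kernel_eq_0[where F = "\<lambda>r. D (r k) (r l)"])
         (use 1 ij kl int deg1 mk D in \<open>auto simp: mult.commute\<close>)
    then show ?thesis by (simp add: mult.commute)
  next
    case 2
    let ?I = "{j, k, l}"
    have D': "(\<lambda>(w, w'). D w' w) \<in> borel_measurable (borel \<Otimes>\<^sub>M borel)" by measurable
    have "(\<integral>\<omega>. D (restrict (\<lambda>i. W i \<omega>) ?I k) (restrict (\<lambda>i. W i \<omega>) ?I l) * D (W i \<omega>) (W j \<omega>) \<partial>M) = 0"
      by (rule expectation_centred_kernel_eq_0[where F = "\<lambda>r. D (r k) (r l)" and K = "\<lambda>w w'. D w' w"])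
         (use 2 ij kl int deg2 mk D' in \<open>auto simp: mult.commute\<close>)
    then show ?thesis by (simp add: mult.commute)
  qed
qed

text \<open>An off-diagonal term is correlated only with itself and with the term for the swapped pair. Of the
  \<open>n\<^sup>4\<close> products in the square at most \<open>2 n\<^sup>2\<close> have a nonzero expectation.\<close>

lemma degenerate_off_diagonal_L2:
  fixes D :: "'d \<Rightarrow> 'd \<Rightarrow> real"
  assumes D[measurable]: "case_prod D \<in> borel_measurable (borel \<Otimes>\<^sub>M borel)"
    and sq: "integrable (P \<Otimes>\<^sub>M P) (\<lambda>(w, w'). (D w w')\<^sup>2)"
    and deg: "AE w in P. (\<integral>w'. D w w' \<partial>P) = 0" "AE w' in P. (\<integral>w. D w w' \<partial>P) = 0"
  defines "J \<equiv> \<lambda>n::nat. {(i, j). i \<in> {1..n} \<and> j \<in> {1..n} \<and> i \<noteq> j}"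
  shows "integrable M (\<lambda>\<omega>. (\<Sum>(i, j)\<in>J n. D (W i \<omega>) (W j \<omega>))\<^sup>2)"
    and "(\<integral>\<omega>. (\<Sum>(i, j)\<in>J n. D (W i \<omega>) (W j \<omega>))\<^sup>2 \<partial>M)
      \<le> 2 * (real n)\<^sup>2 * (\<integral>(w, w'). (D w w')\<^sup>2 \<partial>(P \<Otimes>\<^sub>M P))"
proof -
  define C where "C = (\<integral>(w, w'). (D w w')\<^sup>2 \<partial>(P \<Otimes>\<^sub>M P))"
  let ?X = "\<lambda>p \<omega>. D (W (fst p) \<omega>) (W (snd p) \<omega>)"
  have sub: "J n \<subseteq> {1..n} \<times> {1..n}" by (auto simp: J_def)
  have fin: "finite (J n)" by (rule finite_subset[OF sub]) simp
  have C0: "C \<ge> 0" unfolding C_def by (intro integral_nonneg_AE) auto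
  have X[measurable]: "?X p \<in> borel_measurable M" if "p \<in> J n" for p
  proof -
    have [measurable]: "W (fst p) \<in> borel_measurable M" "W (snd p) \<in> borel_measurable M"
      using that by (auto simp: J_def intro!: measurable_W)
    show ?thesis by measurable
  qed
  have X2: "integrable M (\<lambda>\<omega>. (?X p \<omega>)\<^sup>2)" "(\<integral>\<omega>. (?X p \<omega>)\<^sup>2 \<partial>M) = C" if "p \<in> J n" for p
    using integral_W_W[of "fst p" "snd p" "\<lambda>(w, w'). (D w w')\<^sup>2"] that sq
    by (auto simp: J_def C_def)
  have bound: "\<bar>?X p \<omega> * ?X q \<omega>\<bar> \<le> ((?X p \<omega>)\<^sup>2 + (?X q \<omega>)\<^sup>2) / 2" for p q \<omega>
    using sum_squares_bound[of "\<bar>?X p \<omega>\<bar>" "\<bar>?X q \<omega>\<bar>"] by (simp add: abs_mult)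
  have XX: "integrable M (\<lambda>\<omega>. ?X p \<omega> * ?X q \<omega>)" if "p \<in> J n" "q \<in> J n" for p q
  proof (rule Bochner_Integration.integrable_bound)
    show "integrable M (\<lambda>\<omega>. ((?X p \<omega>)\<^sup>2 + (?X q \<omega>)\<^sup>2) / 2)" using that X2 by auto
    show "AE \<omega> in M. norm (?X p \<omega> * ?X q \<omega>) \<le> norm (((?X p \<omega>)\<^sup>2 + (?X q \<omega>)\<^sup>2) / 2)"
      using bound by (intro AE_I2) (simp only: real_norm_def, rule order_trans[OF _ abs_ge_self])
    show "(\<lambda>\<omega>. ?X p \<omega> * ?X q \<omega>) \<in> borel_measurable M"
      using X[OF that(1)] X[OF that(2)] by (rule borel_measurable_times)
  qed
  have EXX: "(\<integral>\<omega>. ?X p \<omega> * ?X q \<omega> \<partial>M) \<le> C" if "p \<in> J n" "q \<in> J n" for p q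
  proof -
    have "(\<integral>\<omega>. ?X p \<omega> * ?X q \<omega> \<partial>M) \<le> (\<integral>\<omega>. ((?X p \<omega>)\<^sup>2 + (?X q \<omega>)\<^sup>2) / 2 \<partial>M)"
      by (intro integral_mono XX[OF that] order_trans[OF abs_ge_self bound]) (use that X2 in auto)
    also have "\<dots> = C" using that X2 by simp
    finally show ?thesis .
  qed
  have ortho: "(\<integral>\<omega>. ?X p \<omega> * ?X q \<omega> \<partial>M) = 0" if "p \<in> J n" "q \<in> J n" "q \<notin> {p, prod.swap p}" for p q
    using that
    by (intro degenerate_kernel_orthogonal[OF D deg] XX) (auto simp: J_def doubleton_eq_iff prod_eq_iff)
  have expand: "(\<Sum>(i, j)\<in>J n. D (W i \<omega>) (W j \<omega>))\<^sup>2 = (\<Sum>p\<in>J n. \<Sum>q\<in>J n. ?X p \<omega> * ?X q \<omega>)" for \<omega>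
    by (simp add: power2_eq_square sum_product case_prod_unfold)
  show "integrable M (\<lambda>\<omega>. (\<Sum>(i, j)\<in>J n. D (W i \<omega>) (W j \<omega>))\<^sup>2)"
    unfolding expand by (intro Bochner_Integration.integrable_sum XX)
  have "(\<integral>\<omega>. (\<Sum>(i, j)\<in>J n. D (W i \<omega>) (W j \<omega>))\<^sup>2 \<partial>M) = (\<Sum>p\<in>J n. \<Sum>q\<in>J n. \<integral>\<omega>. ?X p \<omega> * ?X q \<omega> \<partial>M)"
    unfolding expand by (simp add: XX)
  also have "\<dots> \<le> (\<Sum>p\<in>J n. 2 * C)"
  proof (rule sum_mono)
    fix p assume p: "p \<in> J n"
    then have sw: "prod.swap p \<in> J n" by (auto simp: J_def)
    have "(\<Sum>q\<in>J n. \<integral>\<omega>. ?X p \<omega> * ?X q \<omega> \<partial>M) = (\<Sum>q\<in>{p, prod.swap p}. \<integral>\<omega>. ?X p \<omega> * ?X q \<omega> \<partial>M)"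
      using fin p sw ortho by (intro sum.mono_neutral_right) auto
    also have "\<dots> \<le> (\<Sum>q\<in>{p, prod.swap p}. C)"
      using EXX[OF p p] EXX[OF p sw] by (intro sum_mono) auto
    also have "\<dots> \<le> 2 * C"
      using C0 by (simp add: card_insert_if)
    finally show "(\<Sum>q\<in>J n. \<integral>\<omega>. ?X p \<omega> * ?X q \<omega> \<partial>M) \<le> 2 * C" .
  qed
  also have "\<dots> = real (card (J n)) * (2 * C)" by simp
  also have "\<dots> \<le> (real n)\<^sup>2 * (2 * C)"
  proof (rule mult_right_mono)
    have "card (J n) \<le> card ({1..n} \<times> {1..n})" using sub by (intro card_mono) auto
    also have "\<dots> = n\<^sup>2" by (simp add: card_cartesian_product power2_eq_square)
    finally show "real (card (J n)) \<le> (real n)\<^sup>2" by (metis of_nat_le_iff of_nat_power)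
  qed (use C0 in simp)
  finally show "(\<integral>\<omega>. (\<Sum>(i, j)\<in>J n. D (W i \<omega>) (W j \<omega>))\<^sup>2 \<partial>M) \<le> 2 * (real n)\<^sup>2 * (\<integral>(w, w'). (D w w')\<^sup>2 \<partial>(P \<Otimes>\<^sub>M P))"
    by (simp add: C_def mult_ac)
qed

text \<open>The off-diagonal part has a second moment of order \<open>1/n\<close>, the diagonal part a first moment of order
  \<open>1/sqrt n\<close>.\<close>

lemma degenerate_V_statistic:
  fixes D :: "'d \<Rightarrow> 'd \<Rightarrow> real"
  assumes D[measurable]: "case_prod D \<in> borel_measurable (borel \<Otimes>\<^sub>M borel)"
    and sq: "integrable (P \<Otimes>\<^sub>M P) (\<lambda>(w, w'). (D w w')\<^sup>2)"
    and deg: "AE w in P. (\<integral>w'. D w w' \<partial>P) = 0" "AE w' in P. (\<integral>w. D w w' \<partial>P) = 0"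
    and diag: "integrable P (\<lambda>w. D w w)"
  shows "o_P_one M (\<lambda>n \<omega>. sqrt (real n) * ((1 / (real n)\<^sup>2) * (\<Sum>i=1..n. \<Sum>j=1..n. D (W i \<omega>) (W j \<omega>))))"
proof -
  define J where "J = (\<lambda>n::nat. {(i, j). i \<in> {1..n} \<and> j \<in> {1..n} \<and> i \<noteq> j})"
  define C where "C = (\<integral>(w, w'). (D w w')\<^sup>2 \<partial>(P \<Otimes>\<^sub>M P))"
  let ?c = "\<lambda>n. sqrt (real n) * (1 / (real n)\<^sup>2)"
  let ?O = "\<lambda>n \<omega>. ?c n * (\<Sum>(i, j)\<in>J n. D (W i \<omega>) (W j \<omega>))"
  let ?G = "\<lambda>n \<omega>. ?c n * (\<Sum>i=1..n. D (W i \<omega>) (W i \<omega>))"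
  have L2: "integrable M (\<lambda>\<omega>. (\<Sum>(i, j)\<in>J n. D (W i \<omega>) (W j \<omega>))\<^sup>2)"
    "(\<integral>\<omega>. (\<Sum>(i, j)\<in>J n. D (W i \<omega>) (W j \<omega>))\<^sup>2 \<partial>M) \<le> 2 * (real n)\<^sup>2 * C" for n
    unfolding J_def C_def by (rule degenerate_off_diagonal_L2[OF D sq deg])+
  have C0: "C \<ge> 0" unfolding C_def by (intro integral_nonneg_AE) auto
  have DW: "(\<lambda>\<omega>. D (W i \<omega>) (W j \<omega>)) \<in> borel_measurable M" if "i \<in> {1..n}" "j \<in> {1..n}" for i j n
  proof -
    have [measurable]: "W i \<in> borel_measurable M" "W j \<in> borel_measurable M" using that by (auto intro!: measurable_W)
    show ?thesis by measurable
  qed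
  have c2: "(?c n)\<^sup>2 = 1 / real n ^ 3" for n
    by (simp add: power_mult_distrib power_divide field_simps eval_nat_numeral)
  have "o_P_one M ?O"
  proof (rule o_P_one_of_L2)
    have "(\<lambda>\<omega>. D (W (fst p) \<omega>) (W (snd p) \<omega>)) \<in> borel_measurable M" if "p \<in> J n" for p n
      using DW[of "fst p" n "snd p"] that by (auto simp: J_def)
    then show "?O n \<in> borel_measurable M" for n
      unfolding case_prod_unfold by (intro borel_measurable_times borel_measurable_const borel_measurable_sum)
    have O2: "(norm (?O n \<omega>))\<^sup>2 = (1 / real n ^ 3) * (\<Sum>(i, j)\<in>J n. D (W i \<omega>) (W j \<omega>))\<^sup>2" for n \<omega>
      by (simp only: real_norm_def power2_abs power_mult_distrib[of "?c n"] c2)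
    show "integrable M (\<lambda>\<omega>. (norm (?O n \<omega>))\<^sup>2)" for n unfolding O2 using L2(1) by simp
    have le: "expectation (\<lambda>\<omega>. (norm (?O n \<omega>))\<^sup>2) \<le> 2 * C / real n" for n
    proof -
      have "expectation (\<lambda>\<omega>. (norm (?O n \<omega>))\<^sup>2) = (1 / real n ^ 3) * (\<integral>\<omega>. (\<Sum>(i, j)\<in>J n. D (W i \<omega>) (W j \<omega>))\<^sup>2 \<partial>M)"
        unfolding O2 by simp
      also have "\<dots> \<le> (1 / real n ^ 3) * (2 * (real n)\<^sup>2 * C)"
        by (intro mult_left_mono L2(2)) simp
      also have "\<dots> = 2 * C / real n" by (cases "n = 0") (simp_all add: field_simps eval_nat_numeral)
      finally show ?thesis .
    qed
    show "(\<lambda>n. expectation (\<lambda>\<omega>. (norm (?O n \<omega>))\<^sup>2)) \<longlonglongrightarrow> 0"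
    proof (rule tendsto_sandwich)
      show "\<forall>\<^sub>F n in sequentially. 0 \<le> expectation (\<lambda>\<omega>. (norm (?O n \<omega>))\<^sup>2)"
        by (intro always_eventually allI integral_nonneg_AE AE_I2) simp
      show "\<forall>\<^sub>F n in sequentially. expectation (\<lambda>\<omega>. (norm (?O n \<omega>))\<^sup>2) \<le> 2 * C / real n"
        using le by (intro always_eventually allI)
      show "(\<lambda>n. 2 * C / real n) \<longlonglongrightarrow> 0" by (rule lim_const_over_n)
      show "(\<lambda>_. 0::real) \<longlonglongrightarrow> 0" by simp
    qed
  qed
  moreover have "o_P_one M ?G"
  proof (rule o_P_one_of_L1)
    show "?G n \<in> borel_measurable M" for n
      by (intro borel_measurable_times borel_measurable_const borel_measurable_sum DW)
    have Di: "integrable M (\<lambda>\<omega>. \<bar>D (W i \<omega>) (W i \<omega>)\<bar>)" "expectation (\<lambda>\<omega>. \<bar>D (W i \<omega>) (W i \<omega>)\<bar>) = (\<integral>w. \<bar>D w w\<bar> \<partial>P)"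
      if "i \<in> {1..n}" for i n
      using integral_W[of i "\<lambda>w. \<bar>D w w\<bar>"] that diag by auto
    let ?Y = "\<lambda>n \<omega>. ?c n * (\<Sum>i=1..n. \<bar>D (W i \<omega>) (W i \<omega>)\<bar>)"
    show "integrable M (?Y n)" for n
      using Di(1) by (intro integrable_mult_right Bochner_Integration.integrable_sum) auto
    show "norm (?G n \<omega>) \<le> ?Y n \<omega>" for n \<omega>
      by (simp add: abs_mult divide_right_mono mult_left_mono sum_abs)
    have "expectation (?Y n) = (\<integral>w. \<bar>D w w\<bar> \<partial>P) / sqrt (real n)" for n
    proof -
      have "expectation (?Y n) = ?c n * (\<Sum>i=1..n. expectation (\<lambda>\<omega>. \<bar>D (W i \<omega>) (W i \<omega>)\<bar>))"
        by (subst integral_mult_right_zero, subst Bochner_Integration.integral_sum) (use Di(1) in auto)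
      also have "\<dots> = ?c n * (real n * (\<integral>w. \<bar>D w w\<bar> \<partial>P))"
        using Di(2)[of _ n] by simp
      also have "\<dots> = (\<integral>w. \<bar>D w w\<bar> \<partial>P) / sqrt (real n)"
        by (cases "n = 0") (simp_all add: field_simps power2_eq_square)
      finally show ?thesis .
    qed
    moreover have "(\<lambda>n. (\<integral>w. \<bar>D w w\<bar> \<partial>P) / sqrt (real n)) \<longlonglongrightarrow> 0"
      by (intro real_tendsto_divide_at_top[OF tendsto_const]
          filterlim_compose[OF sqrt_at_top filterlim_real_sequentially])
    ultimately show "(\<lambda>n. expectation (?Y n)) \<longlonglongrightarrow> 0" by simp
  qed
  ultimately have "o_P_one M (\<lambda>n \<omega>. ?O n \<omega> + ?G n \<omega>)" by (rule o_P_one_add)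
  then show ?thesis
  proof (rule o_P_one_cong)
    fix n \<omega>
    have dec: "{1..n} \<times> {1..n} = J n \<union> (\<lambda>i. (i, i)) ` {1..n}" by (auto simp: J_def)
    have fin: "finite (J n)" by (rule finite_subset[of _ "{1..n} \<times> {1..n}"]) (auto simp: J_def)
    have "(\<Sum>i=1..n. \<Sum>j=1..n. D (W i \<omega>) (W j \<omega>)) = (\<Sum>(i, j)\<in>{1..n} \<times> {1..n}. D (W i \<omega>) (W j \<omega>))"
      by (rule sum.cartesian_product)
    also have "\<dots> = (\<Sum>(i, j)\<in>J n. D (W i \<omega>) (W j \<omega>)) + (\<Sum>(i, j)\<in>(\<lambda>i. (i, i)) ` {1..n}. D (W i \<omega>) (W j \<omega>))"
      unfolding dec using fin by (intro sum.union_disjoint) (auto simp: J_def)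
    also have "(\<Sum>(i, j)\<in>(\<lambda>i. (i, i)) ` {1..n}. D (W i \<omega>) (W j \<omega>)) = (\<Sum>i=1..n. D (W i \<omega>) (W i \<omega>))"
      by (subst sum.reindex) (auto simp: inj_on_def)
    finally show "sqrt (real n) * (1 / (real n)\<^sup>2 * (\<Sum>i=1..n. \<Sum>j=1..n. D (W i \<omega>) (W j \<omega>))) = ?O n \<omega> + ?G n \<omega>"
      by (simp add: distrib_left mult.assoc)
  qed
qed

text \<open>Hoeffding's projection. Subtracting from \<open>K\<close> its two conditional expectations leaves a degenerate
  kernel. When these are summed over all pairs, diagonal included, each sample point is counted
  exactly \<open>n\<close> times in either coordinate, so that the subtracted part is exactly \<open>n \<Sum>\<^sub>i \<psi> (W i)\<close>.\<close>

lemma V_statistic_projection: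
  fixes K :: "'d \<Rightarrow> 'd \<Rightarrow> real"
  assumes K[measurable]: "case_prod K \<in> borel_measurable (borel \<Otimes>\<^sub>M borel)"
    and sq: "integrable (P \<Otimes>\<^sub>M P) (\<lambda>(w, w'). (K w w')\<^sup>2)"
    and diag: "integrable P (\<lambda>w. K w w)"
    and mean: "(\<integral>(w, w'). K w w' \<partial>(P \<Otimes>\<^sub>M P)) = 0"
  defines "\<psi> \<equiv> \<lambda>w. (\<integral>w'. K w w' \<partial>P) + (\<integral>w'. K w' w \<partial>P)"
  shows "\<psi> \<in> borel_measurable borel" and "integrable P (\<lambda>w. (\<psi> w)\<^sup>2)" and "(\<integral>w. \<psi> w \<partial>P) = 0"
    and "o_P_one M (\<lambda>n \<omega>. sqrt (real n) * ((1 / (real n)\<^sup>2) * (\<Sum>i=1..n. \<Sum>j=1..n. K (W i \<omega>) (W j \<omega>)))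
      - (1 / sqrt (real n)) * (\<Sum>i=1..n. \<psi> (W i \<omega>)))"
proof -
  define k1 k2 where "k1 = (\<lambda>w. \<integral>w'. K w w' \<partial>P)" and "k2 = (\<lambda>w. \<integral>w'. K w' w \<partial>P)"
  have psi: "\<psi> = (\<lambda>w. k1 w + k2 w)" by (simp add: \<psi>_def k1_def k2_def)
  have k1m[measurable]: "k1 \<in> borel_measurable borel" and k2m[measurable]: "k2 \<in> borel_measurable borel"
    unfolding k1_def k2_def by measurable
  show "\<psi> \<in> borel_measurable borel" unfolding psi by measurable
  have Km: "case_prod K \<in> borel_measurable (P \<Otimes>\<^sub>M P)" by measurable
  have intK: "integrable (P \<Otimes>\<^sub>M P) (case_prod K)"
    using sq by (intro PP.P.square_integrable_imp_integrable[OF Km]) (simp add: case_prod_unfold)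
  have sq': "integrable (P \<Otimes>\<^sub>M P) (\<lambda>(w, w'). (K w' w)\<^sup>2)" and intK': "integrable (P \<Otimes>\<^sub>M P) (\<lambda>(w, w'). K w' w)"
    using PP.integrable_product_swap[OF sq] PP.integrable_product_swap[OF intK] by (simp_all add: case_prod_unfold)
  \<comment> \<open>the variance of \<open>L w\<close> is nonnegative, so the squared mean is at most the mean square\<close>
  have Jensen: "integrable P (\<lambda>w. (\<integral>w'. L w w' \<partial>P)\<^sup>2)"
    if L[measurable]: "case_prod L \<in> borel_measurable (borel \<Otimes>\<^sub>M borel)"
      and L2: "integrable (P \<Otimes>\<^sub>M P) (\<lambda>(w, w'). (L w w')\<^sup>2)" for L :: "'d \<Rightarrow> 'd \<Rightarrow> real"
  proof (rule Bochner_Integration.integrable_bound)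
    show "integrable P (\<lambda>w. \<integral>w'. (L w w')\<^sup>2 \<partial>P)" using PP.integrable_fst'[OF L2] by simp
    have "AE w in P. integrable P (\<lambda>w'. (L w w')\<^sup>2)" using PP.AE_integrable_fst'[OF L2] by simp
    then show "AE w in P. norm ((\<integral>w'. L w w' \<partial>P)\<^sup>2) \<le> norm (\<integral>w'. (L w w')\<^sup>2 \<partial>P)"
    proof eventually_elim
      case (elim w)
      have "integrable P (L w)" by (rule P.square_integrable_imp_integrable) (use elim in simp_all)
      then have "(\<integral>w'. L w w' \<partial>P)\<^sup>2 \<le> (\<integral>w'. (L w w')\<^sup>2 \<partial>P)"
        using P.variance_eq[of "L w"] elim P.variance_positive[of "L w"] by simp
      then show ?case by simp
    qed
  qed measurable
  have k1sq: "integrable P (\<lambda>w. (k1 w)\<^sup>2)" unfolding k1_def by (rule Jensen[OF K sq])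
  have k2sq: "integrable P (\<lambda>w. (k2 w)\<^sup>2)" unfolding k2_def by (rule Jensen[OF _ sq']) measurable
  have k1i: "integrable P k1" and k2i: "integrable P k2"
    using k1sq k2sq by (auto intro!: P.square_integrable_imp_integrable)
  have k1mean: "(\<integral>w. k1 w \<partial>P) = 0" unfolding k1_def using PP.integral_fst'[OF intK] mean by simp
  have k2mean: "(\<integral>w. k2 w \<partial>P) = 0"
    unfolding k2_def using PP.integral_snd[OF intK] mean by simp
  show "(\<integral>w. \<psi> w \<partial>P) = 0" unfolding psi using k1i k2i k1mean k2mean by simp
  have sum_sq: "(s + t)\<^sup>2 \<le> 2 * s\<^sup>2 + 2 * t\<^sup>2" for s t :: real
    using sum_squares_bound[of s t] by (simp add: power2_sum)
  show "integrable P (\<lambda>w. (\<psi> w)\<^sup>2)"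
  proof (rule Bochner_Integration.integrable_bound)
    show "integrable P (\<lambda>w. 2 * (k1 w)\<^sup>2 + 2 * (k2 w)\<^sup>2)" using k1sq k2sq by simp
    show "AE w in P. norm ((\<psi> w)\<^sup>2) \<le> norm (2 * (k1 w)\<^sup>2 + 2 * (k2 w)\<^sup>2)"
      unfolding psi using sum_sq by (auto intro!: AE_I2)
  qed (unfold psi, measurable)
  define D where "D = (\<lambda>w w'. K w w' - k1 w - k2 w')"
  have Dm[measurable]: "case_prod D \<in> borel_measurable (borel \<Otimes>\<^sub>M borel)" unfolding D_def by measurable
  have "o_P_one M (\<lambda>n \<omega>. sqrt (real n) * ((1 / (real n)\<^sup>2) * (\<Sum>i=1..n. \<Sum>j=1..n. D (W i \<omega>) (W j \<omega>))))"
  proof (rule degenerate_V_statistic[OF Dm])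
    show "integrable (P \<Otimes>\<^sub>M P) (\<lambda>(w, w'). (D w w')\<^sup>2)"
    proof (rule Bochner_Integration.integrable_bound)
      let ?B = "\<lambda>p. 2 * (2 * (case p of (w, w') \<Rightarrow> (K w w')\<^sup>2) + 2 * (case p of (w, w') \<Rightarrow> (k1 w)\<^sup>2)) + 2 * (case p of (w, w') \<Rightarrow> (k2 w')\<^sup>2)"
      show "integrable (P \<Otimes>\<^sub>M P) ?B"
        using sq integrable_coordinate(1)[OF k1sq] integrable_coordinate(2)[OF k2sq] by simp
      have "(D w w')\<^sup>2 \<le> ?B (w, w')" for w w'
      proof -
        have "(D w w')\<^sup>2 \<le> 2 * (K w w' - k1 w)\<^sup>2 + 2 * (k2 w')\<^sup>2"
          using sum_sq[of "K w w' - k1 w" "- k2 w'"] by (simp add: D_def)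
        moreover have "(K w w' - k1 w)\<^sup>2 \<le> 2 * (K w w')\<^sup>2 + 2 * (k1 w)\<^sup>2"
          using sum_sq[of "K w w'" "- k1 w"] by simp
        ultimately show ?thesis by simp
      qed
      then show "AE p in P \<Otimes>\<^sub>M P. norm (case p of (w, w') \<Rightarrow> (D w w')\<^sup>2) \<le> norm (?B p)"
        by (intro AE_I2) (auto split: prod.split)
    qed measurable
    have fold_k: "(\<integral>w'. K w w' \<partial>P) = k1 w" "(\<integral>w'. K w' w \<partial>P) = k2 w" for w
      by (simp_all add: k1_def k2_def)
    have prob_UNIV: "P.prob UNIV = 1" using P.prob_space by simp
    have "AE w in P. integrable P (K w)" using PP.AE_integrable_fst'[OF intK] by simp
    then show "AE w in P. (\<integral>w'. D w w' \<partial>P) = 0"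
      by eventually_elim (use k2i k2mean in \<open>simp add: D_def fold_k prob_UNIV\<close>)
    have "AE w in P. integrable P (\<lambda>w'. K w' w)" using PP.AE_integrable_fst'[OF intK'] by simp
    then show "AE w' in P. (\<integral>w. D w w' \<partial>P) = 0"
      by eventually_elim (use k1i k1mean in \<open>simp add: D_def fold_k prob_UNIV\<close>)
    show "integrable P (\<lambda>w. D w w)" unfolding D_def using diag k1i k2i by simp
  qed
  then show "o_P_one M (\<lambda>n \<omega>. sqrt (real n) * ((1 / (real n)\<^sup>2) * (\<Sum>i=1..n. \<Sum>j=1..n. K (W i \<omega>) (W j \<omega>)))
      - (1 / sqrt (real n)) * (\<Sum>i=1..n. \<psi> (W i \<omega>)))"
  proof (rule o_P_one_cong)
    fix n \<omega>
    have "(\<Sum>i=1..n. \<Sum>j=1..n. D (W i \<omega>) (W j \<omega>)) =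
        (\<Sum>i=1..n. \<Sum>j=1..n. K (W i \<omega>) (W j \<omega>)) - real n * (\<Sum>i=1..n. \<psi> (W i \<omega>))"
      by (simp add: D_def psi sum_subtractf sum.distrib sum_distrib_left algebra_simps)
    moreover have "sqrt (real n) * (1 / (real n)\<^sup>2 * (real n * S)) = (1 / sqrt (real n)) * S" for S
      by (cases "n = 0") (simp_all add: field_simps power2_eq_square)
    ultimately show "sqrt (real n) * (1 / (real n)\<^sup>2 * (\<Sum>i=1..n. \<Sum>j=1..n. K (W i \<omega>) (W j \<omega>)))
        - 1 / sqrt (real n) * (\<Sum>i=1..n. \<psi> (W i \<omega>)) =
      sqrt (real n) * (1 / (real n)\<^sup>2 * (\<Sum>i=1..n. \<Sum>j=1..n. D (W i \<omega>) (W j \<omega>)))"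
      by (simp only: right_diff_distrib)
  qed
qed

text \<open>After centring, the projection shows that the error is \<open>1/sqrt n\<close> times a sequence that is bounded
  in probability.\<close>

lemma V_statistic_weak_law:
  fixes K :: "'d \<Rightarrow> 'd \<Rightarrow> real"
  assumes K[measurable]: "case_prod K \<in> borel_measurable (borel \<Otimes>\<^sub>M borel)"
    and sq: "integrable (P \<Otimes>\<^sub>M P) (\<lambda>(w, w'). (K w w')\<^sup>2)"
    and diag: "integrable P (\<lambda>w. K w w)"
  shows "o_P_one M (\<lambda>n \<omega>. (1 / (real n)\<^sup>2) * (\<Sum>i=1..n. \<Sum>j=1..n. K (W i \<omega>) (W j \<omega>))
      - (\<integral>(w, w'). K w w' \<partial>(P \<Otimes>\<^sub>M P)))"
proof -
  define \<theta> where "\<theta> = (\<integral>(w, w'). K w w' \<partial>(P \<Otimes>\<^sub>M P))"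
  define L where "L = (\<lambda>w w'. K w w' - \<theta>)"
  define \<psi> where "\<psi> = (\<lambda>w. (\<integral>w'. L w w' \<partial>P) + (\<integral>w'. L w' w \<partial>P))"
  have Lm[measurable]: "case_prod L \<in> borel_measurable (borel \<Otimes>\<^sub>M borel)" unfolding L_def by measurable
  have Km: "case_prod K \<in> borel_measurable (P \<Otimes>\<^sub>M P)" by measurable
  have intK: "integrable (P \<Otimes>\<^sub>M P) (case_prod K)"
    using sq by (intro PP.P.square_integrable_imp_integrable[OF Km]) (simp add: case_prod_unfold)
  have L_eq: "case_prod L = (\<lambda>p. case_prod K p - \<theta>)" by (auto simp: L_def)
  have sqL: "integrable (P \<Otimes>\<^sub>M P) (\<lambda>(w, w'). (L w w')\<^sup>2)"
  proof -
    have "(\<lambda>(w, w'). (L w w')\<^sup>2) = (\<lambda>p. (case p of (w, w') \<Rightarrow> (K w w')\<^sup>2) - 2 * \<theta> * case_prod K p + \<theta>\<^sup>2)"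
      by (auto simp: L_def power2_diff algebra_simps)
    then show ?thesis using sq intK by simp
  qed
  have diagL: "integrable P (\<lambda>w. L w w)" unfolding L_def using diag by simp
  have meanL: "(\<integral>(w, w'). L w w' \<partial>(P \<Otimes>\<^sub>M P)) = 0"
    unfolding L_eq using intK PP.P.prob_space by (simp add: \<theta>_def)
  have proj: "\<psi> \<in> borel_measurable borel" "integrable P (\<lambda>w. (\<psi> w)\<^sup>2)" "(\<integral>w. \<psi> w \<partial>P) = 0"
    "o_P_one M (\<lambda>n \<omega>. sqrt (real n) * ((1 / (real n)\<^sup>2) * (\<Sum>i=1..n. \<Sum>j=1..n. L (W i \<omega>) (W j \<omega>)))
      - (1 / sqrt (real n)) * (\<Sum>i=1..n. \<psi> (W i \<omega>)))"
    unfolding \<psi>_def by (rule V_statistic_projection[OF Lm sqL diagL meanL])+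
  have sq\<psi>: "integrable P (\<lambda>w. (norm (\<psi> w))\<^sup>2)" using proj(2) by simp
  note Z = normalized_sum_L2[OF proj(1) sq\<psi> proj(3), unfolded real_scaleR_def]
  let ?Z = "\<lambda>n \<omega>. (1 / sqrt (real n)) * (\<Sum>i=1..n. \<psi> (W i \<omega>))"
  let ?V = "\<lambda>n \<omega>. sqrt (real n) * ((1 / (real n)\<^sup>2) * (\<Sum>i=1..n. \<Sum>j=1..n. L (W i \<omega>) (W j \<omega>)))"
  have "O_P_one M (\<lambda>n \<omega>. ?Z n \<omega> + (?V n \<omega> - ?Z n \<omega>))"
    by (rule O_P_one_add_o_P_one[OF Z(4) proj(4)])
  then have V: "O_P_one M ?V" by simp
  have rate: "o_P_one M (\<lambda>n _. 1 / sqrt (real n))"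
  proof (rule o_P_one_of_AE_tendsto)
    show "AE \<omega> in M. (\<lambda>n. 1 / sqrt (real n)) \<longlonglongrightarrow> 0"
      by (intro AE_I2 real_tendsto_divide_at_top[OF tendsto_const]
          filterlim_compose[OF sqrt_at_top filterlim_real_sequentially])
  qed simp
  \<comment> \<open>for \<open>n = 0\<close> the average is \<open>0\<close>, so the error is \<open>- \<theta>\<close>\<close>
  have off: "(1 / (real n)\<^sup>2) * (\<Sum>i=1..n. \<Sum>j=1..n. K (W i \<omega>) (W j \<omega>)) - \<theta> = (1 / sqrt (real n)) * ?V n \<omega> - (if n = 0 then \<theta> else 0)" for n \<omega>
    by (simp add: L_def sum_subtractf power2_eq_square field_simps)
  have "o_P_one M (\<lambda>n \<omega>. (1 / sqrt (real n)) * ?V n \<omega>)"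
    by (rule o_P_one_mult[OF rate V])
       (intro borel_measurable_times borel_measurable_const O_P_one_measurable[OF V], simp only: real_norm_def abs_mult order_refl)
  moreover have "o_P_one M (\<lambda>n _. - (if n = 0 then \<theta> else 0))"
    by (rule o_P_one_of_AE_tendsto)
       (auto intro!: tendsto_eventually eventually_mono[OF eventually_gt_at_top[of 0]])
  ultimately have "o_P_one M (\<lambda>n \<omega>. (1 / sqrt (real n)) * ?V n \<omega> + - (if n = 0 then \<theta> else 0))"
    by (rule o_P_one_add)
  then show ?thesis unfolding \<theta>_def[symmetric] by (rule o_P_one_cong) (use off in simp)
qed

end


section \<open>Random functions of a parameter\<close>

text \<open>By continuity, the least upper bound over \<open>U\<close> is the least upper bound over a countable dense subset
  of \<open>U\<close>, and therefore measurable.\<close>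

lemma measurable_envelope:
  fixes q :: "'z \<Rightarrow> 'b::{metric_space, second_countable_topology} \<Rightarrow> real"
  assumes meas: "\<And>\<beta>. \<beta> \<in> U \<Longrightarrow> (\<lambda>z. q z \<beta>) \<in> borel_measurable N"
    and cont: "\<And>z. z \<in> space N \<Longrightarrow> continuous_on U (q z)"
    and bdd: "\<And>z. z \<in> space N \<Longrightarrow> \<exists>C. \<forall>\<beta>\<in>U. q z \<beta> \<le> C"
    and U: "U \<noteq> {}"
  obtains S where "S \<in> borel_measurable N"
    and "\<And>z \<beta>. z \<in> space N \<Longrightarrow> \<beta> \<in> U \<Longrightarrow> q z \<beta> \<le> S z"
    and "\<And>z C. z \<in> space N \<Longrightarrow> (\<And>\<beta>. \<beta> \<in> U \<Longrightarrow> q z \<beta> \<le> C) \<Longrightarrow> S z \<le> C"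
proof -
  obtain T where T: "countable T" "T \<subseteq> U" "U \<subseteq> closure T" by (rule separable)
  have T0: "T \<noteq> {}" using T(3) U by auto
  define S where "S z = (SUP \<beta>\<in>T. q z \<beta>)" for z
  have bddT: "bdd_above (q z ` T)" if "z \<in> space N" for z
    using bdd[OF that] T(2) by (meson bdd_aboveI2 subsetD)
  have "S \<in> borel_measurable N"
    unfolding S_def using T bddT by (intro borel_measurable_cSUP meas) auto
  moreover have "q z \<beta> \<le> S z" if z: "z \<in> space N" and b: "\<beta> \<in> U" for z \<beta>
  proof -
    obtain t where t: "\<And>n. t n \<in> T" "t \<longlonglongrightarrow> \<beta>"
      using T(3) b closure_sequential by blast
    have "(\<lambda>n. q z (t n)) \<longlonglongrightarrow> q z \<beta>"
      using t b T(2) by (intro continuous_on_tendsto_compose[OF cont[OF z] t(2)] always_eventually) auto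
    moreover have "q z (t n) \<le> S z" for n
      unfolding S_def using t(1) bddT[OF z] by (rule cSUP_upper)
    ultimately show ?thesis by (intro LIMSEQ_le_const2) auto
  qed
  moreover have "S z \<le> C" if "z \<in> space N" "\<And>\<beta>. \<beta> \<in> U \<Longrightarrow> q z \<beta> \<le> C" for z C
    unfolding S_def using T0 T(2) that by (intro cSUP_least) auto
  ultimately show thesis by (rule that)
qed

text \<open>Evaluation of a Caratheodory function at a measurable random point of \<open>B\<close>. The set \<open>B\<close> can be
  arbitrary, so the point is approximated from a countable dense subset of \<open>B\<close>.\<close>

lemma measurable_Caratheodory_compose:
  fixes f :: "'z \<Rightarrow> 'b::{metric_space, second_countable_topology} \<Rightarrow> real"
  assumes meas: "\<And>\<beta>. \<beta> \<in> B \<Longrightarrow> (\<lambda>z. f z \<beta>) \<in> borel_measurable N"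
    and cont: "\<And>z. z \<in> space N \<Longrightarrow> continuous_on B (f z)"
    and b[measurable]: "b \<in> borel_measurable N" and bB: "\<And>z. z \<in> space N \<Longrightarrow> b z \<in> B"
  shows "(\<lambda>z. f z (b z)) \<in> borel_measurable N"
proof (cases "space N = {}")
  case True
  then show ?thesis by (simp add: measurable_def)
next
  case False
  obtain T where T: "countable T" "T \<subseteq> B" "B \<subseteq> closure T" by (rule separable)
  have T0: "T \<noteq> {}" using T(3) bB False by auto
  define d where "d = from_nat_into T"
  have d: "d n \<in> T" for n unfolding d_def using T0 by (rule from_nat_into)
  define \<nu> where "\<nu> k z = (LEAST n. dist (d n) (b z) < 1 / real (Suc k))" for k z
  have \<nu>[measurable]: "\<nu> k \<in> measurable N (count_space UNIV)" for k unfolding \<nu>_def by measurable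
  have close: "dist (d (\<nu> k z)) (b z) < 1 / real (Suc k)" if "z \<in> space N" for k z
    unfolding \<nu>_def
  proof (rule LeastI_ex)
    have "b z \<in> closure T" using T(3) bB[OF that] by auto
    moreover have "0 < 1 / real (Suc k)" by simp
    ultimately obtain t where "t \<in> T" "dist t (b z) < 1 / real (Suc k)"
      unfolding closure_approachable by blast
    moreover then obtain n where "t = d n"
      unfolding d_def using T(1) by (metis from_nat_into_surj)
    ultimately show "\<exists>n. dist (d n) (b z) < 1 / real (Suc k)" by auto
  qed
  show ?thesis
  proof (rule borel_measurable_LIMSEQ_real)
    show "(\<lambda>z. f z (d (\<nu> k z))) \<in> borel_measurable N" for k
      by (rule measurable_compose_countable[OF _ \<nu>]) (use d T(2) in \<open>auto intro!: meas\<close>)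
    fix z assume z: "z \<in> space N"
    have "(\<lambda>k. d (\<nu> k z)) \<longlonglongrightarrow> b z"
    proof (rule tendsto_dist_iff[THEN iffD2], rule tendsto_sandwich)
      show "\<forall>\<^sub>F k in sequentially. 0 \<le> dist (d (\<nu> k z)) (b z)" by simp
      show "\<forall>\<^sub>F k in sequentially. dist (d (\<nu> k z)) (b z) \<le> 1 / real (Suc k)"
        using close[OF z] by (intro always_eventually allI less_imp_le)
      show "(\<lambda>k. 1 / real (Suc k)) \<longlonglongrightarrow> 0" by (rule LIMSEQ_Suc[OF lim_1_over_n])
    qed simp
    then show "(\<lambda>k. f z (d (\<nu> k z))) \<longlonglongrightarrow> f z (b z)"
      by (rule continuous_on_tendsto_compose[OF cont[OF z]]) (use bB[OF z] d T(2) in \<open>auto intro!: always_eventually\<close>)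
  qed
qed

text \<open>The partial derivatives are limits of difference quotients along a fixed sequence of step sizes.\<close>

lemma gradient_measurable:
  fixes f :: "'z \<Rightarrow> 'b::euclidean_space \<Rightarrow> real"
  assumes meas: "\<And>\<beta>. \<beta> \<in> ball \<beta>\<^sub>0 \<delta> \<Longrightarrow> (\<lambda>z. f z \<beta>) \<in> borel_measurable N" and "\<delta> > 0"
    and deriv: "\<And>z. z \<in> space N \<Longrightarrow> (f z has_derivative (\<lambda>v. d z \<bullet> v)) (at \<beta>\<^sub>0)"
  shows "d \<in> borel_measurable N"
proof (rule borel_measurable_euclidean_space[THEN iffD2], rule ballI)
  fix b :: 'b assume b: "b \<in> Basis"
  define s where "s k = \<delta> / 2 / real (Suc k)" for k
  have s: "s k > 0" "s k < \<delta>" for k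
    using \<open>\<delta> > 0\<close> by (auto simp: s_def field_simps intro: order_less_le_trans)
  have s0: "s \<longlonglongrightarrow> 0" unfolding s_def by (rule LIMSEQ_Suc[OF lim_const_over_n])
  show "(\<lambda>z. d z \<bullet> b) \<in> borel_measurable N"
  proof (rule borel_measurable_LIMSEQ_real)
    have "\<beta>\<^sub>0 + s k *\<^sub>R b \<in> ball \<beta>\<^sub>0 \<delta>" "\<beta>\<^sub>0 \<in> ball \<beta>\<^sub>0 \<delta>" for k
      using s[of k] b \<open>\<delta> > 0\<close> by (auto simp: dist_norm)
    then show "(\<lambda>z. (f z (\<beta>\<^sub>0 + s k *\<^sub>R b) - f z \<beta>\<^sub>0) / s k) \<in> borel_measurable N" for k
      using meas by (intro borel_measurable_divide borel_measurable_diff borel_measurable_const) auto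
    fix z assume z: "z \<in> space N"
    have "((\<lambda>t. f z (\<beta>\<^sub>0 + t *\<^sub>R b)) has_derivative (\<lambda>t. d z \<bullet> (t *\<^sub>R b))) (at 0)"
      by (rule has_derivative_compose[where f = "\<lambda>t. \<beta>\<^sub>0 + t *\<^sub>R b" and g = "f z", simplified, rotated])
         (use deriv[OF z] in \<open>auto intro!: derivative_eq_intros\<close>)
    then have "((\<lambda>t. f z (\<beta>\<^sub>0 + t *\<^sub>R b)) has_real_derivative (d z \<bullet> b)) (at 0)"
      unfolding has_field_derivative_def by (rule has_derivative_eq_rhs) (auto simp: fun_eq_iff)
    then have "((\<lambda>t. (f z (\<beta>\<^sub>0 + t *\<^sub>R b) - f z \<beta>\<^sub>0) / t) \<longlongrightarrow> d z \<bullet> b) (at 0)"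
      by (simp add: DERIV_def)
    then show "(\<lambda>k. (f z (\<beta>\<^sub>0 + s k *\<^sub>R b) - f z \<beta>\<^sub>0) / s k) \<longlonglongrightarrow> d z \<bullet> b"
      by (rule filterlim_compose) (use s s0 in \<open>auto simp: filterlim_at less_imp_neq[symmetric]\<close>)
  qed
qed

text \<open>\<open>R k z\<close> is the supremum, over the punctured ball of radius \<open>\<delta> / Suc k\<close>, of the linearization error
  divided by the distance to \<open>\<beta>\<^sub>0\<close>. It tends to \<open>0\<close> for each \<open>z\<close> by differentiability at \<open>\<beta>\<^sub>0\<close>, and is dominated
  by the Lipschitz constant plus the norm of the gradient.\<close>

lemma uniform_linearization:
  fixes h :: "'z \<Rightarrow> 'b::euclidean_space \<Rightarrow> real" and d :: "'z \<Rightarrow> 'b"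
  assumes \<delta>: "\<delta> > 0"
    and meas: "\<And>\<beta>. \<beta> \<in> ball \<beta>\<^sub>0 \<delta> \<Longrightarrow> (\<lambda>z. h z \<beta>) \<in> borel_measurable N"
    and cont: "\<And>z. z \<in> space N \<Longrightarrow> continuous_on (ball \<beta>\<^sub>0 \<delta>) (h z)"
    and deriv: "\<And>z. z \<in> space N \<Longrightarrow> (h z has_derivative (\<lambda>v. d z \<bullet> v)) (at \<beta>\<^sub>0)"
    and lip: "\<And>z \<beta>. z \<in> space N \<Longrightarrow> \<beta> \<in> ball \<beta>\<^sub>0 \<delta> \<Longrightarrow> \<bar>h z \<beta> - h z \<beta>\<^sub>0\<bar> \<le> \<Lambda> z * norm (\<beta> - \<beta>\<^sub>0)"
    and int: "integrable N \<Lambda>" "integrable N (\<lambda>z. norm (d z))"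
  obtains R :: "nat \<Rightarrow> 'z \<Rightarrow> real" where "\<And>k. integrable N (R k)"
    and "\<And>k z. z \<in> space N \<Longrightarrow> 0 \<le> R k z"
    and "\<And>k z \<beta>. z \<in> space N \<Longrightarrow> norm (\<beta> - \<beta>\<^sub>0) < \<delta> / real (Suc k) \<Longrightarrow>
      \<bar>h z \<beta> - h z \<beta>\<^sub>0 - d z \<bullet> (\<beta> - \<beta>\<^sub>0)\<bar> \<le> R k z * norm (\<beta> - \<beta>\<^sub>0)"
    and "(\<lambda>k. integral\<^sup>L N (R k)) \<longlonglongrightarrow> 0"
proof -
  have dm[measurable]: "d \<in> borel_measurable N" by (rule gradient_measurable[OF meas \<delta> deriv])
  define U where "U k = ball \<beta>\<^sub>0 (\<delta> / real (Suc k)) - {\<beta>\<^sub>0}" for k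
  define q where "q z \<beta> = \<bar>h z \<beta> - h z \<beta>\<^sub>0 - d z \<bullet> (\<beta> - \<beta>\<^sub>0)\<bar> / norm (\<beta> - \<beta>\<^sub>0)" for z \<beta>
  have Usub: "U k \<subseteq> ball \<beta>\<^sub>0 \<delta>" for k
  proof -
    have "\<delta> / real (Suc k) \<le> \<delta>" using \<delta> by (simp add: field_simps)
    then show ?thesis by (auto simp: U_def)
  qed
  have U0: "U k \<noteq> {}" for k
  proof -
    obtain b :: 'b where b: "b \<in> Basis" using SOME_Basis by blast
    have "\<beta>\<^sub>0 + (\<delta> / real (Suc k) / 2) *\<^sub>R b \<in> U k"
      using \<delta> b nonzero_Basis[OF b] by (auto simp: U_def dist_norm field_simps add_pos_nonneg)
    then show ?thesis by auto
  qed
  have q_bound: "q z \<beta> \<le> \<Lambda> z + norm (d z)" if "z \<in> space N" "\<beta> \<in> U k" for z \<beta> k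
  proof -
    have "\<bar>h z \<beta> - h z \<beta>\<^sub>0 - d z \<bullet> (\<beta> - \<beta>\<^sub>0)\<bar> \<le> \<bar>h z \<beta> - h z \<beta>\<^sub>0\<bar> + \<bar>d z \<bullet> (\<beta> - \<beta>\<^sub>0)\<bar>" by linarith
    also have "\<dots> \<le> \<Lambda> z * norm (\<beta> - \<beta>\<^sub>0) + norm (d z) * norm (\<beta> - \<beta>\<^sub>0)"
      by (intro add_mono lip[OF that(1) subsetD[OF Usub that(2)]] Cauchy_Schwarz_ineq2)
    finally show ?thesis using that(2) by (simp add: q_def U_def field_simps)
  qed
  have "\<exists>S. S \<in> borel_measurable N \<and> (\<forall>z\<in>space N. \<forall>\<beta>\<in>U k. q z \<beta> \<le> S z) \<and>
      (\<forall>z\<in>space N. \<forall>C. (\<forall>\<beta>\<in>U k. q z \<beta> \<le> C) \<longrightarrow> S z \<le> C)" for k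
  proof -
    have m: "(\<lambda>z. q z \<beta>) \<in> borel_measurable N" if "\<beta> \<in> U k" for \<beta>
    proof -
      have [measurable]: "(\<lambda>z. h z \<beta>) \<in> borel_measurable N" "(\<lambda>z. h z \<beta>\<^sub>0) \<in> borel_measurable N"
        using that Usub \<delta> by (auto intro!: meas)
      show ?thesis unfolding q_def by measurable
    qed
    have c: "continuous_on (U k) (q z)" if "z \<in> space N" for z
      unfolding q_def using continuous_on_subset[OF cont[OF that] Usub]
      by (intro continuous_intros) (auto simp: U_def)
    obtain S where "S \<in> borel_measurable N" "\<And>z \<beta>. z \<in> space N \<Longrightarrow> \<beta> \<in> U k \<Longrightarrow> q z \<beta> \<le> S z"
      "\<And>z C. z \<in> space N \<Longrightarrow> (\<And>\<beta>. \<beta> \<in> U k \<Longrightarrow> q z \<beta> \<le> C) \<Longrightarrow> S z \<le> C"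
      by (rule measurable_envelope[of "U k" q N, OF m c _ U0]) (use q_bound in blast)+
    then show ?thesis by blast
  qed
  then obtain R where Rm[measurable]: "\<And>k. R k \<in> borel_measurable N"
    and Rq: "\<And>k z \<beta>. z \<in> space N \<Longrightarrow> \<beta> \<in> U k \<Longrightarrow> q z \<beta> \<le> R k z"
    and Rleast: "\<And>k z C. z \<in> space N \<Longrightarrow> (\<And>\<beta>. \<beta> \<in> U k \<Longrightarrow> q z \<beta> \<le> C) \<Longrightarrow> R k z \<le> C"
    by metis
  have R0: "0 \<le> R k z" if "z \<in> space N" for k z
  proof -
    obtain \<beta> where b: "\<beta> \<in> U k" using U0 by blast
    have "0 \<le> q z \<beta>" by (simp add: q_def)
    also have "\<dots> \<le> R k z" using Rq[OF that b] .
    finally show ?thesis .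
  qed
  have Rb: "R k z \<le> \<Lambda> z + norm (d z)" if "z \<in> space N" for k z
    using Rleast[OF that] q_bound[OF that] by blast
  have w: "integrable N (\<lambda>z. \<Lambda> z + norm (d z))" using int by simp
  have lim: "(\<lambda>k. R k z) \<longlonglongrightarrow> 0" if z: "z \<in> space N" for z
  proof (rule tendstoI)
    fix e :: real assume e: "e > 0"
    then have "e / 2 > 0" by simp
    then obtain r where r: "r > 0"
      "\<And>\<beta>. norm (\<beta> - \<beta>\<^sub>0) < r \<Longrightarrow> norm (h z \<beta> - h z \<beta>\<^sub>0 - d z \<bullet> (\<beta> - \<beta>\<^sub>0)) \<le> e / 2 * norm (\<beta> - \<beta>\<^sub>0)"
      using deriv[OF z] unfolding has_derivative_at_alt by blast
    have "(\<lambda>k. \<delta> / real (Suc k)) \<longlonglongrightarrow> 0" by (rule LIMSEQ_Suc[OF lim_const_over_n])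
    from order_tendstoD(2)[OF this r(1)]
    show "\<forall>\<^sub>F k in sequentially. dist (R k z) 0 < e"
    proof eventually_elim
      case (elim k)
      have "R k z \<le> e / 2"
      proof (rule Rleast[OF z])
        fix \<beta> assume b: "\<beta> \<in> U k"
        then have "norm (\<beta> - \<beta>\<^sub>0) < r" using elim by (auto simp: U_def dist_norm norm_minus_commute)
        from r(2)[OF this] b show "q z \<beta> \<le> e / 2" by (simp add: q_def U_def field_simps)
      qed
      then show ?case using R0[OF z, of k] e by simp
    qed
  qed
  show thesis
  proof (rule that)
    have "norm (R k z) \<le> norm (\<Lambda> z + norm (d z))" if "z \<in> space N" for k z
      using R0[OF that, of k] Rb[OF that, of k] by simp
    then show "integrable N (R k)" for k
      by (intro Bochner_Integration.integrable_bound[OF w Rm] AE_I2)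
    show "\<bar>h z \<beta> - h z \<beta>\<^sub>0 - d z \<bullet> (\<beta> - \<beta>\<^sub>0)\<bar> \<le> R k z * norm (\<beta> - \<beta>\<^sub>0)"
      if "z \<in> space N" "norm (\<beta> - \<beta>\<^sub>0) < \<delta> / real (Suc k)" for k z \<beta>
    proof (cases "\<beta> = \<beta>\<^sub>0")
      case False
      then have "\<beta> \<in> U k" using that(2) by (simp add: U_def dist_norm norm_minus_commute)
      from Rq[OF that(1) this] False show ?thesis by (simp add: q_def field_simps)
    qed simp
    have "(\<lambda>k. integral\<^sup>L N (R k)) \<longlonglongrightarrow> (\<integral>z. 0 \<partial>N)"
      by (rule integral_dominated_convergence[OF _ _ w]) (use lim R0 Rb in \<open>auto intro!: AE_I2\<close>)
    then show "(\<lambda>k. integral\<^sup>L N (R k)) \<longlonglongrightarrow> 0" by simp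
  qed (rule R0)
qed

text \<open>The envelope \<open>G z\<close> of the gradient over the ball serves as an integrable Lipschitz constant.\<close>

lemma gradient_envelope:
  fixes g :: "'z \<Rightarrow> 'b::euclidean_space \<Rightarrow> real" and gd :: "'z \<Rightarrow> 'b \<Rightarrow> 'b"
  assumes \<delta>: "\<delta> > 0"
    and meas: "\<And>\<beta>. \<beta> \<in> cball \<beta>\<^sub>0 \<delta> \<Longrightarrow> (\<lambda>z. g z \<beta>) \<in> borel_measurable N"
    and deriv: "\<And>z \<beta>. \<beta> \<in> cball \<beta>\<^sub>0 \<delta> \<Longrightarrow> (g z has_derivative (\<lambda>v. gd z \<beta> \<bullet> v)) (at \<beta> within cball \<beta>\<^sub>0 \<delta>)"
    and cont: "\<And>z. continuous_on (cball \<beta>\<^sub>0 \<delta>) (gd z)"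
    and fin: "(\<integral>\<^sup>+z. (SUP \<beta>\<in>cball \<beta>\<^sub>0 \<delta>. ennreal ((norm (gd z \<beta>))\<^sup>2)) \<partial>N) < \<infinity>"
  obtains G where "G \<in> borel_measurable N" and "integrable N (\<lambda>z. (G z)\<^sup>2)"
    and "\<And>z. z \<in> space N \<Longrightarrow> norm (gd z \<beta>\<^sub>0) \<le> G z"
    and "\<And>z \<beta>. z \<in> space N \<Longrightarrow> \<beta> \<in> ball \<beta>\<^sub>0 \<delta> \<Longrightarrow> \<bar>g z \<beta> - g z \<beta>\<^sub>0\<bar> \<le> G z * norm (\<beta> - \<beta>\<^sub>0)"
proof -
  have deriv_at: "(g z has_derivative (\<lambda>v. gd z \<beta> \<bullet> v)) (at \<beta>)" if "\<beta> \<in> ball \<beta>\<^sub>0 \<delta>" for z \<beta>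
    using deriv[of \<beta> z] that at_within_interior[of \<beta> "cball \<beta>\<^sub>0 \<delta>"] by (simp add: interior_cball)
  have gdm: "(\<lambda>z. gd z \<beta>) \<in> borel_measurable N" if b: "\<beta> \<in> ball \<beta>\<^sub>0 \<delta>" for \<beta>
  proof (rule gradient_measurable[where f = g])
    show "\<delta> - dist \<beta>\<^sub>0 \<beta> > 0" using b by simp
    show "(\<lambda>z. g z \<gamma>) \<in> borel_measurable N" if "\<gamma> \<in> ball \<beta> (\<delta> - dist \<beta>\<^sub>0 \<beta>)" for \<gamma>
      using that dist_triangle[of \<beta>\<^sub>0 \<gamma> \<beta>] by (intro meas) simp
  qed (rule deriv_at[OF b])
  have bdd: "\<exists>C. \<forall>\<beta>\<in>ball \<beta>\<^sub>0 \<delta>. norm (gd z \<beta>) \<le> C" for z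
  proof -
    have "bounded (gd z ` cball \<beta>\<^sub>0 \<delta>)"
      by (intro compact_imp_bounded compact_continuous_image cont compact_cball)
    then show ?thesis unfolding bounded_iff using ball_subset_cball[of \<beta>\<^sub>0 \<delta>] by blast
  qed
  obtain G where Gm: "G \<in> borel_measurable N"
    and Gub: "\<And>z \<beta>. z \<in> space N \<Longrightarrow> \<beta> \<in> ball \<beta>\<^sub>0 \<delta> \<Longrightarrow> norm (gd z \<beta>) \<le> G z"
    and Gleast: "\<And>z C. z \<in> space N \<Longrightarrow> (\<And>\<beta>. \<beta> \<in> ball \<beta>\<^sub>0 \<delta> \<Longrightarrow> norm (gd z \<beta>) \<le> C) \<Longrightarrow> G z \<le> C"
  proof (rule measurable_envelope[of "ball \<beta>\<^sub>0 \<delta>" "\<lambda>z \<beta>. norm (gd z \<beta>)" N], goal_cases)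
    case (1 \<beta>)
    from gdm[OF 1(2)] show ?case by measurable
  next
    case (2 z)
    show ?case by (intro continuous_on_norm continuous_on_subset[OF cont ball_subset_cball])
  next
    case (3 z)
    show ?case by (rule bdd)
  next
    case 4
    show ?case using \<delta> by simp
  next
    case (5 S)
    show ?case by (rule that) (fact 5)+
  qed
  have G0: "norm (gd z \<beta>\<^sub>0) \<le> G z" if "z \<in> space N" for z using Gub[OF that] \<delta> by simp
  have "integrable N (\<lambda>z. (G z)\<^sup>2)"
  proof (rule integrableI_bounded)
    have "(\<integral>\<^sup>+z. ennreal (norm ((G z)\<^sup>2)) \<partial>N) \<le> (\<integral>\<^sup>+z. (SUP \<beta>\<in>cball \<beta>\<^sub>0 \<delta>. ennreal ((norm (gd z \<beta>))\<^sup>2)) \<partial>N)"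
    proof (rule nn_integral_mono)
      fix z assume z: "z \<in> space N"
      let ?T = "SUP \<beta>\<in>cball \<beta>\<^sub>0 \<delta>. ennreal ((norm (gd z \<beta>))\<^sup>2)"
      show "ennreal (norm ((G z)\<^sup>2)) \<le> ?T"
      proof (cases ?T)
        case (real t)
        have "norm (gd z \<beta>) \<le> sqrt t" if "\<beta> \<in> ball \<beta>\<^sub>0 \<delta>" for \<beta>
        proof -
          have "ennreal ((norm (gd z \<beta>))\<^sup>2) \<le> ?T" using that by (intro SUP_upper) auto
          then have "(norm (gd z \<beta>))\<^sup>2 \<le> t" using real by simp
          then show ?thesis by (rule real_le_rsqrt)
        qed
        then have "G z \<le> sqrt t" by (rule Gleast[OF z])
        moreover have "0 \<le> G z" using order_trans[OF norm_ge_zero G0[OF z]] .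
        ultimately have "(G z)\<^sup>2 \<le> (sqrt t)\<^sup>2" by (rule power_mono)
        then show ?thesis using real by simp
      next
        case top
        then show ?thesis by (simp only: top_greatest)
      qed
    qed
    also note fin
    finally show "(\<integral>\<^sup>+z. ennreal (norm ((G z)\<^sup>2)) \<partial>N) < \<infinity>" .
  qed (use Gm in measurable)
  moreover have "\<bar>g z \<beta> - g z \<beta>\<^sub>0\<bar> \<le> G z * norm (\<beta> - \<beta>\<^sub>0)" if z: "z \<in> space N" and b: "\<beta> \<in> ball \<beta>\<^sub>0 \<delta>" for z \<beta>
  proof -
    have "norm (g z \<beta> - g z \<beta>\<^sub>0) \<le> G z * norm (\<beta> - \<beta>\<^sub>0)"
    proof (rule differentiable_bound[where S = "ball \<beta>\<^sub>0 \<delta>" and f' = "\<lambda>\<gamma> v. gd z \<gamma> \<bullet> v"])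
      fix \<gamma> assume c: "\<gamma> \<in> ball \<beta>\<^sub>0 \<delta>"
      show "(g z has_derivative (\<lambda>v. gd z \<gamma> \<bullet> v)) (at \<gamma> within ball \<beta>\<^sub>0 \<delta>)"
        using deriv_at[OF c] by (rule has_derivative_at_withinI)
      have "onorm (\<lambda>v. gd z \<gamma> \<bullet> v) \<le> norm (gd z \<gamma>)"
        by (rule onorm_le) (simp add: Cauchy_Schwarz_ineq2)
      then show "onorm (\<lambda>v. gd z \<gamma> \<bullet> v) \<le> G z" using Gub[OF z c] by simp
    qed (use b \<delta> in auto)
    then show ?thesis by simp
  qed
  ultimately show thesis using Gm G0 by (intro that)
qed

lemma bounded_derivative_imp_lipschitz:
  fixes L :: "real \<Rightarrow> real"
  assumes "\<And>t. (L has_real_derivative L' t) (at t)" "\<And>t. \<bar>L' t\<bar> \<le> \<kappa>"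
  shows "\<bar>L s - L t\<bar> \<le> \<kappa> * \<bar>s - t\<bar>"
  using field_differentiable_bound[of UNIV L L' \<kappa> s t] assms by auto

lemma derivative_measurable:
  fixes L :: "real \<Rightarrow> real"
  assumes "\<And>t. (L has_real_derivative L' t) (at t)"
  shows "L \<in> borel_measurable borel" and "L' \<in> borel_measurable borel"
proof -
  show L[measurable]: "L \<in> borel_measurable borel"
    using assms by (intro borel_measurable_continuous_onI DERIV_continuous_on[where D = L']) (simp add: has_field_derivative_at_within)
  show "L' \<in> borel_measurable borel"
  proof (rule gradient_measurable[where f = "\<lambda>t s. L (t + s)" and \<beta>\<^sub>0 = 0 and \<delta> = 1])
    show "((\<lambda>s. L (t + s)) has_derivative (\<lambda>v. L' t \<bullet> v)) (at 0)" for t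
      using assms[of t] DERIV_shift[of L "L' t" 0 t] by (simp add: has_field_derivative_def add.commute)
    show "(\<lambda>t. L (t + s)) \<in> borel_measurable borel" for s by measurable
  qed simp
qed

section \<open>V-statistics at an estimated parameter\<close>

context iid_sample
begin


text \<open>On the event that the estimate lies in the ball of radius \<open>\<delta> / Suc k\<close>, the quotient is bounded by
  the average of \<open>R k (W i, W j)\<close> from \<open>uniform_linearization\<close>. The expectation of this average is at
  most that of \<open>R k\<close>, which is small for large \<open>k\<close>. Diagonal pairs do not have the law
  \<open>P \<Otimes>\<^sub>M P\<close>; their error vanishes since \<open>h w w\<close> is constant.\<close>

lemma V_statistic_linearization:
  fixes h :: "'d \<Rightarrow> 'd \<Rightarrow> 'b::euclidean_space \<Rightarrow> real" and d :: "'d \<Rightarrow> 'd \<Rightarrow> 'b"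
    and bhat :: "nat \<Rightarrow> 'w \<Rightarrow> 'b"
  assumes \<delta>: "\<delta> > 0"
    and meas: "\<And>\<beta>. \<beta> \<in> ball \<beta>\<^sub>0 \<delta> \<Longrightarrow> (\<lambda>(w, w'). h w w' \<beta>) \<in> borel_measurable (borel \<Otimes>\<^sub>M borel)"
    and cont: "\<And>w w'. continuous_on (ball \<beta>\<^sub>0 \<delta>) (h w w')"
    and deriv: "\<And>w w'. (h w w' has_derivative (\<lambda>v. d w w' \<bullet> v)) (at \<beta>\<^sub>0)"
    and lip: "\<And>w w' \<beta>. \<beta> \<in> ball \<beta>\<^sub>0 \<delta> \<Longrightarrow> \<bar>h w w' \<beta> - h w w' \<beta>\<^sub>0\<bar> \<le> \<Lambda> w w' * norm (\<beta> - \<beta>\<^sub>0)"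
    and int: "integrable (P \<Otimes>\<^sub>M P) (case_prod \<Lambda>)" "integrable (P \<Otimes>\<^sub>M P) (\<lambda>(w, w'). norm (d w w'))"
    and diag: "\<And>w \<beta>. h w w \<beta> = h w w \<beta>\<^sub>0" "\<And>w. d w w = 0"
    and bhat[measurable]: "\<And>n. bhat n \<in> borel_measurable M" and cons: "o_P_one M (\<lambda>n \<omega>. bhat n \<omega> - \<beta>\<^sub>0)"
    and hb: "\<And>i j n. i \<ge> 1 \<Longrightarrow> j \<ge> 1 \<Longrightarrow> (\<lambda>\<omega>. h (W i \<omega>) (W j \<omega>) (bhat n \<omega>)) \<in> borel_measurable M"
  shows "o_P_one M (\<lambda>n \<omega>. ((1 / (real n)\<^sup>2) * (\<Sum>i=1..n. \<Sum>j=1..n.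
      h (W i \<omega>) (W j \<omega>) (bhat n \<omega>) - h (W i \<omega>) (W j \<omega>) \<beta>\<^sub>0 - d (W i \<omega>) (W j \<omega>) \<bullet> (bhat n \<omega> - \<beta>\<^sub>0)))
        / norm (bhat n \<omega> - \<beta>\<^sub>0))"
    (is "o_P_one M ?Q")
proof (rule o_P_oneI)
  let ?\<rho> = "\<lambda>i j n \<omega>. h (W i \<omega>) (W j \<omega>) (bhat n \<omega>) - h (W i \<omega>) (W j \<omega>) \<beta>\<^sub>0 - d (W i \<omega>) (W j \<omega>) \<bullet> (bhat n \<omega> - \<beta>\<^sub>0)"
  have dm[measurable]: "(\<lambda>(w, w'). d w w') \<in> borel_measurable (borel \<Otimes>\<^sub>M borel)"
    unfolding case_prod_unfold
    by (rule gradient_measurable[where f = "\<lambda>p. h (fst p) (snd p)" and \<delta> = \<delta> and \<beta>\<^sub>0 = \<beta>\<^sub>0])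
       (use meas \<delta> deriv in \<open>auto simp: case_prod_unfold\<close>)
  have h0[measurable]: "(\<lambda>(w, w'). h w w' \<beta>\<^sub>0) \<in> borel_measurable (borel \<Otimes>\<^sub>M borel)" using \<delta> by (intro meas) simp
  have \<rho>m: "?\<rho> i j n \<in> borel_measurable M" if ij: "i \<in> {1..n}" "j \<in> {1..n}" for i j n
  proof -
    have [measurable]: "W i \<in> borel_measurable M" "W j \<in> borel_measurable M"
      "(\<lambda>\<omega>. h (W i \<omega>) (W j \<omega>) (bhat n \<omega>)) \<in> borel_measurable M"
      using ij by (auto intro!: measurable_W hb)
    show ?thesis by measurable
  qed
  have "(\<lambda>\<omega>. norm (bhat n \<omega> - \<beta>\<^sub>0)) \<in> borel_measurable M" for n by measurable
  then show Qm: "?Q n \<in> borel_measurable M" for n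
    by (intro borel_measurable_divide borel_measurable_times borel_measurable_const borel_measurable_sum \<rho>m)
  have m: "(\<lambda>z. h (fst z) (snd z) \<beta>) \<in> borel_measurable (P \<Otimes>\<^sub>M P)" if "\<beta> \<in> ball \<beta>\<^sub>0 \<delta>" for \<beta>
    using meas[OF that] by (simp add: measurable_PP case_prod_unfold)
  have i: "integrable (P \<Otimes>\<^sub>M P) (\<lambda>z. \<Lambda> (fst z) (snd z))" "integrable (P \<Otimes>\<^sub>M P) (\<lambda>z. norm (d (fst z) (snd z)))"
    using int by (simp_all add: case_prod_unfold)
  obtain R :: "nat \<Rightarrow> 'd \<times> 'd \<Rightarrow> real" where Rint: "\<And>k. integrable (P \<Otimes>\<^sub>M P) (R k)"
    and R0': "\<And>k z. z \<in> space (P \<Otimes>\<^sub>M P) \<Longrightarrow> 0 \<le> R k z"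
    and R': "\<And>k z \<beta>. z \<in> space (P \<Otimes>\<^sub>M P) \<Longrightarrow> norm (\<beta> - \<beta>\<^sub>0) < \<delta> / real (Suc k) \<Longrightarrow>
      \<bar>h (fst z) (snd z) \<beta> - h (fst z) (snd z) \<beta>\<^sub>0 - d (fst z) (snd z) \<bullet> (\<beta> - \<beta>\<^sub>0)\<bar> \<le> R k z * norm (\<beta> - \<beta>\<^sub>0)"
    and Rlim: "(\<lambda>k. integral\<^sup>L (P \<Otimes>\<^sub>M P) (R k)) \<longlonglongrightarrow> 0"
  proof (rule uniform_linearization[OF \<delta> m cont deriv lip i], goal_cases)
    case (3 R)
    show ?case by (rule that) (fact 3)+
  qed
  have R0: "0 \<le> R k z" for k z using R0' by (simp add: space_pair_measure)
  have R: "\<bar>h w w' \<beta> - h w w' \<beta>\<^sub>0 - d w w' \<bullet> (\<beta> - \<beta>\<^sub>0)\<bar> \<le> R k (w, w') * norm (\<beta> - \<beta>\<^sub>0)"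
    if "norm (\<beta> - \<beta>\<^sub>0) < \<delta> / real (Suc k)" for k w w' \<beta>
    using R'[of "(w, w')", OF _ that] by (simp add: space_pair_measure)
  have Rm[measurable]: "R k \<in> borel_measurable (borel \<Otimes>\<^sub>M borel)" for k
    using borel_measurable_integrable[OF Rint] by (simp add: measurable_PP)
  fix \<epsilon> \<eta> :: real assume pos: "\<epsilon> > 0" "\<eta> > 0"
  have "\<forall>\<^sub>F k in sequentially. integral\<^sup>L (P \<Otimes>\<^sub>M P) (R k) < \<epsilon> * (\<eta> / 2)"
    using order_tendstoD(2)[OF Rlim, of "\<epsilon> * (\<eta> / 2)"] pos by simp
  then obtain k where k: "integral\<^sup>L (P \<Otimes>\<^sub>M P) (R k) < \<epsilon> * (\<eta> / 2)"
    by (auto simp: eventually_sequentially)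
  let ?s = "\<delta> / real (Suc k) / 2"
  let ?A = "\<lambda>n \<omega>. (1 / (real n)\<^sup>2) * (\<Sum>i=1..n. \<Sum>j=1..n. if i = j then 0 else R k (W i \<omega>, W j \<omega>))"
  have RW: "integrable M (\<lambda>\<omega>. if i = j then 0 else R k (W i \<omega>, W j \<omega>))"
    "expectation (\<lambda>\<omega>. if i = j then 0 else R k (W i \<omega>, W j \<omega>)) \<le> integral\<^sup>L (P \<Otimes>\<^sub>M P) (R k)"
    if "i \<in> {1..n}" "j \<in> {1..n}" for i j n
    using integral_W_W[of i j "R k"] that Rint[of k] R0
    by (cases "i = j"; auto intro!: integral_nonneg_AE)+
  have Aint: "integrable M (?A n)" for n
    by (intro integrable_mult_right Bochner_Integration.integrable_sum RW(1))
  have A0: "0 \<le> ?A n \<omega>" for n \<omega> by (intro mult_nonneg_nonneg sum_nonneg) (auto simp: R0)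
  have EA: "expectation (?A n) \<le> integral\<^sup>L (P \<Otimes>\<^sub>M P) (R k)" for n
  proof -
    have "expectation (?A n) = (1 / (real n)\<^sup>2) * (\<Sum>i=1..n. \<Sum>j=1..n. expectation (\<lambda>\<omega>. if i = j then 0 else R k (W i \<omega>, W j \<omega>)))"
      by (subst integral_mult_right_zero, subst Bochner_Integration.integral_sum)
         (intro Bochner_Integration.integrable_sum RW(1) sum.cong refl Bochner_Integration.integral_sum
            arg_cong2[where f = "(*)"]; assumption)+
    also have "\<dots> \<le> (1 / (real n)\<^sup>2) * (\<Sum>i=1..n. \<Sum>j=1..n. integral\<^sup>L (P \<Otimes>\<^sub>M P) (R k))"
      by (intro mult_left_mono sum_mono RW(2)) auto
    also have "\<dots> \<le> integral\<^sup>L (P \<Otimes>\<^sub>M P) (R k)"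
      using R0[of k] by (cases "n = 0") (auto simp: power2_eq_square intro!: integral_nonneg_AE)
    finally show ?thesis .
  qed
  have "\<forall>\<^sub>F n in sequentially. measure M {\<omega> \<in> space M. norm (bhat n \<omega> - \<beta>\<^sub>0) > ?s} \<le> \<eta> / 2"
    using pos \<delta> by (intro o_P_oneD[OF cons]) auto
  then show "\<forall>\<^sub>F n in sequentially. measure M {\<omega> \<in> space M. norm (?Q n \<omega>) > \<epsilon>} \<le> \<eta>"
  proof eventually_elim
    case (elim n)
    have A: "measure M {\<omega> \<in> space M. norm (?A n \<omega>) > \<epsilon>} \<le> \<eta> / 2"
    proof -
      have "measure M {\<omega> \<in> space M. norm (?A n \<omega>) > \<epsilon>} \<le> expectation (?A n) / \<epsilon>"
        by (rule tail_Markov[OF borel_measurable_integrable[OF Aint] Aint _ pos(1)])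
           (simp only: real_norm_def abs_of_nonneg[OF A0])
      also have "\<dots> \<le> \<eta> / 2"
        unfolding pos_divide_le_eq[OF pos(1)] using EA[of n] k by (simp only: mult.commute)
      finally show ?thesis .
    qed
    have "measure M {\<omega> \<in> space M. norm (?Q n \<omega>) > \<epsilon>} \<le> \<eta> / 2 + \<eta> / 2"
    proof (rule tail_union_bound[OF _ borel_measurable_integrable[OF Aint] _ elim A])
      fix \<omega> assume s: "norm (bhat n \<omega> - \<beta>\<^sub>0) \<le> ?s" and a: "norm (?A n \<omega>) \<le> \<epsilon>"
      let ?N = "norm (bhat n \<omega> - \<beta>\<^sub>0)"
      have "?s < \<delta> / real (Suc k)" using \<delta> by (simp add: field_simps add_pos_nonneg)
      with s have s': "?N < \<delta> / real (Suc k)" by linarith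
      have "\<bar>\<Sum>i=1..n. \<Sum>j=1..n. ?\<rho> i j n \<omega>\<bar> \<le> (\<Sum>i=1..n. \<Sum>j=1..n. (if i = j then 0 else R k (W i \<omega>, W j \<omega>)) * ?N)"
        using R[OF s'] diag by (intro order_trans[OF sum_abs] sum_mono) auto
      also have "\<dots> = (\<Sum>i=1..n. \<Sum>j=1..n. if i = j then 0 else R k (W i \<omega>, W j \<omega>)) * ?N"
        by (simp only: sum_distrib_right)
      finally have "\<bar>(1 / (real n)\<^sup>2) * (\<Sum>i=1..n. \<Sum>j=1..n. ?\<rho> i j n \<omega>)\<bar> \<le> ?A n \<omega> * ?N"
        by (simp only: abs_mult mult.assoc) (intro mult_mono; simp)
      moreover have "?A n \<omega> \<le> \<epsilon>" using a by (simp only: real_norm_def abs_of_nonneg[OF A0])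
      moreover have "\<bar>X / N\<bar> \<le> \<epsilon>" if "\<bar>X\<bar> \<le> a * N" "a \<le> \<epsilon>" "N \<ge> 0" for X a N :: real
      proof (cases "N = 0")
        case False
        then have "N > 0" using that(3) by simp
        then have "\<bar>X / N\<bar> \<le> a" using that(1) by (simp add: field_simps)
        then show ?thesis using that(2) by linarith
      qed (use pos(1) in simp)
      ultimately show "norm (?Q n \<omega>) \<le> \<epsilon>" by (simp only: real_norm_def norm_ge_zero)
    qed measurable
    then show ?case by simp
  qed
qed

text \<open>The difference of the V-statistics is the linearization error times \<open>\<parallel>sqrt n (bhat n - \<beta>\<^sub>0)\<parallel>\<close>, plus
  the averaged gradient applied to \<open>sqrt n (bhat n - \<beta>\<^sub>0)\<close>. The former is \<open>o\<^sub>P(1) O\<^sub>P(1)\<close>; in the latter the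
  averaged gradient can be replaced by its limit \<open>c\<close>, and then the estimate by its linear expansion.\<close>

lemma V_statistic_delta_method:
  fixes h :: "'d \<Rightarrow> 'd \<Rightarrow> 'b::euclidean_space \<Rightarrow> real" and d :: "'d \<Rightarrow> 'd \<Rightarrow> 'b"
    and bhat :: "nat \<Rightarrow> 'w \<Rightarrow> 'b" and \<phi> :: "'d \<Rightarrow> 'b"
  assumes linearization: "o_P_one M (\<lambda>n \<omega>. ((1 / (real n)\<^sup>2) * (\<Sum>i=1..n. \<Sum>j=1..n.
      h (W i \<omega>) (W j \<omega>) (bhat n \<omega>) - h (W i \<omega>) (W j \<omega>) \<beta>\<^sub>0 - d (W i \<omega>) (W j \<omega>) \<bullet> (bhat n \<omega> - \<beta>\<^sub>0)))
        / norm (bhat n \<omega> - \<beta>\<^sub>0))"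
    and d[measurable]: "(\<lambda>(w, w'). d w w') \<in> borel_measurable (borel \<Otimes>\<^sub>M borel)"
    and d_sq: "integrable (P \<Otimes>\<^sub>M P) (\<lambda>(w, w'). (norm (d w w'))\<^sup>2)" and d_diag: "\<And>w. d w w = 0"
    and \<phi>[measurable]: "\<phi> \<in> borel_measurable borel" and \<phi>_sq: "integrable P (\<lambda>w. (norm (\<phi> w))\<^sup>2)"
    and \<phi>_mean: "(\<integral>w. \<phi> w \<partial>P) = 0"
    and bhat[measurable]: "\<And>n. bhat n \<in> borel_measurable M"
    and expansion: "o_P_one M (\<lambda>n \<omega>. sqrt (real n) *\<^sub>R (bhat n \<omega> - \<beta>\<^sub>0) - (1 / sqrt (real n)) *\<^sub>R (\<Sum>i=1..n. \<phi> (W i \<omega>)))"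
  defines "c \<equiv> (\<integral>(w, w'). d w w' \<partial>(P \<Otimes>\<^sub>M P))"
  shows "o_P_one M (\<lambda>n \<omega>. sqrt (real n) * ((1 / (real n)\<^sup>2) * (\<Sum>i=1..n. \<Sum>j=1..n. h (W i \<omega>) (W j \<omega>) (bhat n \<omega>)))
      - sqrt (real n) * ((1 / (real n)\<^sup>2) * (\<Sum>i=1..n. \<Sum>j=1..n. h (W i \<omega>) (W j \<omega>) \<beta>\<^sub>0))
      - (1 / sqrt (real n)) * (\<Sum>i=1..n. c \<bullet> \<phi> (W i \<omega>)))"
proof -
  let ?b = "\<lambda>n \<omega>. sqrt (real n) *\<^sub>R (bhat n \<omega> - \<beta>\<^sub>0)"
  let ?S = "\<lambda>n \<omega>. (1 / sqrt (real n)) *\<^sub>R (\<Sum>i=1..n. \<phi> (W i \<omega>))"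
  let ?C = "\<lambda>n \<omega>. (1 / (real n)\<^sup>2) *\<^sub>R (\<Sum>i=1..n. \<Sum>j=1..n. d (W i \<omega>) (W j \<omega>))"
  let ?V = "\<lambda>n \<omega> \<beta>. (1 / (real n)\<^sup>2) * (\<Sum>i=1..n. \<Sum>j=1..n. h (W i \<omega>) (W j \<omega>) \<beta>)"
  let ?Q = "\<lambda>n \<omega>. ((1 / (real n)\<^sup>2) * (\<Sum>i=1..n. \<Sum>j=1..n.
      h (W i \<omega>) (W j \<omega>) (bhat n \<omega>) - h (W i \<omega>) (W j \<omega>) \<beta>\<^sub>0 - d (W i \<omega>) (W j \<omega>) \<bullet> (bhat n \<omega> - \<beta>\<^sub>0)))
        / norm (bhat n \<omega> - \<beta>\<^sub>0)"
  have "O_P_one M (\<lambda>n \<omega>. ?S n \<omega> + (?b n \<omega> - ?S n \<omega>))"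
    by (intro O_P_one_add_o_P_one normalized_sum_L2(4) \<phi> \<phi>_sq \<phi>_mean expansion)
  then have b: "O_P_one M ?b" by simp
  have bm: "?b n \<in> borel_measurable M" and nbm: "(\<lambda>\<omega>. norm (?b n \<omega>)) \<in> borel_measurable M" for n by measurable
  have d_int: "integrable (P \<Otimes>\<^sub>M P) (\<lambda>(w, w'). d w w')"
  proof (rule Bochner_Integration.integrable_bound)
    show "integrable (P \<Otimes>\<^sub>M P) (\<lambda>p. 1 + (case p of (w, w') \<Rightarrow> (norm (d w w'))\<^sup>2))" using d_sq by simp
    have "t \<le> 1 + t\<^sup>2" for t :: real
      using sum_squares_bound[of 1 t] zero_le_power2[of t] unfolding one_power2 mult_1_right by linarith
    then show "AE p in P \<Otimes>\<^sub>M P. norm (case p of (w, w') \<Rightarrow> d w w') \<le> norm (1 + (case p of (w, w') \<Rightarrow> (norm (d w w'))\<^sup>2))"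
      by (intro AE_I2) (auto split: prod.split)
  qed measurable
  have C: "o_P_one M (\<lambda>n \<omega>. ?C n \<omega> - c)"
  proof (rule o_P_one_componentwise)
    fix e :: 'b assume e: "e \<in> Basis"
    have "o_P_one M (\<lambda>n \<omega>. (1 / (real n)\<^sup>2) * (\<Sum>i=1..n. \<Sum>j=1..n. d (W i \<omega>) (W j \<omega>) \<bullet> e)
        - (\<integral>(w, w'). d w w' \<bullet> e \<partial>(P \<Otimes>\<^sub>M P)))"
    proof (rule V_statistic_weak_law)
      show "(\<lambda>(w, w'). d w w' \<bullet> e) \<in> borel_measurable (borel \<Otimes>\<^sub>M borel)" by measurable
      show "integrable (P \<Otimes>\<^sub>M P) (\<lambda>(w, w'). (d w w' \<bullet> e)\<^sup>2)"
      proof (rule Bochner_Integration.integrable_bound[OF d_sq])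
        have "(d w w' \<bullet> e)\<^sup>2 \<le> (norm (d w w'))\<^sup>2" for w w'
          using Basis_le_norm[OF e, of "d w w'"] by (metis abs_le_square_iff abs_norm_cancel)
        then show "AE p in P \<Otimes>\<^sub>M P. norm (case p of (w, w') \<Rightarrow> (d w w' \<bullet> e)\<^sup>2) \<le> norm (case p of (w, w') \<Rightarrow> (norm (d w w'))\<^sup>2)"
          by (intro AE_I2) (auto split: prod.split)
      qed measurable
    qed (simp add: d_diag)
    moreover have "(\<integral>(w, w'). d w w' \<bullet> e \<partial>(P \<Otimes>\<^sub>M P)) = c \<bullet> e"
      unfolding c_def using d_int by (subst integral_inner_left[symmetric]) (auto simp: case_prod_unfold)
    ultimately show "o_P_one M (\<lambda>n \<omega>. (?C n \<omega> - c) \<bullet> e)"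
      by (simp add: inner_diff_left inner_sum_left)
  qed
  have Cm: "?C n \<in> borel_measurable M" for n
    using borel_measurable_add[OF o_P_one_measurable[OF C, of n] borel_measurable_const[of c]] by simp
  have "o_P_one M (\<lambda>n \<omega>. norm (?b n \<omega>) * ?Q n \<omega>)"
    by (rule o_P_one_mult[OF linearization b])
       (intro borel_measurable_times nbm o_P_one_measurable[OF linearization],
         simp only: real_norm_def abs_mult abs_norm_cancel mult.commute order_refl)
  moreover have "o_P_one M (\<lambda>n \<omega>. (?C n \<omega> - c) \<bullet> ?b n \<omega>)"
    by (rule o_P_one_mult[OF C b])
       (intro borel_measurable_inner bm o_P_one_measurable[OF C], simp only: real_norm_def Cauchy_Schwarz_ineq2)
  moreover have "o_P_one M (\<lambda>n \<omega>. c \<bullet> (?b n \<omega> - ?S n \<omega>))"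
    by (rule o_P_one_mult[OF expansion O_P_one_const[of c]])
       (intro borel_measurable_inner borel_measurable_const o_P_one_measurable[OF expansion],
         simp only: real_norm_def, subst mult.commute, rule Cauchy_Schwarz_ineq2)
  ultimately have "o_P_one M (\<lambda>n \<omega>. (norm (?b n \<omega>) * ?Q n \<omega> + (?C n \<omega> - c) \<bullet> ?b n \<omega>) + c \<bullet> (?b n \<omega> - ?S n \<omega>))"
    by (intro o_P_one_add)
  then show ?thesis
  proof (rule o_P_one_cong)
    fix n \<omega>
    let ?D = "bhat n \<omega> - \<beta>\<^sub>0"
    have lin: "(1 / (real n)\<^sup>2) * (\<Sum>i=1..n. \<Sum>j=1..n.
        h (W i \<omega>) (W j \<omega>) (bhat n \<omega>) - h (W i \<omega>) (W j \<omega>) \<beta>\<^sub>0 - d (W i \<omega>) (W j \<omega>) \<bullet> ?D)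
        = ?V n \<omega> (bhat n \<omega>) - ?V n \<omega> \<beta>\<^sub>0 - ?C n \<omega> \<bullet> ?D"
      by (simp add: sum_subtractf inner_sum_left right_diff_distrib diff_divide_distrib)
    have "norm (?b n \<omega>) * ?Q n \<omega> = sqrt (real n) * (?V n \<omega> (bhat n \<omega>) - ?V n \<omega> \<beta>\<^sub>0 - ?C n \<omega> \<bullet> ?D)"
      unfolding lin by (cases "?D = 0") (auto simp: norm_scaleR)
    moreover have "(1 / sqrt (real n)) * (\<Sum>i=1..n. c \<bullet> \<phi> (W i \<omega>)) = c \<bullet> ?S n \<omega>"
      by (simp add: inner_sum_right)
    ultimately show "sqrt (real n) * ?V n \<omega> (bhat n \<omega>) - sqrt (real n) * ?V n \<omega> \<beta>\<^sub>0
        - (1 / sqrt (real n)) * (\<Sum>i=1..n. c \<bullet> \<phi> (W i \<omega>))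
      = (norm (?b n \<omega>) * ?Q n \<omega> + (?C n \<omega> - c) \<bullet> ?b n \<omega>) + c \<bullet> (?b n \<omega> - ?S n \<omega>)"
      by (simp only: inner_diff_left inner_diff_right inner_scaleR_right right_diff_distrib)
  qed
qed

lemma normalized_ratio_asymptotics:
  fixes \<psi> :: "'d \<Rightarrow> real" and N Y :: "nat \<Rightarrow> 'w \<Rightarrow> real"
  assumes \<psi>: "\<psi> \<in> borel_measurable borel" "integrable P (\<lambda>w. (\<psi> w)\<^sup>2)" "(\<integral>w. \<psi> w \<partial>P) = 0"
    and Y: "o_P_one M (\<lambda>n \<omega>. Y n \<omega> - (1 / sqrt (real n)) * (\<Sum>i=1..n. \<psi> (W i \<omega>)))"
    and N: "o_P_one M (\<lambda>n \<omega>. N n \<omega> - \<eta>)" and \<eta>: "\<eta> \<noteq> 0"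
  shows "o_P_one M (\<lambda>n \<omega>. (1 / N n \<omega>) * Y n \<omega> - (1 / sqrt (real n)) * (\<Sum>i=1..n. \<psi> (W i \<omega>) / \<eta>))"
proof -
  let ?S = "\<lambda>n \<omega>. (1 / sqrt (real n)) * (\<Sum>i=1..n. \<psi> (W i \<omega>))"
  have sq: "integrable P (\<lambda>w. (norm (\<psi> w))\<^sup>2)" using \<psi>(2) by simp
  have "O_P_one M (\<lambda>n \<omega>. ?S n \<omega> + (Y n \<omega> - ?S n \<omega>))"
    using normalized_sum_L2(4)[OF \<psi>(1) sq \<psi>(3)] Y by (intro O_P_one_add_o_P_one) simp_all
  then have Yb: "O_P_one M Y" by simp
  note inv = o_P_one_inverse[OF N \<eta>]
  have "o_P_one M (\<lambda>n \<omega>. (1 / N n \<omega> - 1 / \<eta>) * Y n \<omega>)"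
    by (rule o_P_one_mult[OF inv Yb])
       (intro borel_measurable_times o_P_one_measurable[OF inv] O_P_one_measurable[OF Yb],
         simp only: real_norm_def abs_mult order_refl)
  moreover have "o_P_one M (\<lambda>n \<omega>. (1 / \<eta>) * (Y n \<omega> - ?S n \<omega>))"
    by (rule o_P_one_mult[OF Y O_P_one_const[of "1 / \<eta>"]])
       (intro borel_measurable_times borel_measurable_const o_P_one_measurable[OF Y],
         simp only: real_norm_def abs_mult mult.commute order_refl)
  ultimately have "o_P_one M (\<lambda>n \<omega>. (1 / N n \<omega> - 1 / \<eta>) * Y n \<omega> + (1 / \<eta>) * (Y n \<omega> - ?S n \<omega>))"
    by (rule o_P_one_add)
  then show ?thesis
    by (rule o_P_one_cong) (simp add: algebra_simps sum_divide_distrib[symmetric])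
qed

end


section \<open>Independence and conditional expectation\<close>

text \<open>By independence of the generated \<open>\<sigma>\<close>-algebras, both sides agree on measurable rectangles.\<close>

lemma (in prob_space) distr_pair_indep_set:
  assumes X[measurable]: "X \<in> measurable M S" and Y[measurable]: "Y \<in> measurable M T"
    and ind: "indep_set (sets (vimage_algebra (space M) X S)) (sets (vimage_algebra (space M) Y T))"
  shows "distr M (S \<Otimes>\<^sub>M T) (\<lambda>\<omega>. (X \<omega>, Y \<omega>)) = distr M S X \<Otimes>\<^sub>M distr M T Y"
proof (rule pair_measure_eqI[symmetric])
  interpret X: prob_space "distr M S X" by (rule prob_space_distr) fact
  interpret Y: prob_space "distr M T Y" by (rule prob_space_distr) fact
  show "sigma_finite_measure (distr M S X)" "sigma_finite_measure (distr M T Y)" by unfold_locales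
  fix A B assume "A \<in> sets (distr M S X)" "B \<in> sets (distr M T Y)"
  then have A: "A \<in> sets S" and B: "B \<in> sets T" by simp_all
  have XS: "X \<in> space M \<rightarrow> space S" "Y \<in> space M \<rightarrow> space T" using measurable_space[OF X] measurable_space[OF Y] by auto
  have "X -` A \<inter> space M \<in> sets (vimage_algebra (space M) X S)"
    "Y -` B \<inter> space M \<in> sets (vimage_algebra (space M) Y T)"
    using A B XS by (auto simp: sets_vimage_algebra2)
  from indep_setD[OF ind this]
  have "emeasure M (X -` A \<inter> space M \<inter> (Y -` B \<inter> space M)) = emeasure M (X -` A \<inter> space M) * emeasure M (Y -` B \<inter> space M)"
    by (simp add: emeasure_eq_measure ennreal_mult)
  moreover have "(\<lambda>\<omega>. (X \<omega>, Y \<omega>)) -` (A \<times> B) \<inter> space M = X -` A \<inter> space M \<inter> (Y -` B \<inter> space M)" by auto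
  ultimately show "emeasure (distr M S X) A * emeasure (distr M T Y) B = emeasure (distr M (S \<Otimes>\<^sub>M T) (\<lambda>\<omega>. (X \<omega>, Y \<omega>))) (A \<times> B)"
    using A B by (simp add: emeasure_distr)
qed simp

text \<open>If \<open>r\<close> and \<open>v\<close> are independent under \<open>P\<close>, taking \<open>v\<close> from a second, independent point does not change
  their joint law.\<close>

lemma decouple_independent_pair:
  fixes H :: "'s \<times> 't \<Rightarrow> real"
  assumes P: "prob_space P" and r[measurable]: "r \<in> measurable P S" and v[measurable]: "v \<in> measurable P T"
    and law: "distr P (S \<Otimes>\<^sub>M T) (\<lambda>w. (r w, v w)) = distr P S r \<Otimes>\<^sub>M distr P T v"
    and H: "H \<in> borel_measurable (S \<Otimes>\<^sub>M T)"
  shows "(\<integral>(w, w'). H (r w, v w') \<partial>(P \<Otimes>\<^sub>M P)) = (\<integral>w. H (r w, v w) \<partial>P)"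
    and "integrable (P \<Otimes>\<^sub>M P) (\<lambda>(w, w'). H (r w, v w')) \<longleftrightarrow> integrable P (\<lambda>w. H (r w, v w))"
proof -
  interpret prob_space P by fact
  interpret T: prob_space "distr P T v" by (rule prob_space_distr) fact
  have eq: "distr P (S \<Otimes>\<^sub>M T) (\<lambda>w. (r w, v w)) = distr (P \<Otimes>\<^sub>M P) (S \<Otimes>\<^sub>M T) (\<lambda>(w, w'). (r w, v w'))"
    unfolding law by (rule pair_measure_distr[OF r v]) unfold_locales
  have m: "(\<lambda>w. (r w, v w)) \<in> measurable P (S \<Otimes>\<^sub>M T)" "(\<lambda>(w, w'). (r w, v w')) \<in> measurable (P \<Otimes>\<^sub>M P) (S \<Otimes>\<^sub>M T)"
    by measurable
  show "(\<integral>(w, w'). H (r w, v w') \<partial>(P \<Otimes>\<^sub>M P)) = (\<integral>w. H (r w, v w) \<partial>P)"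
    using integral_distr[OF m(1) H] integral_distr[OF m(2) H] by (simp add: eq case_prod_unfold)
  show "integrable (P \<Otimes>\<^sub>M P) (\<lambda>(w, w'). H (r w, v w')) \<longleftrightarrow> integrable P (\<lambda>w. H (r w, v w))"
    using integrable_distr_eq[OF m(1) H] integrable_distr_eq[OF m(2) H] by (simp add: eq case_prod_unfold)
qed

text \<open>Conditioning on a function of \<open>W i\<close> freezes it, and the independent point \<open>W j\<close> is integrated out.
  The variables \<open>X\<close> and \<open>Z\<close> allow for expressions in the original data that agree with functions of the
  sample points on \<open>space M\<close> only.\<close>

lemma (in iid_sample) real_cond_exp_W:
  fixes p :: "'d \<Rightarrow> 'e::topological_space" and \<Phi> :: "'e \<Rightarrow> 'd \<Rightarrow> real"
  assumes ij: "i \<ge> 1" "j \<ge> 1" "i \<noteq> j" and p[measurable]: "p \<in> borel_measurable borel"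
    and \<Phi>[measurable]: "case_prod \<Phi> \<in> borel_measurable (borel \<Otimes>\<^sub>M borel)"
    and int: "integrable (P \<Otimes>\<^sub>M P) (\<lambda>(w, w'). \<Phi> (p w) w')"
    and X: "\<And>\<omega>. \<omega> \<in> space M \<Longrightarrow> X \<omega> = p (W i \<omega>)"
    and Z: "\<And>\<omega>. \<omega> \<in> space M \<Longrightarrow> Z \<omega> = \<Phi> (p (W i \<omega>)) (W j \<omega>)"
  defines "F \<equiv> vimage_algebra (space M) X borel"
  shows "AE \<omega> in M. real_cond_exp M F Z \<omega> = (\<integral>w'. \<Phi> (p (W i \<omega>)) w' \<partial>P)"
proof -
  let ?X = "\<lambda>\<omega>. p (W i \<omega>)"
  let ?\<psi> = "\<lambda>e. \<integral>w'. \<Phi> e w' \<partial>P"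
  have [measurable]: "W i \<in> borel_measurable M" "W j \<in> borel_measurable M" using ij by (auto intro: measurable_W)
  have Xm: "?X \<in> borel_measurable M" by measurable
  have \<psi>[measurable]: "?\<psi> \<in> borel_measurable borel" by measurable
  have F: "F = vimage_algebra (space M) ?X borel"
    unfolding F_def by (rule vimage_algebra_cong) (use X in auto)
  have setsF: "sets F = {?X -` S \<inter> space M |S. S \<in> sets borel}" unfolding F by (simp add: sets_vimage_algebra2)
  have sub: "subalgebra M F" unfolding subalgebra_def setsF using measurable_sets[OF Xm] by (auto simp: F)
  interpret F: finite_measure_subalgebra M F by unfold_locales (rule sub)
  have "integrable M (\<lambda>\<omega>. \<Phi> (p (W i \<omega>)) (W j \<omega>))"
    using integral_W_W(2)[OF ij, of "\<lambda>(w, w'). \<Phi> (p w) w'"] int by simp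
  then have intM: "integrable M Z"
    using Bochner_Integration.integrable_cong[OF refl Z, of M] by simp
  have int\<psi>P: "integrable P (\<lambda>w. ?\<psi> (p w))" using PP.integrable_fst'[OF int] by simp
  then have int\<psi>: "integrable M (\<lambda>\<omega>. ?\<psi> (?X \<omega>))"
    using integral_W(2)[OF ij(1), of "\<lambda>w. ?\<psi> (p w)"] by simp
  show "AE \<omega> in M. real_cond_exp M F Z \<omega> = ?\<psi> (?X \<omega>)"
  proof (rule F.real_cond_exp_charact[OF _ intM int\<psi>])
    show "(\<lambda>\<omega>. ?\<psi> (?X \<omega>)) \<in> borel_measurable F"
      unfolding F by (rule measurable_compose[OF measurable_vimage_algebra1 \<psi>]) simp
    fix A assume "A \<in> sets F"
    then obtain S where A: "A = ?X -` S \<inter> space M" and S[measurable]: "S \<in> sets borel"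
      unfolding setsF by blast
    let ?K = "\<lambda>(w, w'). indicator S (p w) * \<Phi> (p w) w'"
    have intK: "integrable (P \<Otimes>\<^sub>M P) ?K"
      by (rule Bochner_Integration.integrable_bound[OF int]) (auto simp: indicator_def measurable_PP)
    have "(\<integral>\<omega>\<in>A. Z \<omega> \<partial>M) = (\<integral>\<omega>. ?K (W i \<omega>, W j \<omega>) \<partial>M)"
      unfolding set_lebesgue_integral_def A by (rule Bochner_Integration.integral_cong) (auto simp: indicator_def Z)
    also have "\<dots> = integral\<^sup>L (P \<Otimes>\<^sub>M P) ?K" by (rule integral_W_W(1)[OF ij]) measurable
    also have "\<dots> = (\<integral>w. indicator S (p w) * ?\<psi> (p w) \<partial>P)"
      using PP.integral_fst'[OF intK] by simp
    also have "\<dots> = (\<integral>\<omega>. indicator S (?X \<omega>) * ?\<psi> (?X \<omega>) \<partial>M)"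
      by (rule integral_W(1)[OF ij(1), symmetric]) measurable
    also have "\<dots> = (\<integral>\<omega>\<in>A. ?\<psi> (?X \<omega>) \<partial>M)"
      unfolding set_lebesgue_integral_def A by (rule Bochner_Integration.integral_cong) (auto simp: indicator_def)
    finally show "(\<integral>\<omega>\<in>A. Z \<omega> \<partial>M) = (\<integral>\<omega>\<in>A. ?\<psi> (?X \<omega>) \<partial>M)" .
  qed
qed

section \<open>The imputation kernel\<close>

text \<open>The indicator of an observed response in a data point \<open>(x, y, a)\<close>. In contrast to the component
  \<open>a\<close> itself it is bounded everywhere, and not just almost surely.\<close>

definition obs :: "'p \<times> real \<times> real \<Rightarrow> real" where
  "obs w = of_bool (snd (snd w) = 1)"

text \<open>The contribution to \<open>V n \<beta>\<close> of the response imputed to the covariate of \<open>w'\<close> from the residual of \<open>w\<close>.\<close>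

definition imputation_kernel ::
  "('p \<Rightarrow> 'q \<Rightarrow> real) \<Rightarrow> (real \<Rightarrow> real) \<Rightarrow> 'p \<times> real \<times> real \<Rightarrow> 'p \<times> real \<times> real \<Rightarrow> 'q \<Rightarrow> real" where
  "imputation_kernel g L w w' \<beta> = obs w * L (g (fst w') \<beta> + (fst (snd w) - g (fst w) \<beta>))"

definition imputation_gradient ::
  "('p \<Rightarrow> 'q \<Rightarrow> real) \<Rightarrow> ('p \<Rightarrow> 'q \<Rightarrow> 'b) \<Rightarrow> (real \<Rightarrow> real) \<Rightarrow> 'p \<times> real \<times> real \<Rightarrow> 'p \<times> real \<times> real \<Rightarrow> 'q \<Rightarrow> 'b::real_vector" where
  "imputation_gradient g gd L' w w' \<beta> =
     (obs w * L' (g (fst w') \<beta> + (fst (snd w) - g (fst w) \<beta>))) *\<^sub>R (gd (fst w') \<beta> - gd (fst w) \<beta>)"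

lemma obs_nonneg: "0 \<le> obs w" and obs_le_1: "obs w \<le> 1"
  by (simp_all add: obs_def)

lemma measurable_triple_components:
  shows "fst \<in> borel_measurable (borel :: ('p::second_countable_topology \<times> real \<times> real) measure)"
    and "(\<lambda>w. fst (snd w)) \<in> borel_measurable (borel :: ('p \<times> real \<times> real) measure)"
    and "(\<lambda>w. snd (snd w)) \<in> borel_measurable (borel :: ('p \<times> real \<times> real) measure)"
    and "obs \<in> borel_measurable (borel :: ('p \<times> real \<times> real) measure)"
proof -
  show c[measurable]: "fst \<in> borel_measurable (borel :: ('p \<times> real \<times> real) measure)"
    "(\<lambda>w. fst (snd w)) \<in> borel_measurable (borel :: ('p \<times> real \<times> real) measure)"
    "(\<lambda>w. snd (snd w)) \<in> borel_measurable (borel :: ('p \<times> real \<times> real) measure)"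
    by (intro borel_measurable_continuous_onI continuous_intros)+
  show "obs \<in> borel_measurable (borel :: ('p \<times> real \<times> real) measure)"
    unfolding obs_def[abs_def] of_bool_def by measurable
qed

lemma imputation_kernel_has_derivative:
  fixes g :: "'p \<Rightarrow> 'b::euclidean_space \<Rightarrow> real"
  assumes g: "\<And>z. (g z has_derivative (\<lambda>v. gd z \<beta> \<bullet> v)) (at \<beta>)"
    and L: "\<And>t. (L has_real_derivative L' t) (at t)"
  shows "(imputation_kernel g L w w' has_derivative (\<lambda>v. imputation_gradient g gd L' w w' \<beta> \<bullet> v)) (at \<beta>)"
proof -
  let ?t = "\<lambda>\<beta>. g (fst w') \<beta> + (fst (snd w) - g (fst w) \<beta>)"
  have t: "(?t has_derivative (\<lambda>v. gd (fst w') \<beta> \<bullet> v + (0 - gd (fst w) \<beta> \<bullet> v))) (at \<beta>)"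
    by (intro has_derivative_add has_derivative_diff has_derivative_const g)
  have "((\<lambda>\<beta>. L (?t \<beta>)) has_derivative (\<lambda>v. L' (?t \<beta>) * (gd (fst w') \<beta> \<bullet> v + (0 - gd (fst w) \<beta> \<bullet> v)))) (at \<beta>)"
    using has_derivative_compose[OF t L[of "?t \<beta>", unfolded has_field_derivative_def]] .
  from has_derivative_mult_right[OF this, of "obs w"] show ?thesis
    unfolding imputation_kernel_def[abs_def]
    by (rule has_derivative_eq_rhs) (simp add: imputation_gradient_def inner_diff_left fun_eq_iff algebra_simps)
qed

lemma imputation_kernel_lipschitz:
  fixes g :: "'p \<Rightarrow> 'q \<Rightarrow> real"
  assumes L: "\<And>s t. \<bar>L s - L t\<bar> \<le> \<kappa> * \<bar>s - t\<bar>"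
  shows "\<bar>imputation_kernel g L w w' \<beta> - imputation_kernel g L w w' \<beta>\<^sub>0\<bar>
    \<le> \<kappa> * (\<bar>g (fst w) \<beta> - g (fst w) \<beta>\<^sub>0\<bar> + \<bar>g (fst w') \<beta> - g (fst w') \<beta>\<^sub>0\<bar>)"
proof -
  have \<kappa>: "\<kappa> \<ge> 0" using L[of 1 0] by simp
  let ?t = "\<lambda>\<beta>. g (fst w') \<beta> + (fst (snd w) - g (fst w) \<beta>)"
  have "\<bar>imputation_kernel g L w w' \<beta> - imputation_kernel g L w w' \<beta>\<^sub>0\<bar> = obs w * \<bar>L (?t \<beta>) - L (?t \<beta>\<^sub>0)\<bar>"
    by (simp add: imputation_kernel_def abs_mult obs_nonneg flip: right_diff_distrib)
  also have "\<dots> \<le> 1 * (\<kappa> * \<bar>?t \<beta> - ?t \<beta>\<^sub>0\<bar>)"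
    by (intro mult_mono L) (auto simp: obs_le_1)
  also have "\<dots> \<le> \<kappa> * (\<bar>g (fst w) \<beta> - g (fst w) \<beta>\<^sub>0\<bar> + \<bar>g (fst w') \<beta> - g (fst w') \<beta>\<^sub>0\<bar>)"
    unfolding mult_1 by (intro mult_left_mono \<kappa>) linarith
  finally show ?thesis .
qed

text \<open>The denominator is the fraction of observed responses. If it is \<open>0\<close>, both sides are \<open>0\<close>: nothing is
  observed or \<open>n = 0\<close>, and \<open>1 / 0 = 0\<close>.\<close>

lemma integral_imputed_distr:
  fixes L :: "real \<Rightarrow> real" and x :: "nat \<Rightarrow> 'w \<Rightarrow> 'p" and y a :: "nat \<Rightarrow> 'w \<Rightarrow> real" and \<omega> :: 'w
  assumes L: "L \<in> borel_measurable borel"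
  defines "W \<equiv> \<lambda>i. (x i \<omega>, y i \<omega>, a i \<omega>)"
  shows "sqrt (real n) * (\<integral>t. L t \<partial>imputed_distr g bhat x y a n \<omega>) =
    (1 / ((1 / real n) * (\<Sum>i=1..n. obs (W i)))) *
      (sqrt (real n) * ((1 / (real n)\<^sup>2) * (\<Sum>i=1..n. \<Sum>j=1..n. imputation_kernel g L (W i) (W j) (bhat n \<omega>))))"
proof -
  let ?A = "observed a n \<omega>" and ?h = "\<lambda>(i, j). imputed g bhat x y n \<omega> i j"
  let ?U = "uniform_count_measure (?A \<times> {1..n})"
  let ?S = "\<Sum>i=1..n. \<Sum>j=1..n. imputation_kernel g L (W i) (W j) (bhat n \<omega>)"
  have fin: "finite ?A" by (simp add: observed_def)
  have h: "?h \<in> measurable ?U borel"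
    by (simp add: measurable_def space_uniform_count_measure sets_uniform_count_measure)
  have "(\<integral>t. L t \<partial>imputed_distr g bhat x y a n \<omega>) = (\<Sum>p\<in>?A \<times> {1..n}. L (?h p)) / real (card (?A \<times> {1..n}))"
    unfolding imputed_distr_def integral_distr[OF h L] using fin by (subst integral_uniform_count_measure) auto
  also have "(\<Sum>p\<in>?A \<times> {1..n}. L (?h p)) = (\<Sum>i\<in>?A. \<Sum>j=1..n. L (imputed g bhat x y n \<omega> i j))"
    by (simp add: sum.cartesian_product split_def)
  also have "\<dots> = ?S"
    unfolding observed_def
    by (subst sum.inter_filter)
       (auto intro!: sum.cong simp: imputation_kernel_def obs_def W_def imputed_def)
  also have "real (card (?A \<times> {1..n})) = (\<Sum>i=1..n. obs (W i)) * real n"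
  proof -
    have "real (card ?A) = (\<Sum>i\<in>{i \<in> {1..n}. a i \<omega> = 1}. 1)" by (simp add: observed_def)
    also have "\<dots> = (\<Sum>i=1..n. if a i \<omega> = 1 then 1 else 0)" by (rule sum.inter_filter) simp
    also have "\<dots> = (\<Sum>i=1..n. obs (W i))" by (intro sum.cong) (auto simp: obs_def W_def)
    finally show ?thesis by (simp add: card_cartesian_product)
  qed
  finally show ?thesis by (simp add: field_simps power2_eq_square)
qed

text \<open>By \<open>law\<close>, the imputed value \<open>r w + g (fst w') \<beta>\<^sub>0\<close> under \<open>P \<Otimes>\<^sub>M P\<close> has the law of the response under \<open>P\<close>.
  This transfers the two moment conditions on \<open>L\<close>. For the mean, \<open>obs w\<close> moreover factors out, since it
  is independent of \<open>r w\<close>.\<close>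

lemma imputation_kernel_moments:
  fixes W :: "nat \<Rightarrow> 'w \<Rightarrow> 'p::second_countable_topology \<times> real \<times> real" and L :: "real \<Rightarrow> real"
  assumes iid: "iid_sample M W P"
    and g0[measurable]: "(\<lambda>z. g z \<beta>\<^sub>0) \<in> borel_measurable borel" and L[measurable]: "L \<in> borel_measurable borel"
  defines "r \<equiv> \<lambda>w. fst (snd w) - g (fst w) \<beta>\<^sub>0"
  assumes law: "distr P (borel \<Otimes>\<^sub>M borel) (\<lambda>w. (r w, (fst w, snd (snd w)))) = distr P borel r \<Otimes>\<^sub>M distr P borel (\<lambda>w. (fst w, snd (snd w)))"
    and sq: "integrable P (\<lambda>w. (L (fst (snd w)))\<^sup>2)" and mean: "(\<integral>w. L (fst (snd w)) \<partial>P) = 0"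
  shows "integrable (P \<Otimes>\<^sub>M P) (\<lambda>(w, w'). (L (r w + g (fst w') \<beta>\<^sub>0))\<^sup>2)"
    and "integrable (P \<Otimes>\<^sub>M P) (\<lambda>(w, w'). (imputation_kernel g L w w' \<beta>\<^sub>0)\<^sup>2)"
    and "(\<integral>(w, w'). imputation_kernel g L w w' \<beta>\<^sub>0 \<partial>(P \<Otimes>\<^sub>M P)) = 0"
    and "integrable P (\<lambda>w. imputation_kernel g L w w \<beta>\<^sub>0)"
    and "(\<lambda>(w, w'). imputation_kernel g L w w' \<beta>\<^sub>0) \<in> borel_measurable (borel \<Otimes>\<^sub>M borel)"
proof -
  interpret iid_sample M W P by fact
  note [measurable] = measurable_triple_components[where 'p = 'p]
  have r[measurable]: "r \<in> borel_measurable borel" unfolding r_def by measurable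
  have kernel: "imputation_kernel g L w w' \<beta>\<^sub>0 = obs w * L (r w + g (fst w') \<beta>\<^sub>0)" for w w'
    by (simp add: imputation_kernel_def r_def add.commute)
  have v: "(\<lambda>w. (fst w, snd (snd w))) \<in> borel_measurable (borel :: ('p \<times> real \<times> real) measure)" by measurable
  have rP: "r \<in> borel_measurable P" and vP: "(\<lambda>w. (fst w, snd (snd w))) \<in> borel_measurable P"
    using r v by (simp_all add: measurable_cong_sets[OF sets_P refl])
  have [measurable]: "fst \<in> borel_measurable (borel :: ('p \<times> real) measure)" "snd \<in> borel_measurable (borel :: ('p \<times> real) measure)"
    by (intro borel_measurable_continuous_onI continuous_intros)+
  note decouple = decouple_independent_pair[OF P.prob_space_axioms rP vP law]
  have y: "r w + g (fst w) \<beta>\<^sub>0 = fst (snd w)" for w by (simp add: r_def)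
  show km[measurable]: "(\<lambda>(w, w'). imputation_kernel g L w w' \<beta>\<^sub>0) \<in> borel_measurable (borel \<Otimes>\<^sub>M borel)"
    unfolding kernel by measurable
  show J: "integrable (P \<Otimes>\<^sub>M P) (\<lambda>(w, w'). (L (r w + g (fst w') \<beta>\<^sub>0))\<^sup>2)"
    using decouple(2)[of "\<lambda>(t, x, a). (L (t + g x \<beta>\<^sub>0))\<^sup>2"] sq by (simp add: y case_prod_unfold)
  show K2: "integrable (P \<Otimes>\<^sub>M P) (\<lambda>(w, w'). (imputation_kernel g L w w' \<beta>\<^sub>0)\<^sup>2)"
  proof (rule Bochner_Integration.integrable_bound[OF J])
    show "(\<lambda>(w, w'). (imputation_kernel g L w w' \<beta>\<^sub>0)\<^sup>2) \<in> borel_measurable (P \<Otimes>\<^sub>M P)"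
      unfolding measurable_PP by measurable
  qed (auto simp: kernel obs_def)
  have Lm: "(\<lambda>(w, w'). L (r w + g (fst w') \<beta>\<^sub>0)) \<in> borel_measurable (P \<Otimes>\<^sub>M P)"
    unfolding measurable_PP by measurable
  have LI: "integrable (P \<Otimes>\<^sub>M P) (\<lambda>(w, w'). L (r w + g (fst w') \<beta>\<^sub>0))"
    using J by (intro PP.P.square_integrable_imp_integrable[OF Lm]) (simp add: case_prod_unfold)
  have KI: "integrable (P \<Otimes>\<^sub>M P) (\<lambda>(w, w'). imputation_kernel g L w w' \<beta>\<^sub>0)"
  proof (rule Bochner_Integration.integrable_bound[OF LI])
    show "(\<lambda>(w, w'). imputation_kernel g L w w' \<beta>\<^sub>0) \<in> borel_measurable (P \<Otimes>\<^sub>M P)"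
      unfolding measurable_PP by measurable
  qed (auto simp: kernel obs_def)
  define m where "m t = (\<integral>w'. L (t + g (fst w') \<beta>\<^sub>0) \<partial>P)" for t
  have mm[measurable]: "m \<in> borel_measurable borel" unfolding m_def by measurable
  have mI: "integrable P (\<lambda>w. m (r w))" using PP.integrable_fst'[OF LI] by (simp add: m_def)
  have m0: "(\<integral>w. m (r w) \<partial>P) = 0"
  proof -
    have "(\<integral>w. m (r w) \<partial>P) = (\<integral>(w, w'). L (r w + g (fst w') \<beta>\<^sub>0) \<partial>(P \<Otimes>\<^sub>M P))"
      using PP.integral_fst'[OF LI] by (simp add: m_def)
    also have "\<dots> = (\<integral>w. L (fst (snd w)) \<partial>P)"
      using decouple(1)[of "\<lambda>(t, x, a). L (t + g x \<beta>\<^sub>0)"] by (simp add: y case_prod_unfold)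
    finally show ?thesis using mean by simp
  qed
  have oI: "integrable (P \<Otimes>\<^sub>M P) (\<lambda>(w, w'). obs w' * m (r w))"
  proof (rule Bochner_Integration.integrable_bound[OF integrable_coordinate(1)[OF mI]])
    show "(\<lambda>(w, w'). obs w' * m (r w)) \<in> borel_measurable (P \<Otimes>\<^sub>M P)"
      unfolding measurable_PP by measurable
  qed (auto simp: obs_def)
  have "(\<integral>(w, w'). imputation_kernel g L w w' \<beta>\<^sub>0 \<partial>(P \<Otimes>\<^sub>M P)) = (\<integral>w. obs w * m (r w) \<partial>P)"
    using PP.integral_fst'[OF KI] by (simp add: kernel m_def)
  also have "\<dots> = (\<integral>(w, w'). obs w' * m (r w) \<partial>(P \<Otimes>\<^sub>M P))"
    using decouple(1)[of "\<lambda>(t, x, a). of_bool (a = 1) * m t"] by (simp add: obs_def case_prod_unfold of_bool_def)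
  also have "\<dots> = (\<integral>w. (\<integral>w'. obs w' * m (r w) \<partial>P) \<partial>P)"
    using PP.integral_fst'[OF oI] by simp
  also have "\<dots> = 0" using m0 by simp
  finally show "(\<integral>(w, w'). imputation_kernel g L w w' \<beta>\<^sub>0 \<partial>(P \<Otimes>\<^sub>M P)) = 0" .
  have yI: "integrable P (\<lambda>w. L (fst (snd w)))"
    by (rule P.square_integrable_imp_integrable[OF _ sq]) measurable
  show "integrable P (\<lambda>w. imputation_kernel g L w w \<beta>\<^sub>0)"
  proof (rule Bochner_Integration.integrable_bound[OF yI])
    show "(\<lambda>w. imputation_kernel g L w w \<beta>\<^sub>0) \<in> borel_measurable P"
      unfolding kernel by measurable
  qed (auto simp: kernel obs_def y)
qed

lemma imputation_gradient_square_integrable: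
  fixes W :: "nat \<Rightarrow> 'w \<Rightarrow> 'p::second_countable_topology \<times> real \<times> real" and gd :: "'p \<Rightarrow> 'b \<Rightarrow> 'b::euclidean_space"
  assumes iid: "iid_sample M W P"
    and m: "(\<lambda>(w, w'). imputation_gradient g gd L' w w' \<beta>\<^sub>0) \<in> borel_measurable (borel \<Otimes>\<^sub>M borel)"
    and L': "\<And>t. \<bar>L' t\<bar> \<le> \<kappa>" and G: "\<And>z. norm (gd z \<beta>\<^sub>0) \<le> G z" and G_sq: "integrable P (\<lambda>w. (G (fst w))\<^sup>2)"
  shows "integrable (P \<Otimes>\<^sub>M P) (\<lambda>(w, w'). (norm (imputation_gradient g gd L' w w' \<beta>\<^sub>0))\<^sup>2)"
proof -
  interpret iid_sample M W P by fact
  have \<kappa>: "\<kappa> \<ge> 0" using L'[of 0] by linarith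
  let ?B = "\<lambda>p. \<kappa>\<^sup>2 * (2 * (case p of (w, w') \<Rightarrow> (G (fst w'))\<^sup>2) + 2 * (case p of (w, w') \<Rightarrow> (G (fst w))\<^sup>2))"
  have B: "integrable (P \<Otimes>\<^sub>M P) ?B" using integrable_coordinate[OF G_sq] by simp
  have "(norm (imputation_gradient g gd L' w w' \<beta>\<^sub>0))\<^sup>2 \<le> ?B (w, w')" for w w'
  proof -
    have "norm (imputation_gradient g gd L' w w' \<beta>\<^sub>0) \<le> (1 * \<kappa>) * (G (fst w') + G (fst w))"
      unfolding imputation_gradient_def norm_scaleR abs_mult
      by (intro mult_mono L' order_trans[OF norm_triangle_ineq4] add_mono G mult_nonneg_nonneg \<kappa>)
         (auto simp: obs_def)
    then have "(norm (imputation_gradient g gd L' w w' \<beta>\<^sub>0))\<^sup>2 \<le> (\<kappa> * (G (fst w') + G (fst w)))\<^sup>2"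
      by (intro power_mono) simp_all
    also have "\<dots> = \<kappa>\<^sup>2 * (G (fst w') + G (fst w))\<^sup>2" by (rule power_mult_distrib)
    also have "\<dots> \<le> ?B (w, w')"
      using sum_squares_bound[of "G (fst w')" "G (fst w)"] by (intro mult_left_mono) (auto simp: power2_sum)
    finally show ?thesis .
  qed
  then have "AE p in P \<Otimes>\<^sub>M P. norm (case p of (w, w') \<Rightarrow> (norm (imputation_gradient g gd L' w w' \<beta>\<^sub>0))\<^sup>2) \<le> norm (?B p)"
    by (intro AE_I2) (auto split: prod.split)
  moreover have "(\<lambda>(w, w'). (norm (imputation_gradient g gd L' w w' \<beta>\<^sub>0))\<^sup>2) \<in> borel_measurable (P \<Otimes>\<^sub>M P)"
    unfolding measurable_PP using m by measurable
  ultimately show ?thesis by (intro Bochner_Integration.integrable_bound[OF B])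
qed

section \<open>Asymptotic normality\<close>

theorem theorem2:
  fixes M :: "'w measure"
    and x :: "nat \<Rightarrow> 'w \<Rightarrow> real ^ 'p"
    and y a u :: "nat \<Rightarrow> 'w \<Rightarrow> real"
    and g :: "real ^ 'p \<Rightarrow> real ^ 'q \<Rightarrow> real"
    and gd :: "real ^ 'p \<Rightarrow> real ^ 'q \<Rightarrow> real ^ 'q"
    and gdd :: "real ^ 'p \<Rightarrow> real ^ 'q \<Rightarrow> real ^ 'q ^ 'q"
    and B :: "(real ^ 'q) set"
    and \<beta>\<^sub>0 c :: "real ^ 'q"
    and est :: "nat \<Rightarrow> ((real ^ 'p) \<times> real) list \<Rightarrow> real ^ 'q"
    and bhat :: "nat \<Rightarrow> 'w \<Rightarrow> real ^ 'q"
    and D :: "real measure set"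
    and T\<^sub>L :: "real measure \<Rightarrow> real"
    and I\<^sub>R :: "(real ^ 'p) \<times> real \<Rightarrow> real ^ 'q"
    and I\<^sub>L I\<^sub>L' :: "real \<Rightarrow> real"
    and Q\<^sub>0 :: "(real ^ 'p) measure"
    and F\<^sub>0 :: "real measure"
    and Fhat :: "nat \<Rightarrow> 'w \<Rightarrow> real measure"
    and \<eta> \<tau>2 :: real
    and e f :: "nat \<Rightarrow> nat \<Rightarrow> 'w \<Rightarrow> real"
    and i j k :: nat
  defines "Q\<^sub>0 \<equiv> distr M borel (x 1)"
    and "F\<^sub>0 \<equiv> distr M borel (y 1)"
    and "bhat \<equiv> \<lambda>n \<omega>. est n (complete_cases x y a n \<omega>)"
    and "Fhat \<equiv> imputed_distr g bhat x y a"
    and "\<eta> \<equiv> (\<integral>\<omega>. a 1 \<omega> \<partial>M)"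
    and "c \<equiv> (\<integral>\<omega>. (a 1 \<omega> * I\<^sub>L' (y 1 \<omega> - g (x 1 \<omega>) \<beta>\<^sub>0 + g (x 2 \<omega>) \<beta>\<^sub>0)) *\<^sub>R
                     (gd (x 2 \<omega>) \<beta>\<^sub>0 - gd (x 1 \<omega>) \<beta>\<^sub>0) \<partial>M)"
    and "e \<equiv> \<lambda>i j \<omega>. a i \<omega> *
                real_cond_exp M (vimage_algebra (space M) (\<lambda>\<omega>. (u i \<omega>, a i \<omega>)) borel)
                  (\<lambda>\<omega>. I\<^sub>L (u i \<omega> + g (x j \<omega>) \<beta>\<^sub>0)) \<omega>"
    and "f \<equiv> \<lambda>i j. real_cond_exp M (vimage_algebra (space M) (x j) borel)
                  (\<lambda>\<omega>. a i \<omega> * I\<^sub>L (u i \<omega> + g (x j \<omega>) \<beta>\<^sub>0))"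
    and "\<tau>2 \<equiv> 1 / \<eta>\<^sup>2 *
                (\<integral>\<omega>. (e i j \<omega> + f k i \<omega> + a i \<omega> * (c \<bullet> I\<^sub>R (x i \<omega>, y i \<omega>)))\<^sup>2 \<partial>M)"
  assumes "prob_space M"
    \<comment> \<open>i.i.d. data and the regression model\<close>
    and "prob_space.indep_vars M (\<lambda>_. borel) (\<lambda>i \<omega>. (x i \<omega>, y i \<omega>, a i \<omega>)) {1..}"
    and "\<And>i. i \<ge> 1 \<Longrightarrow>
           distr M borel (\<lambda>\<omega>. (x i \<omega>, y i \<omega>, a i \<omega>)) = distr M borel (\<lambda>\<omega>. (x 1 \<omega>, y 1 \<omega>, a 1 \<omega>))"
    and "\<And>i \<omega>. i \<ge> 1 \<Longrightarrow> \<omega> \<in> space M \<Longrightarrow> a i \<omega> \<in> {0, 1}"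
    and "\<And>\<beta>. \<beta> \<in> B \<Longrightarrow> (\<lambda>z. g z \<beta>) \<in> borel_measurable borel"
    and "\<beta>\<^sub>0 \<in> B"
    and "\<And>i \<omega>. i \<ge> 1 \<Longrightarrow> \<omega> \<in> space M \<Longrightarrow> y i \<omega> = g (x i \<omega>) \<beta>\<^sub>0 + u i \<omega>"
    and "\<And>i. i \<ge> 1 \<Longrightarrow> prob_space.indep_set M
           (sets (vimage_algebra (space M) (u i) borel))
           (sets (vimage_algebra (space M) (\<lambda>\<omega>. (x i \<omega>, a i \<omega>)) borel))"
    and "\<eta> > 0"
    and "\<And>\<beta> \<alpha>. \<beta> \<in> B \<Longrightarrow> \<beta> \<noteq> \<beta>\<^sub>0 \<Longrightarrow> measure Q\<^sub>0 {z. g z \<beta>\<^sub>0 = g z \<beta> + \<alpha>} < 1"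
    \<comment> \<open>the estimator of \<open>\<beta>\<^sub>0\<close> and the location functional\<close>
    and "\<And>n d. est n d \<in> B"
    and "\<And>n. bhat n \<in> borel_measurable M"
    and "location_functional D T\<^sub>L"
    and "\<And>n. n \<ge> 1 \<Longrightarrow> AE \<omega> in M. observed a n \<omega> \<noteq> {} \<longrightarrow> Fhat n \<omega> \<in> D"
    \<comment> \<open>(A0)\<close>
    and "\<And>z. C2_on_with B (g z) (gd z) (gdd z)"
    and "\<exists>\<delta>>0. cball \<beta>\<^sub>0 \<delta> \<subseteq> B \<and>
           (\<integral>\<^sup>+z. (SUP \<beta>\<in>cball \<beta>\<^sub>0 \<delta>. ennreal ((norm (gd z \<beta>))\<^sup>2)) \<partial>Q\<^sub>0) < \<infinity> \<and>
           (\<integral>\<^sup>+z. (SUP \<beta>\<in>cball \<beta>\<^sub>0 \<delta>. ennreal (norm (gdd z \<beta>))) \<partial>Q\<^sub>0) < \<infinity>"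
    \<comment> \<open>(A1)\<close>
    and "AE \<omega> in M. (\<lambda>n. bhat n \<omega>) \<longlonglongrightarrow> \<beta>\<^sub>0"
    \<comment> \<open>(A2)\<close>
    and "I\<^sub>R \<in> borel_measurable borel"
    and "(\<integral>\<omega>. a 1 \<omega> *\<^sub>R I\<^sub>R (x 1 \<omega>, y 1 \<omega>) \<partial>M) = 0"
    and "integrable M (\<lambda>\<omega>. (norm (a 1 \<omega> *\<^sub>R I\<^sub>R (x 1 \<omega>, y 1 \<omega>)))\<^sup>2)"
    and "o_P_one M (\<lambda>n \<omega>. sqrt (real n) *\<^sub>R (bhat n \<omega> - \<beta>\<^sub>0) -
           (1 / sqrt (real n)) *\<^sub>R (\<Sum>i=1..n. a i \<omega> *\<^sub>R I\<^sub>R (x i \<omega>, y i \<omega>)))"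
    \<comment> \<open>(A3)\<close>
    and "weakly_continuous_at D T\<^sub>L F\<^sub>0"
    \<comment> \<open>(A4)\<close>
    and "\<And>t. (I\<^sub>L has_real_derivative I\<^sub>L' t) (at t)"
    and "bounded (range I\<^sub>L')"
    and "(\<integral>t. I\<^sub>L t \<partial>F\<^sub>0) = 0"
    and "integrable F\<^sub>0 (\<lambda>t. (I\<^sub>L t)\<^sup>2)"
    and "o_P_one M (\<lambda>n \<omega>. sqrt (real n) * (T\<^sub>L (Fhat n \<omega>) - T\<^sub>L F\<^sub>0) -
           sqrt (real n) * (\<integral>t. I\<^sub>L t \<partial>Fhat n \<omega>))"
    \<comment> \<open>the indices in the definition of \<open>\<tau>2\<close>\<close>
    and "i \<ge> 1" and "j \<ge> 1" and "k \<ge> 1" and "j \<noteq> i" and "k \<noteq> i"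
  shows "weak_conv_m (\<lambda>n. distr M borel (\<lambda>\<omega>. sqrt (real n) * (T\<^sub>L (Fhat n \<omega>) - T\<^sub>L F\<^sub>0)))
           (normal_law 0 \<tau>2)"
proof -
  note prob = assms(10) and indep = assms(11) and ident = assms(12) and a01 = assms(13) and g_meas = assms(14)
    and b0B = assms(15) and model = assms(16) and u_indep = assms(17) and \<eta>_pos = assms(18)
    and est_B = assms(20) and bhat_meas = assms(21)
    and C2 = assms(24) and A0 = assms(25) and A1 = assms(26) and I\<^sub>R_meas = assms(27) and I\<^sub>R_mean = assms(28)
    and I\<^sub>R_sq = assms(29) and A2 = assms(30) and I\<^sub>L_deriv = assms(32) and I\<^sub>L'_bdd = assms(33)
    and I\<^sub>L_mean = assms(34) and I\<^sub>L_sq = assms(35) and A4 = assms(36)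
    and ij = assms(37) assms(38) assms(39) assms(40) assms(41)
  define W where "W i \<omega> = (x i \<omega>, y i \<omega>, a i \<omega>)" for i \<omega>
  define P where "P = distr M borel (W 1)"
  have iid: "iid_sample M W P"
  proof (intro iid_sample.intro iid_sample_axioms.intro prob)
    show "prob_space.indep_vars M (\<lambda>_. borel) W {1..}"
      using indep unfolding W_def[abs_def] .
    show "distr M borel (W i) = P" if "i \<ge> 1" for i
      using ident[OF that] unfolding P_def W_def[abs_def] .
  qed
  interpret iid_sample M W P by (rule iid)
  note [measurable] = measurable_triple_components[where 'p = "real ^ 'p"]
  have [measurable]: "fst \<in> borel_measurable (borel :: (real \<times> real) measure)" "snd \<in> borel_measurable (borel :: (real \<times> real) measure)"
    by (intro borel_measurable_continuous_onI continuous_intros)+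

  define r where "r = (\<lambda>w :: (real ^ 'p) \<times> real \<times> real. fst (snd w) - g (fst w) \<beta>\<^sub>0)"
  define \<phi> where "\<phi> = (\<lambda>w :: (real ^ 'p) \<times> real \<times> real. obs w *\<^sub>R I\<^sub>R (fst w, fst (snd w)))"
  define h where "h = imputation_kernel g I\<^sub>L"
  define d where "d w w' = imputation_gradient g gd I\<^sub>L' w w' \<beta>\<^sub>0" for w w'

  have g0_meas[measurable]: "(\<lambda>z. g z \<beta>\<^sub>0) \<in> borel_measurable borel" by (rule g_meas[OF b0B])
  have r_meas[measurable]: "r \<in> borel_measurable borel" unfolding r_def by measurable
  have pair_meas[measurable]: "(\<lambda>w. (fst w, fst (snd w))) \<in> borel_measurable (borel :: ((real ^ 'p) \<times> real \<times> real) measure)"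
    by measurable
  have \<phi>_meas[measurable]: "\<phi> \<in> borel_measurable borel"
    unfolding \<phi>_def using I\<^sub>R_meas by measurable
  have I\<^sub>L_meas[measurable]: "I\<^sub>L \<in> borel_measurable borel" and I\<^sub>L'_meas: "I\<^sub>L' \<in> borel_measurable borel"
    using derivative_measurable[OF I\<^sub>L_deriv] by auto
  obtain \<kappa> where \<kappa>: "\<And>t. \<bar>I\<^sub>L' t\<bar> \<le> \<kappa>" using I\<^sub>L'_bdd by (auto simp: bounded_iff)
  note lip = bounded_derivative_imp_lipschitz[OF I\<^sub>L_deriv \<kappa>]

  have comp_W: "fst (W i \<omega>) = x i \<omega>" "fst (snd (W i \<omega>)) = y i \<omega>" "snd (snd (W i \<omega>)) = a i \<omega>" for i \<omega>
    by (simp_all add: W_def)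
  have a_W: "a i \<omega> = obs (W i \<omega>)" if "i \<ge> 1" "\<omega> \<in> space M" for i \<omega>
    using a01[OF that] by (auto simp: obs_def W_def)
  have u_W: "u i \<omega> = r (W i \<omega>)" if "i \<ge> 1" "\<omega> \<in> space M" for i \<omega>
    using model[OF that] by (simp add: r_def W_def)
  have bB: "bhat n \<omega> \<in> B" for n \<omega> by (simp add: bhat_def est_B)
  have xm: "x i \<in> borel_measurable M" if "i \<ge> 1" for i
    using measurable_compose[OF measurable_W[OF that] measurable_triple_components(1)] by (simp add: comp_W)
  have Q0: "Q\<^sub>0 = distr P borel fst"
    unfolding Q\<^sub>0_def P_def by (subst distr_distr) (auto intro!: measurable_W simp: comp_def comp_W)

  have law: "distr P (borel \<Otimes>\<^sub>M borel) (\<lambda>w. (r w, (fst w, snd (snd w))))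
      = distr P borel r \<Otimes>\<^sub>M distr P borel (\<lambda>w. (fst w, snd (snd w)))"
  proof -
    have X: "(\<lambda>\<omega>. r (W 1 \<omega>)) \<in> borel_measurable M"
      by (rule measurable_compose[OF measurable_W r_meas]) simp
    have vm: "(\<lambda>w. (fst w, snd (snd w))) \<in> borel_measurable (borel :: ((real ^ 'p) \<times> real \<times> real) measure)"
      by measurable
    have V: "(\<lambda>\<omega>. (x 1 \<omega>, a 1 \<omega>)) \<in> borel_measurable M"
      using measurable_compose[OF measurable_W[of 1] vm] by (simp add: comp_W)
    have "vimage_algebra (space M) (u 1) borel = vimage_algebra (space M) (\<lambda>\<omega>. r (W 1 \<omega>)) borel"
      by (rule vimage_algebra_cong) (use u_W[of 1] in auto)
    then have "indep_set (sets (vimage_algebra (space M) (\<lambda>\<omega>. r (W 1 \<omega>)) borel))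
        (sets (vimage_algebra (space M) (\<lambda>\<omega>. (x 1 \<omega>, a 1 \<omega>)) borel))"
      using u_indep[of 1] by simp
    from distr_pair_indep_set[OF X V this]
    have *: "distr M (borel \<Otimes>\<^sub>M borel) (\<lambda>\<omega>. (r (W 1 \<omega>), (x 1 \<omega>, a 1 \<omega>)))
        = distr M borel (\<lambda>\<omega>. r (W 1 \<omega>)) \<Otimes>\<^sub>M distr M borel (\<lambda>\<omega>. (x 1 \<omega>, a 1 \<omega>))" .
    have push: "distr P N k = distr M N (\<lambda>\<omega>. k (W 1 \<omega>))" if "k \<in> measurable borel N" for N :: "'z measure" and k
      unfolding P_def using that by (subst distr_distr) (auto intro!: measurable_W simp: comp_def)
    have pm: "(\<lambda>w. (r w, (fst w, snd (snd w)))) \<in> measurable borel (borel \<Otimes>\<^sub>M borel)"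
      by (rule measurable_Pair[OF r_meas vm])
    show ?thesis using * by (simp add: push[OF pm] push[OF r_meas] push[OF vm] comp_W)
  qed

  have F0: "F\<^sub>0 = distr P borel (\<lambda>w. fst (snd w))"
    unfolding F\<^sub>0_def P_def by (subst distr_distr) (auto intro!: measurable_W simp: comp_def comp_W)
  have ym: "(\<lambda>w. fst (snd w)) \<in> borel_measurable P" by measurable
  have L_sq: "integrable P (\<lambda>w. (I\<^sub>L (fst (snd w)))\<^sup>2)"
    using I\<^sub>L_sq unfolding F0 by (subst (asm) integrable_distr_eq[OF ym]) auto
  have L_mean: "(\<integral>w. I\<^sub>L (fst (snd w)) \<partial>P) = 0"
    using I\<^sub>L_mean unfolding F0 by (subst (asm) integral_distr[OF ym]) auto
  note moments = imputation_kernel_moments[where g = g and \<beta>\<^sub>0 = \<beta>\<^sub>0 and L = I\<^sub>L, OF iid g0_meas I\<^sub>L_meas law[unfolded r_def] L_sq L_mean,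
      folded h_def, folded r_def]
  define \<psi>\<^sub>1 where "\<psi>\<^sub>1 = (\<lambda>w. (\<integral>w'. h w w' \<beta>\<^sub>0 \<partial>P) + (\<integral>w'. h w' w \<beta>\<^sub>0 \<partial>P))"
  have \<psi>1: "\<psi>\<^sub>1 \<in> borel_measurable borel" "integrable P (\<lambda>w. (\<psi>\<^sub>1 w)\<^sup>2)" "(\<integral>w. \<psi>\<^sub>1 w \<partial>P) = 0"
    and proj: "o_P_one M (\<lambda>n \<omega>. sqrt (real n) * ((1 / (real n)\<^sup>2) * (\<Sum>i=1..n. \<Sum>j=1..n. h (W i \<omega>) (W j \<omega>) \<beta>\<^sub>0))
      - (1 / sqrt (real n)) * (\<Sum>i=1..n. \<psi>\<^sub>1 (W i \<omega>)))"
    unfolding \<psi>\<^sub>1_def by (rule V_statistic_projection[OF moments(5,2,4,3)])+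

  have \<phi>_W: "a 1 \<omega> *\<^sub>R I\<^sub>R (x 1 \<omega>, y 1 \<omega>) = \<phi> (W 1 \<omega>)" if "\<omega> \<in> space M" for \<omega>
    using a_W[OF _ that, of 1] by (simp add: \<phi>_def comp_W)
  have \<phi>_sq: "integrable P (\<lambda>w. (norm (\<phi> w))\<^sup>2)"
  proof -
    have "integrable M (\<lambda>\<omega>. (norm (\<phi> (W 1 \<omega>)))\<^sup>2)
        \<longleftrightarrow> integrable M (\<lambda>\<omega>. (norm (a 1 \<omega> *\<^sub>R I\<^sub>R (x 1 \<omega>, y 1 \<omega>)))\<^sup>2)"
      by (intro Bochner_Integration.integrable_cong refl) (simp only: \<phi>_W)
    with I\<^sub>R_sq have "integrable M (\<lambda>\<omega>. (norm (\<phi> (W 1 \<omega>)))\<^sup>2)" by (rule iffD2[rotated])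
    then show ?thesis using integral_W(2)[of 1 "\<lambda>w. (norm (\<phi> w))\<^sup>2"] by simp
  qed
  have \<phi>_mean: "(\<integral>w. \<phi> w \<partial>P) = 0"
  proof -
    have "(\<integral>w. \<phi> w \<partial>P) = (\<integral>\<omega>. \<phi> (W 1 \<omega>) \<partial>M)" by (rule integral_W(1)[symmetric]) simp_all
    also have "\<dots> = (\<integral>\<omega>. a 1 \<omega> *\<^sub>R I\<^sub>R (x 1 \<omega>, y 1 \<omega>) \<partial>M)"
      by (rule Bochner_Integration.integral_cong) (simp_all only: \<phi>_W)
    finally show ?thesis using I\<^sub>R_mean by simp
  qed
  have expansion: "o_P_one M (\<lambda>n \<omega>. sqrt (real n) *\<^sub>R (bhat n \<omega> - \<beta>\<^sub>0) - (1 / sqrt (real n)) *\<^sub>R (\<Sum>i=1..n. \<phi> (W i \<omega>)))"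
  proof (rule o_P_one_cong[OF A2])
    fix n \<omega> assume w: "\<omega> \<in> space M"
    have "(\<Sum>i=1..n. \<phi> (W i \<omega>)) = (\<Sum>i=1..n. a i \<omega> *\<^sub>R I\<^sub>R (x i \<omega>, y i \<omega>))"
      using a_W[OF _ w] by (intro sum.cong) (auto simp: \<phi>_def comp_W)
    then show "sqrt (real n) *\<^sub>R (bhat n \<omega> - \<beta>\<^sub>0) - (1 / sqrt (real n)) *\<^sub>R (\<Sum>i=1..n. \<phi> (W i \<omega>))
        = sqrt (real n) *\<^sub>R (bhat n \<omega> - \<beta>\<^sub>0) - (1 / sqrt (real n)) *\<^sub>R (\<Sum>i=1..n. a i \<omega> *\<^sub>R I\<^sub>R (x i \<omega>, y i \<omega>))"
      by simp
  qed

  obtain \<delta> where \<delta>: "\<delta> > 0" and \<delta>B: "cball \<beta>\<^sub>0 \<delta> \<subseteq> B"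
    and fin: "(\<integral>\<^sup>+z. (SUP \<beta>\<in>cball \<beta>\<^sub>0 \<delta>. ennreal ((norm (gd z \<beta>))\<^sup>2)) \<partial>Q\<^sub>0) < \<infinity>"
    using A0 by blast
  have ballB: "ball \<beta>\<^sub>0 \<delta> \<subseteq> B" using \<delta>B ball_subset_cball by blast
  have g_deriv: "(g z has_derivative (\<lambda>v. gd z \<beta> \<bullet> v)) (at \<beta> within B)" if "\<beta> \<in> B" for z \<beta>
    using C2[of z] that unfolding C2_on_with_def by blast
  have g_cont: "continuous_on B (g z)" for z
    unfolding continuous_on_eq_continuous_within using has_derivative_continuous[OF g_deriv] by blast
  have gd_cont: "continuous_on B (gd z)" for z
    unfolding continuous_on_eq_continuous_within
  proof
    fix \<beta> assume "\<beta> \<in> B"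
    then have "(gd z has_derivative (\<lambda>v. gdd z \<beta> *v v)) (at \<beta> within B)" 
      using C2[of z] unfolding C2_on_with_def by blast
    then show "continuous (at \<beta> within B) (gd z)" by (rule has_derivative_continuous)
  qed
  have "interior B \<supseteq> ball \<beta>\<^sub>0 \<delta>" using ballB by (intro interior_maximal) auto
  then have int0: "\<beta>\<^sub>0 \<in> interior B" using \<delta> by auto
  have g_deriv0: "(g z has_derivative (\<lambda>v. gd z \<beta>\<^sub>0 \<bullet> v)) (at \<beta>\<^sub>0)" for z
    using g_deriv[OF b0B, of z] unfolding at_within_interior[OF int0] .
  obtain G where Gm: "G \<in> borel_measurable Q\<^sub>0" and G_sq: "integrable Q\<^sub>0 (\<lambda>z. (G z)\<^sup>2)"
    and G_grad: "\<And>z. norm (gd z \<beta>\<^sub>0) \<le> G z"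
    and G_lip: "\<And>z \<beta>. \<beta> \<in> ball \<beta>\<^sub>0 \<delta> \<Longrightarrow> \<bar>g z \<beta> - g z \<beta>\<^sub>0\<bar> \<le> G z * norm (\<beta> - \<beta>\<^sub>0)"
  proof (rule gradient_envelope[of \<delta> \<beta>\<^sub>0 g Q\<^sub>0 gd, OF \<delta> _ _ _ fin], goal_cases)
    case (1 \<beta>)
    then show ?case using g_meas[of \<beta>] \<delta>B by (auto simp: Q\<^sub>0_def)
  next
    case (2 z \<beta>)
    then show ?case using g_deriv[of \<beta> z] \<delta>B has_derivative_subset by blast
  next
    case (3 z)
    show ?case by (rule continuous_on_subset[OF gd_cont \<delta>B])
  next
    case (4 G)
    show ?case by (rule 4(1)[of G]) (use 4(2-) in \<open>auto simp: Q\<^sub>0_def\<close>)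
  qed
  have Gm': "G \<in> borel_measurable borel" using Gm by (simp add: Q\<^sub>0_def)
  have fstP: "fst \<in> borel_measurable P" by measurable
  have G_sqP: "integrable P (\<lambda>w. (G (fst w))\<^sup>2)"
    using G_sq Gm' unfolding Q0 by (subst (asm) integrable_distr_eq[OF fstP]) auto
  have G_P: "integrable P (\<lambda>w. G (fst w))"
    by (rule P.square_integrable_imp_integrable[OF _ G_sqP]) (use Gm' in measurable)
  have gd0_meas: "(\<lambda>z. gd z \<beta>\<^sub>0) \<in> borel_measurable borel"
    by (rule gradient_measurable[where f = g and \<delta> = \<delta>]) (use g_meas ballB \<delta> g_deriv0 in auto)
  have d_meas: "(\<lambda>(w, w'). d w w') \<in> borel_measurable (borel \<Otimes>\<^sub>M borel)"
    unfolding d_def imputation_gradient_def using gd0_meas I\<^sub>L'_meas by measurable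
  have d_sq: "integrable (P \<Otimes>\<^sub>M P) (\<lambda>(w, w'). (norm (d w w'))\<^sup>2)"
    unfolding d_def
    by (rule imputation_gradient_square_integrable[OF iid d_meas[unfolded d_def] \<kappa> G_grad G_sqP])
  have h_meas: "(\<lambda>(w, w'). h w w' \<beta>) \<in> borel_measurable (borel \<Otimes>\<^sub>M borel)" if "\<beta> \<in> B" for \<beta>
    unfolding h_def imputation_kernel_def using g_meas[OF that] by measurable
  have h_cont: "continuous_on B (h w w')" for w w'
  proof -
    have L: "continuous_on UNIV I\<^sub>L" by (intro continuous_at_imp_continuous_on ballI DERIV_isCont[OF I\<^sub>L_deriv])
    show ?thesis
      unfolding h_def imputation_kernel_def[abs_def]
      by (intro continuous_intros continuous_on_compose2[OF L] g_cont) auto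
  qed
  have h_deriv: "(h w w' has_derivative (\<lambda>v. d w w' \<bullet> v)) (at \<beta>\<^sub>0)" for w w'
    unfolding h_def d_def by (rule imputation_kernel_has_derivative[where gd = gd and \<beta> = \<beta>\<^sub>0, OF g_deriv0 I\<^sub>L_deriv])
  have h_lip: "\<bar>h w w' \<beta> - h w w' \<beta>\<^sub>0\<bar> \<le> \<kappa> * (G (fst w) + G (fst w')) * norm (\<beta> - \<beta>\<^sub>0)"
    if "\<beta> \<in> ball \<beta>\<^sub>0 \<delta>" for w w' \<beta>
  proof -
    have "\<kappa> \<ge> 0" using \<kappa>[of 0] by linarith
    have "\<bar>h w w' \<beta> - h w w' \<beta>\<^sub>0\<bar> \<le> \<kappa> * (\<bar>g (fst w) \<beta> - g (fst w) \<beta>\<^sub>0\<bar> + \<bar>g (fst w') \<beta> - g (fst w') \<beta>\<^sub>0\<bar>)"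
      unfolding h_def by (rule imputation_kernel_lipschitz[OF lip])
    also have "\<dots> \<le> \<kappa> * (G (fst w) * norm (\<beta> - \<beta>\<^sub>0) + G (fst w') * norm (\<beta> - \<beta>\<^sub>0))"
      by (intro mult_left_mono add_mono G_lip that \<open>\<kappa> \<ge> 0\<close>)
    finally show ?thesis by (simp add: algebra_simps)
  qed
  have cons: "o_P_one M (\<lambda>n \<omega>. bhat n \<omega> - \<beta>\<^sub>0)"
  proof (rule o_P_one_of_AE_tendsto)
    show "(\<lambda>\<omega>. bhat n \<omega> - \<beta>\<^sub>0) \<in> borel_measurable M" for n using bhat_meas[of n] by measurable
    show "AE \<omega> in M. (\<lambda>n. bhat n \<omega> - \<beta>\<^sub>0) \<longlonglongrightarrow> 0"
      using A1 by eventually_elim (rule LIM_zero)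
  qed
  have h_bhat: "(\<lambda>\<omega>. h (W i \<omega>) (W j \<omega>) (bhat n \<omega>)) \<in> borel_measurable M" if "i \<ge> 1" "j \<ge> 1" for i j n
  proof (rule measurable_Caratheodory_compose[where B = B and f = "\<lambda>\<omega>. h (W i \<omega>) (W j \<omega>)"])
    have [measurable]: "W i \<in> borel_measurable M" "W j \<in> borel_measurable M" using that by (auto intro: measurable_W)
    show "(\<lambda>\<omega>. h (W i \<omega>) (W j \<omega>) \<beta>) \<in> borel_measurable M" if "\<beta> \<in> B" for \<beta>
    proof -
      note [measurable] = h_meas[OF that]
      show ?thesis by measurable
    qed
  qed (use h_cont bB bhat_meas in auto)
  have h_diag: "h w w \<beta> = h w w \<beta>\<^sub>0" and d_diag: "d w w = 0" for w \<beta>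
    by (simp_all add: h_def imputation_kernel_def d_def imputation_gradient_def)
  \<comment> \<open>the value of \<open>c\<close> as an integral over two independent data points\<close>
  define c' where "c' = (\<integral>(w, w'). d w w' \<partial>(P \<Otimes>\<^sub>M P))"
  have d_norm: "integrable (P \<Otimes>\<^sub>M P) (\<lambda>(w, w'). norm (d w w'))"
    by (rule PP.P.square_integrable_imp_integrable)
       (use d_sq d_meas in \<open>auto simp: case_prod_unfold measurable_PP\<close>)
  have \<Lambda>_int: "integrable (P \<Otimes>\<^sub>M P) (\<lambda>(w, w'). \<kappa> * (G (fst w) + G (fst w')))"
    using integrable_coordinate[OF G_P] by (simp add: case_prod_unfold)
  have delta: "o_P_one M (\<lambda>n \<omega>. sqrt (real n) * ((1 / (real n)\<^sup>2) * (\<Sum>i=1..n. \<Sum>j=1..n. h (W i \<omega>) (W j \<omega>) (bhat n \<omega>)))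
      - sqrt (real n) * ((1 / (real n)\<^sup>2) * (\<Sum>i=1..n. \<Sum>j=1..n. h (W i \<omega>) (W j \<omega>) \<beta>\<^sub>0))
      - (1 / sqrt (real n)) * (\<Sum>i=1..n. c' \<bullet> \<phi> (W i \<omega>)))"
    unfolding c'_def
  proof (rule V_statistic_delta_method[OF _ d_meas d_sq d_diag \<phi>_meas \<phi>_sq \<phi>_mean bhat_meas expansion])
    show "o_P_one M (\<lambda>n \<omega>. ((1 / (real n)\<^sup>2) * (\<Sum>i=1..n. \<Sum>j=1..n.
      h (W i \<omega>) (W j \<omega>) (bhat n \<omega>) - h (W i \<omega>) (W j \<omega>) \<beta>\<^sub>0 - d (W i \<omega>) (W j \<omega>) \<bullet> (bhat n \<omega> - \<beta>\<^sub>0)))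
        / norm (bhat n \<omega> - \<beta>\<^sub>0))"
      by (rule V_statistic_linearization[OF \<delta> h_meas[OF subsetD[OF ballB]] continuous_on_subset[OF h_cont ballB] h_deriv h_lip
            \<Lambda>_int d_norm h_diag d_diag bhat_meas cons h_bhat])
  qed
  have c_eq: "c = c'"
  proof -
    have "c = (\<integral>\<omega>. (\<lambda>(w, w'). d w w') (W 1 \<omega>, W 2 \<omega>) \<partial>M)"
      unfolding c_def
      by (rule Bochner_Integration.integral_cong)
         (use a_W[of 1] in \<open>simp_all add: d_def imputation_gradient_def comp_W algebra_simps\<close>)
    also have "\<dots> = c'" unfolding c'_def by (rule integral_W_W(1)) (use d_meas in auto)
    finally show ?thesis .
  qed

  define \<psi> where "\<psi> w = \<psi>\<^sub>1 w + c \<bullet> \<phi> w" for w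
  have \<phi>_int: "integrable P \<phi>"
  proof (rule integrable_norm_cancel)
    show "integrable P (\<lambda>w. norm (\<phi> w))"
      by (rule P.square_integrable_imp_integrable[OF _ \<phi>_sq]) measurable
  qed measurable
  have \<psi>: "\<psi> \<in> borel_measurable borel" "integrable P (\<lambda>w. (\<psi> w)\<^sup>2)" "(\<integral>w. \<psi> w \<partial>P) = 0"
  proof -
    note [measurable] = \<psi>1(1)
    show m: "\<psi> \<in> borel_measurable borel" unfolding \<psi>_def[abs_def] by measurable
    show "integrable P (\<lambda>w. (\<psi> w)\<^sup>2)"
    proof (rule Bochner_Integration.integrable_bound)
      show "integrable P (\<lambda>w. 2 * (\<psi>\<^sub>1 w)\<^sup>2 + 2 * ((norm c)\<^sup>2 * (norm (\<phi> w))\<^sup>2))" using \<psi>1(2) \<phi>_sq by simp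
      have "(\<psi> w)\<^sup>2 \<le> 2 * (\<psi>\<^sub>1 w)\<^sup>2 + 2 * ((norm c)\<^sup>2 * (norm (\<phi> w))\<^sup>2)" for w
      proof -
        have "(c \<bullet> \<phi> w)\<^sup>2 \<le> (norm c * norm (\<phi> w))\<^sup>2"
          using Cauchy_Schwarz_ineq2[of c "\<phi> w"] by (metis abs_le_square_iff abs_mult abs_norm_cancel)
        then show ?thesis
          using sum_squares_bound[of "\<psi>\<^sub>1 w" "c \<bullet> \<phi> w"] by (simp add: \<psi>_def power2_sum power_mult_distrib)
      qed
      then show "AE w in P. norm ((\<psi> w)\<^sup>2) \<le> norm (2 * (\<psi>\<^sub>1 w)\<^sup>2 + 2 * ((norm c)\<^sup>2 * (norm (\<phi> w))\<^sup>2))" by (intro AE_I2) simp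
    qed (use m in measurable)
    have "integrable P \<psi>\<^sub>1" by (rule P.square_integrable_imp_integrable[OF _ \<psi>1(2)]) measurable
    then show "(\<integral>w. \<psi> w \<partial>P) = 0" unfolding \<psi>_def using \<psi>1(3) \<phi>_int \<phi>_mean by simp
  qed
  let ?Y = "\<lambda>n \<omega>. sqrt (real n) * ((1 / (real n)\<^sup>2) * (\<Sum>i=1..n. \<Sum>j=1..n. h (W i \<omega>) (W j \<omega>) (bhat n \<omega>)))"
  have Y: "o_P_one M (\<lambda>n \<omega>. ?Y n \<omega> - (1 / sqrt (real n)) * (\<Sum>i=1..n. \<psi> (W i \<omega>)))"
    by (rule o_P_one_cong[OF o_P_one_add[OF delta proj]])
       (simp add: \<psi>_def c_eq sum.distrib distrib_left add_divide_distrib)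

  have \<eta>_P: "(\<integral>w. obs w \<partial>P) = \<eta>"
  proof -
    have "(\<integral>w. obs w \<partial>P) = (\<integral>\<omega>. obs (W 1 \<omega>) \<partial>M)" by (rule integral_W(1)[symmetric]) simp_all
    also have "\<dots> = \<eta>" unfolding \<eta>_def by (rule Bochner_Integration.integral_cong) (use a_W[of 1] in auto)
    finally show ?thesis .
  qed
  let ?N = "\<lambda>n \<omega>. (1 / real n) * (\<Sum>i=1..n. obs (W i \<omega>))"
  have N: "o_P_one M (\<lambda>n \<omega>. ?N n \<omega> - \<eta>)"
  proof -
    have oi: "integrable (P \<Otimes>\<^sub>M P) (\<lambda>(w, w'). obs w)" and oi2: "integrable (P \<Otimes>\<^sub>M P) (\<lambda>(w, w'). (obs w)\<^sup>2)"
      by (rule integrable_coordinate(1), rule P.integrable_const_bound[where B = 1], simp_all add: obs_def)+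
    have "(\<integral>(w, w'). obs w \<partial>(P \<Otimes>\<^sub>M P)) = \<eta>"
      using PP.integral_fst'[OF oi] \<eta>_P P.prob_space by simp
    moreover have "o_P_one M (\<lambda>n \<omega>. (1 / (real n)\<^sup>2) * (\<Sum>i=1..n. \<Sum>j=1..n. obs (W i \<omega>)) - (\<integral>(w, w'). obs w \<partial>(P \<Otimes>\<^sub>M P)))"
      by (rule V_statistic_weak_law[where K = "\<lambda>w w'. obs w", OF _ oi2])
         (measurable, rule P.integrable_const_bound[where B = 1], simp_all add: obs_def)
    ultimately show ?thesis
      by (elim o_P_one_cong) (simp add: sum_distrib_left[symmetric] power2_eq_square)
  qed
  have Z: "o_P_one M (\<lambda>n \<omega>. sqrt (real n) * (T\<^sub>L (Fhat n \<omega>) - T\<^sub>L F\<^sub>0) - (1 / sqrt (real n)) * (\<Sum>i=1..n. \<psi> (W i \<omega>) / \<eta>))"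
  proof (rule o_P_one_cong[OF o_P_one_add[OF A4 normalized_ratio_asymptotics[OF \<psi> Y N]]])
    show "\<eta> \<noteq> 0" using \<eta>_pos by simp
    fix n \<omega>
    have "sqrt (real n) * (\<integral>t. I\<^sub>L t \<partial>Fhat n \<omega>) = (1 / ?N n \<omega>) * ?Y n \<omega>"
      unfolding Fhat_def h_def W_def by (rule integral_imputed_distr[OF I\<^sub>L_meas])
    then show "sqrt (real n) * (T\<^sub>L (Fhat n \<omega>) - T\<^sub>L F\<^sub>0) - (1 / sqrt (real n)) * (\<Sum>i=1..n. \<psi> (W i \<omega>) / \<eta>)
      = (sqrt (real n) * (T\<^sub>L (Fhat n \<omega>) - T\<^sub>L F\<^sub>0) - sqrt (real n) * (\<integral>t. I\<^sub>L t \<partial>Fhat n \<omega>))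
        + ((1 / ?N n \<omega>) * ?Y n \<omega> - (1 / sqrt (real n)) * (\<Sum>i=1..n. \<psi> (W i \<omega>) / \<eta>))"
      by simp
  qed

  have h0: "h w w' \<beta>\<^sub>0 = obs w * I\<^sub>L (r w + g (fst w') \<beta>\<^sub>0)" for w w'
    by (simp add: h_def imputation_kernel_def r_def add.commute)
  \<comment> \<open>\<open>u i\<close> and \<open>a i\<close> are functions of \<open>W i\<close>, so only \<open>W j\<close> is integrated out and \<open>e\<close> is the conditional
      expectation of the kernel given its first argument\<close>
  have e_meas: "e i j \<in> borel_measurable M"
    and e_eq: "AE \<omega> in M. e i j \<omega> = (\<integral>w'. h (W i \<omega>) w' \<beta>\<^sub>0 \<partial>P)"
  proof -
    let ?p = "\<lambda>w :: (real ^ 'p) \<times> real \<times> real. (r w, snd (snd w))"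
    let ?\<Phi> = "\<lambda>(t :: real, s :: real) w' :: (real ^ 'p) \<times> real \<times> real. I\<^sub>L (t + g (fst w') \<beta>\<^sub>0)"
    let ?E = "real_cond_exp M (vimage_algebra (space M) (\<lambda>\<omega>. (u i \<omega>, a i \<omega>)) borel) (\<lambda>\<omega>. I\<^sub>L (u i \<omega> + g (x j \<omega>) \<beta>\<^sub>0))"
    have pm: "?p \<in> borel_measurable borel" by measurable
    have \<Phi>m: "case_prod ?\<Phi> \<in> borel_measurable (borel \<Otimes>\<^sub>M borel)" unfolding case_prod_unfold by measurable
    have Lm: "(\<lambda>(w, w'). I\<^sub>L (r w + g (fst w') \<beta>\<^sub>0)) \<in> borel_measurable (P \<Otimes>\<^sub>M P)"
      unfolding measurable_PP by measurable
    have "integrable (P \<Otimes>\<^sub>M P) (\<lambda>(w, w'). I\<^sub>L (r w + g (fst w') \<beta>\<^sub>0))"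
      by (rule PP.P.square_integrable_imp_integrable[OF Lm])
         (use moments(1) in \<open>simp add: case_prod_unfold r_def\<close>)
    then have int: "integrable (P \<Otimes>\<^sub>M P) (\<lambda>(w, w'). ?\<Phi> (?p w) w')" by simp
    have E: "AE \<omega> in M. ?E \<omega> = (\<integral>w'. ?\<Phi> (?p (W i \<omega>)) w' \<partial>P)"
      using ij u_W[OF ij(1)]
      by (intro real_cond_exp_W[where \<Phi> = ?\<Phi> and p = ?p and j = j, OF ij(1,2) _ pm \<Phi>m int]) (auto simp: comp_W)
    have "a i \<in> borel_measurable M"
      using measurable_compose[OF measurable_W[OF ij(1)] measurable_triple_components(3)] by (simp add: comp_W)
    then show "e i j \<in> borel_measurable M" unfolding e_def by measurable
    show "AE \<omega> in M. e i j \<omega> = (\<integral>w'. h (W i \<omega>) w' \<beta>\<^sub>0 \<partial>P)"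
      using E AE_space
    proof eventually_elim
      case (elim \<omega>)
      then show ?case unfolding e_def h0 using a_W[OF ij(1) elim(2)] by simp
    qed
  qed
  \<comment> \<open>the kernel depends on its second argument only through \<open>x\<close>, so conditioning on \<open>x i\<close> amounts to
      conditioning on \<open>W i\<close>\<close>
  have f_meas: "f k i \<in> borel_measurable M"
    and f_eq: "AE \<omega> in M. f k i \<omega> = (\<integral>w'. h w' (W i \<omega>) \<beta>\<^sub>0 \<partial>P)"
  proof -
    let ?\<Phi> = "\<lambda>z (w' :: (real ^ 'p) \<times> real \<times> real). obs w' * I\<^sub>L (r w' + g z \<beta>\<^sub>0)"
    have \<Phi>m: "case_prod ?\<Phi> \<in> borel_measurable (borel \<Otimes>\<^sub>M borel)" by measurable
    have "integrable (P \<Otimes>\<^sub>M P) (\<lambda>(w, w'). h w w' \<beta>\<^sub>0)"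
      by (rule PP.P.square_integrable_imp_integrable)
         (use moments(5) in \<open>simp add: measurable_PP\<close>, use moments(2) in \<open>simp add: case_prod_unfold\<close>)
    from PP.integrable_product_swap[OF this]
    have int: "integrable (P \<Otimes>\<^sub>M P) (\<lambda>(w, w'). ?\<Phi> (fst w) w')" by (simp add: h0 case_prod_unfold)
    show "f k i \<in> borel_measurable M" unfolding f_def by measurable
    have "AE \<omega> in M. f k i \<omega> = (\<integral>w'. ?\<Phi> (fst (W i \<omega>)) w' \<partial>P)"
      unfolding f_def using ij u_W[OF ij(3)] a_W[OF ij(3)]
      by (intro real_cond_exp_W[where \<Phi> = ?\<Phi> and p = fst and j = k, OF ij(1,3) _ measurable_triple_components(1) \<Phi>m int]) (auto simp: comp_W)
    then show "AE \<omega> in M. f k i \<omega> = (\<integral>w'. h w' (W i \<omega>) \<beta>\<^sub>0 \<partial>P)"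
      by (simp add: h0)
  qed
  have \<tau>: "\<tau>2 = (\<integral>w. (\<psi> w / \<eta>)\<^sup>2 \<partial>P)"
  proof -
    have am: "(\<lambda>\<omega>. c \<bullet> \<phi> (W i \<omega>)) \<in> borel_measurable M"
      using measurable_compose[OF measurable_W[OF ij(1)] \<phi>_meas] by measurable
    have a\<phi>: "a i \<omega> * (c \<bullet> I\<^sub>R (x i \<omega>, y i \<omega>)) = c \<bullet> \<phi> (W i \<omega>)" if "\<omega> \<in> space M" for \<omega>
      using a_W[OF ij(1) that] by (simp add: \<phi>_def comp_W)
    have "(\<integral>\<omega>. (e i j \<omega> + f k i \<omega> + a i \<omega> * (c \<bullet> I\<^sub>R (x i \<omega>, y i \<omega>)))\<^sup>2 \<partial>M)
        = (\<integral>\<omega>. (e i j \<omega> + f k i \<omega> + c \<bullet> \<phi> (W i \<omega>))\<^sup>2 \<partial>M)"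
      by (rule Bochner_Integration.integral_cong) (simp_all only: a\<phi>)
    also have "\<dots> = (\<integral>\<omega>. (\<psi> (W i \<omega>))\<^sup>2 \<partial>M)"
    proof (rule integral_cong_AE)
      show "(\<lambda>\<omega>. (e i j \<omega> + f k i \<omega> + c \<bullet> \<phi> (W i \<omega>))\<^sup>2) \<in> borel_measurable M"
        using e_meas f_meas am by measurable
      show "(\<lambda>\<omega>. (\<psi> (W i \<omega>))\<^sup>2) \<in> borel_measurable M"
        using measurable_compose[OF measurable_W[OF ij(1)] \<psi>(1)] by measurable
      show "AE \<omega> in M. (e i j \<omega> + f k i \<omega> + c \<bullet> \<phi> (W i \<omega>))\<^sup>2 = (\<psi> (W i \<omega>))\<^sup>2"
        using e_eq f_eq by eventually_elim (simp add: \<psi>_def \<psi>\<^sub>1_def)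
    qed
    also have "\<dots> = (\<integral>w. (\<psi> w)\<^sup>2 \<partial>P)" by (rule integral_W(1)[OF ij(1)]) (use \<psi>(1) in measurable)
    finally show ?thesis unfolding \<tau>2_def by (simp add: power_divide)
  qed
  have conv: "weak_conv_m (\<lambda>n. distr M borel (\<lambda>\<omega>. (1 / sqrt (real n)) * (\<Sum>i=1..n. \<psi> (W i \<omega>) / \<eta>))) (normal_law 0 \<tau>2)"
    unfolding \<tau>
  proof (rule iid_central_limit)
    show "(\<lambda>w. \<psi> w / \<eta>) \<in> borel_measurable borel" using \<psi>(1) by measurable
    show "integrable P (\<lambda>w. (\<psi> w / \<eta>)\<^sup>2)" using \<psi>(2) by (simp add: power_divide)
    show "(\<integral>w. \<psi> w / \<eta> \<partial>P) = 0" using \<psi>(3) by simp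
  qed
  show ?thesis
  proof (rule weak_conv_add_o_P_one[OF _ real_distribution_normal_law conv Z])
    show "(\<lambda>\<omega>. (1 / sqrt (real n)) * (\<Sum>i=1..n. \<psi> (W i \<omega>) / \<eta>)) \<in> borel_measurable M" for n
      by (intro borel_measurable_times borel_measurable_const borel_measurable_sum borel_measurable_divide
          measurable_compose[OF measurable_W \<psi>(1)]) auto
  qed
qed

end
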